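(* Let $n\ge2$ and let $\psi\in L^2(\mathbb R^n)$ be an admissible shearlet with admissibility constant $C_\psi=1$. Then for every nonzero $f\in\mathbb H(\mathbb R^n)\cap\mathbb W_1^1(\mathbb R^n)$, $$\int_{\mathbb S}|t|^2\,\big|\mathcal{SH}_{\psi}f(a,s,t)\big|^2\,d\eta\;\ge\;\frac{2}{\|\nabla f\|_{2}}\exp\!\left(\frac{\Gamma'(n/2)}{\Gamma(n/2)}\right)\|f\|_2^3-\|f\|_2^2,$$ provided the left-hand side is defined.
   Context: Fourier transform: $\hat f(\xi)=\mathscr F[f](\xi)=\int_{\mathbb R^n}f(x)e^{-2\pi i\,\xi\cdot x}\,dx$, extended to $L^2(\mathbb R^n)$ by Plancherel. $|t|$ is the Euclidean norm of $t\in\mathbb R^n$, $\Gamma$ is Euler's gamma function, and $\|\nabla f\|_2=\big(\int_{\mathbb R^n}|\nabla f(x)|^2dx\big)^{1/2}$. Function spaces: $\mathbb H(\mathbb R^n)=\{f\in L^2(\mathbb R^n):\nabla f\in L^2(\mathbb R^n)\}$ (weak gradient), and for $1\le p<\infty$, $b>0$, $\mathbb W^p_b(\mathbb R^n)=\{f\in L^p(\mathbb R^n):\langle t\rangle^b f\in L^p(\mathbb R^n)\}$ with $\langle t\rangle=(1+|t|^2)^{1/2}$; thus $\mathbb W_1^1(\mathbb R^n)$ is the case $p=b=1$. For $a\in\mathbb R\setminus\{0\}$ and $s\in\mathbb R^{n-1}$ let $$A_a=\begin{pmatrix} a & 0\\ 0 & \operatorname{sgn}(a)|a|^{1/n}I_{n-1}\end{pmatrix},\qquad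 S_s=\begin{pmatrix}1 & s^T\\ 0 & I_{n-1}\end{pmatrix},\qquad M_{sa}=S_sA_a,$$ so $|\det M_{sa}|=|\det A_a|=|a|^{2-1/n}$. For $\psi\in L^2(\mathbb R^n)$ and $t\in\mathbb R^n$ put $\psi_{a,s,t}(x)=|\det M_{sa}|^{-1/2}\psi\big(M_{sa}^{-1}(x-t)\big)$. The continuous shearlet transform of $f\in L^2(\mathbb R^n)$ is $\mathcal{SH}_\psi f(a,s,t)=\langle f,\psi_{a,s,t}\rangle=\int_{\mathbb R^n}f(x)\overline{\psi_{a,s,t}(x)}\,dx$. Let $\mathbb S=(\mathbb R\setminus\{0\})\times\mathbb R^{n-1}\times\mathbb R^n$ with the measure $d\eta=\dfrac{da\,ds\,dt}{|a|^{n+1}}$. The function $\psi\in L^2(\mathbb R^n)$ is an admissible shearlet if $$C_\psi=\int_{\mathbb R^{n-1}}\int_{\mathbb R\setminus\{0\}}\frac{|\hat\psi(M_{sa}^T\xi)|^2}{|a|^{(n^2-n+1)/n}}\,da\,ds<\infty;$$ this quantity has the same value for every $\xi\in\mathbb R^n$ with $\xi_1\neq0$. *)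

theory Defs
  imports "HOL-Analysis.Analysis"
begin

text \<open>
  The space \<open>\<real>\<^sup>n\<close> with \<open>n \<ge> 2\<close> is \<open>real ^ ('m option)\<close>, where \<open>'m\<close> is an arbitrary finite
  (hence nonempty) type: \<open>n = CARD('m option) = CARD('m) + 1\<close>.  The index \<open>None\<close> is the first
  coordinate, the indices \<open>Some k\<close> are the other \<open>n - 1\<close> ones, and \<open>real ^ 'm\<close> is
  \<open>\<real>\<^sup>n\<^sup>-\<^sup>1\<close>.  Elements of function spaces are functions, not classes modulo null sets.
\<close>

type_synonym 'm vec_n = "real ^ ('m option)"


subsection \<open>Function spaces\<close>

definition Lp :: "real \<Rightarrow> ('a::euclidean_space \<Rightarrow> 'b::euclidean_space) set" where
  "Lp p = {f \<in> borel_measurable lebesgue. integrable lebesgue (\<lambda>x. norm (f x) powr p)}"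

definition L2_norm :: "('a::euclidean_space \<Rightarrow> 'b::euclidean_space) \<Rightarrow> real" where
  "L2_norm f = sqrt (\<integral>x. (norm (f x))\<^sup>2 \<partial>lebesgue)"

definition weighted_Lp :: "real \<Rightarrow> real \<Rightarrow> ('a::euclidean_space \<Rightarrow> complex) set" where
  "weighted_Lp p b =
     {f \<in> Lp p. (\<lambda>t. complex_of_real (sqrt (1 + (norm t)\<^sup>2) powr b) * f t) \<in> Lp p}"

definition partial_deriv :: "'k \<Rightarrow> (real ^ 'k::finite \<Rightarrow> real) \<Rightarrow> real ^ 'k \<Rightarrow> real" where
  "partial_deriv k \<phi> x = frechet_derivative \<phi> (at x) (axis k 1)"

text \<open>
  Smoothness: every iterated partial derivative is (totally) differentiable everywhere,
  and therefore continuous.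
\<close>

definition test_function :: "(real ^ 'k::finite \<Rightarrow> real) \<Rightarrow> bool" where
  "test_function \<phi> \<longleftrightarrow>
     (\<forall>ks. foldr partial_deriv ks \<phi> differentiable_on UNIV) \<and>
     compact (closure {x. \<phi> x \<noteq> 0})"

definition locally_integrable :: "('a::euclidean_space \<Rightarrow> 'b::euclidean_space) \<Rightarrow> bool" where
  "locally_integrable f \<longleftrightarrow> (\<forall>K. compact K \<longrightarrow> set_integrable lebesgue K f)"

definition has_weak_gradient ::
  "(real ^ 'k::finite \<Rightarrow> complex) \<Rightarrow> (real ^ 'k \<Rightarrow> complex ^ 'k) \<Rightarrow> bool" where
  "has_weak_gradient f g \<longleftrightarrow>
     locally_integrable f \<and> locally_integrable g \<and>
     (\<forall>\<phi> k. test_function \<phi> \<longrightarrow>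
        (\<integral>x. partial_deriv k \<phi> x *\<^sub>R f x \<partial>lebesgue) = - (\<integral>x. \<phi> x *\<^sub>R (g x $ k) \<partial>lebesgue))"

text \<open>The weak gradient is unique up to null sets; this picks a representative.\<close>

definition weak_gradient ::
  "(real ^ 'k::finite \<Rightarrow> complex) \<Rightarrow> real ^ 'k \<Rightarrow> complex ^ 'k" where
  "weak_gradient f = (SOME g. has_weak_gradient f g)"

definition sobolev_H :: "(real ^ 'k::finite \<Rightarrow> complex) set" where
  "sobolev_H = {f \<in> Lp 2. \<exists>g. has_weak_gradient f g \<and> g \<in> Lp 2}"


subsection \<open>Fourier transform\<close>

definition fourier_L1 :: "('a::euclidean_space \<Rightarrow> complex) \<Rightarrow> 'a \<Rightarrow> complex" where
  "fourier_L1 f \<xi> = (\<integral>x. f x * exp (- 2 * complex_of_real pi * \<i> * complex_of_real (\<xi> \<bullet> x)) \<partial>lebesgue)"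

text \<open>
  The continuous extension to \<open>L\<^sup>2\<close> of the transform on the intersection of \<open>L\<^sup>1\<close> and \<open>L\<^sup>2\<close>
  (Plancherel).  It is determined up to null sets, and \<open>fourier_L2\<close> picks a representative.
\<close>

definition is_fourier_L2 ::
  "('a::euclidean_space \<Rightarrow> complex) \<Rightarrow> ('a \<Rightarrow> complex) \<Rightarrow> bool" where
  "is_fourier_L2 f g \<longleftrightarrow>
     f \<in> Lp 2 \<and> g \<in> Lp 2 \<and>
     (\<forall>u::nat \<Rightarrow> 'a \<Rightarrow> complex.
        (\<forall>k. u k \<in> Lp 1 \<inter> Lp 2) \<longrightarrow> (\<lambda>k. L2_norm (\<lambda>x. u k x - f x)) \<longlonglongrightarrow> 0 \<longrightarrow>
        (\<lambda>k. L2_norm (\<lambda>\<xi>. fourier_L1 (u k) \<xi> - g \<xi>)) \<longlonglongrightarrow> 0)"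

definition fourier_L2 :: "('a::euclidean_space \<Rightarrow> complex) \<Rightarrow> 'a \<Rightarrow> complex" where
  "fourier_L2 f = (SOME g. is_fourier_L2 f g)"


subsection \<open>Shearlets\<close>

definition dilation_matrix :: "real \<Rightarrow> real ^ ('m option) ^ ('m::finite option)" where
  "dilation_matrix a =
     (\<chi> i j. if i \<noteq> j then 0
             else if i = None then a
             else sgn a * \<bar>a\<bar> powr (1 / real CARD('m option)))"

definition shear_matrix :: "real ^ 'm \<Rightarrow> real ^ ('m option) ^ ('m::finite option)" where
  "shear_matrix s =
     (\<chi> i j. if i = j then 1
             else case (i, j) of (None, Some k) \<Rightarrow> s $ k | _ \<Rightarrow> 0)"

definition shearlet_matrix :: "real ^ 'm \<Rightarrow> real \<Rightarrow> real ^ ('m option) ^ ('m::finite option)" where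
  "shearlet_matrix s a = shear_matrix s ** dilation_matrix a"

definition shearlet ::
  "('m::finite vec_n \<Rightarrow> complex) \<Rightarrow> real \<Rightarrow> real ^ 'm \<Rightarrow> 'm vec_n \<Rightarrow> 'm vec_n \<Rightarrow> complex" where
  "shearlet \<psi> a s t x =
     complex_of_real (\<bar>det (shearlet_matrix s a)\<bar> powr (- 1 / 2)) *
     \<psi> (matrix_inv (shearlet_matrix s a) *v (x - t))"

definition shearlet_transform ::
  "('m::finite vec_n \<Rightarrow> complex) \<Rightarrow> ('m vec_n \<Rightarrow> complex) \<Rightarrow> real \<Rightarrow> real ^ 'm \<Rightarrow> 'm vec_n \<Rightarrow> complex" where
  "shearlet_transform \<psi> f a s t = (\<integral>x. f x * cnj (shearlet \<psi> a s t x) \<partial>lebesgue)"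

definition shearlet_space :: "(real \<times> (real ^ 'm) \<times> ('m::finite) vec_n) set" where
  "shearlet_space = (UNIV - {0}) \<times> UNIV \<times> UNIV"

definition shearlet_measure :: "(real \<times> (real ^ 'm) \<times> ('m::finite) vec_n) measure" where
  "shearlet_measure =
     density (lebesgue_on shearlet_space)
       (\<lambda>(a, s, t). ennreal (1 / \<bar>a\<bar> ^ (CARD('m option) + 1)))"

definition admissibility_integral ::
  "('m::finite vec_n \<Rightarrow> complex) \<Rightarrow> 'm vec_n \<Rightarrow> ennreal" where
  "admissibility_integral \<psi> \<xi> =
     (let n = real CARD('m option) in
      \<integral>\<^sup>+ s. (\<integral>\<^sup>+ a \<in> UNIV - {0}.
         ennreal ((cmod (fourier_L2 \<psi> (transpose (shearlet_matrix s a) *v \<xi>)))\<^sup>2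
                  / \<bar>a\<bar> powr ((n\<^sup>2 - n + 1) / n)) \<partial>lebesgue) \<partial>(lebesgue :: (real ^ 'm) measure))"

text \<open>
  For \<open>\<psi>\<close> in \<open>L\<^sup>2\<close> the integral has the same value in \<open>[0, \<infinity>]\<close> at all \<open>\<xi>\<close> with \<open>\<xi>\<^sub>1 \<noteq> 0\<close>,
  whichever representative \<open>fourier_L2 \<psi>\<close> is; the constant is this common value.
\<close>

definition admissibility_constant :: "('m::finite vec_n \<Rightarrow> complex) \<Rightarrow> ennreal" where
  "admissibility_constant \<psi> =
     (THE C. \<forall>\<xi>. \<xi> $ None \<noteq> 0 \<longrightarrow> admissibility_integral \<psi> \<xi> = C)"

definition admissible_shearlet :: "('m::finite vec_n \<Rightarrow> complex) \<Rightarrow> bool" where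
  "admissible_shearlet \<psi> \<longleftrightarrow> \<psi> \<in> Lp 2 \<and> admissibility_constant \<psi> < \<infinity>"

end

theory Submission imports Defs "HOL-Probability.Probability" begin

text \<open>
  The bound follows from Heisenberg's inequality, without the logarithmic uncertainty principle.
  By Plancherel the shearlet transform is isometric when \<open>C\<^sub>\<psi> = 1\<close>, and it intertwines translations of \<open>f\<close>
  with translations in \<open>t\<close>. Applying \<open>\<integral> t\<^sub>k (|F(\<cdot> + \<epsilon> e\<^sub>k)|\<^sup>2 - |F|\<^sup>2) d\<eta> = - \<epsilon> \<parallel>F\<parallel>\<^sup>2\<close> to the transform \<open>F\<close> of \<open>f\<close>
  and letting \<open>\<epsilon>\<close> tend to \<open>0\<close> gives \<open>\<parallel>f\<parallel>\<^sup>2 \<le> 2 \<parallel>\<partial>\<^sub>k f\<parallel> \<parallel>t\<^sub>k F\<parallel>\<close>, hence, summing over \<open>k\<close>,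
  \<open>n \<parallel>f\<parallel>\<^sup>2 \<le> 2 \<parallel>\<nabla>f\<parallel> V\<^sup>1\<^sup>/\<^sup>2\<close> with \<open>V = \<integral> |t|\<^sup>2 |F|\<^sup>2 d\<eta>\<close>.
  Finally \<open>V + \<parallel>f\<parallel>\<^sup>2 \<ge> 2 \<parallel>f\<parallel> V\<^sup>1\<^sup>/\<^sup>2\<close>, and \<open>2 exp (\<Gamma>'(n/2) / \<Gamma>(n/2)) \<le> n\<close> because \<open>ln \<Gamma>\<close> is convex.
\<close>

subsection \<open>Square integrable functions\<close>

text \<open>Difference quotients take the place of derivatives because of integrability. The
  isometry is proved for functions in both L^1 and L^2, whose Fourier transform is an absolutely
  convergent integral; the weak gradient is only known to lie in L^2. The difference f(. +
  \<epsilon> e_k) - f stays in both spaces (the weighted space supplies L^1), and Plancherel bounds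
  its norm by \<epsilon> times that of the k-th weak derivative. The shearlet lies in L^2, so its
  transform enters as a function \<open>\<Psi>\<close> fixed up to null sets, through Parseval
  against a function in L^1 and L^2.

  Two obstacles shape the statements. Fubini over (a, s, t) needs joint measurability, hence Borel
  representatives on \<open>lborel\<close>, whereas the theorem speaks of the completed measure and
  of representatives picked by \<open>SOME\<close>. And test functions are real with all iterated
  partial derivatives totally differentiable, so windowed plane waves have to be constructed from an
  explicit bump function before the weak derivative can be seen on the Fourier side.\<close>

definition sq_integrable :: "'a measure \<Rightarrow> ('a \<Rightarrow> 'b::euclidean_space) \<Rightarrow> bool" where
  "sq_integrable M f \<longleftrightarrow> f \<in> borel_measurable M \<and> integrable M (\<lambda>x. (norm (f x))\<^sup>2)"

text \<open>The measure is a parameter because the same facts serve \<open>lborel\<close>,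
  \<open>lebesgue\<close> and the weighted measure on the shearlet parameters. If the square is not
  integrable the value is 0, so an upper bound on \<open>l2\<close> is informative only together
  with \<open>sq_integrable\<close>.\<close>

definition l2 :: "'a measure \<Rightarrow> ('a \<Rightarrow> 'b::euclidean_space) \<Rightarrow> real" where
  "l2 M f = sqrt (\<integral>x. (norm (f x))\<^sup>2 \<partial>M)"

lemma sq_integrableI:
  "f \<in> borel_measurable M \<Longrightarrow> integrable M (\<lambda>x. (norm (f x))\<^sup>2) \<Longrightarrow> sq_integrable M f"
  by (simp add: sq_integrable_def)

lemma sq_integrable_measurable [measurable_dest]:
  "sq_integrable M f \<Longrightarrow> f \<in> borel_measurable M"
  by (simp add: sq_integrable_def)

lemma sq_integrableD: "sq_integrable M f \<Longrightarrow> integrable M (\<lambda>x. (norm (f x))\<^sup>2)"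
  by (simp add: sq_integrable_def)

lemma l2_nonneg [simp]: "0 \<le> l2 M f"
  by (simp add: l2_def)

lemma l2_power2: "(l2 M f)\<^sup>2 = (\<integral>x. (norm (f x))\<^sup>2 \<partial>M)"
  by (simp add: l2_def)

lemma sq_integrable_nn_integral:
  assumes "f \<in> borel_measurable M" "(\<integral>\<^sup>+ x. ennreal ((norm (f x))\<^sup>2) \<partial>M) < \<infinity>"
  shows "sq_integrable M f"
  using assms by (auto simp: sq_integrable_def integrable_iff_bounded)

lemma nn_integral_l2:
  assumes "sq_integrable M f"
  shows "(\<integral>\<^sup>+ x. ennreal ((norm (f x))\<^sup>2) \<partial>M) = ennreal ((l2 M f)\<^sup>2)"
  unfolding l2_power2 by (intro nn_integral_eq_integral sq_integrableD assms) auto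

text \<open>Fatou and pointwise comparison deliver bounds on nonnegative integrals; such a bound
  yields integrability and the norm estimate at once.\<close>

lemma l2_le_nn_integral:
  assumes "(\<integral>\<^sup>+ x. ennreal ((norm (f x))\<^sup>2) \<partial>M) \<le> ennreal (c\<^sup>2)" "0 \<le> c" "f \<in> borel_measurable M"
  shows "sq_integrable M f" "l2 M f \<le> c"
proof -
  show *: "sq_integrable M f"
    by (intro sq_integrable_nn_integral assms) (use assms(1) in \<open>auto simp: order_le_less_trans\<close>)
  show "l2 M f \<le> c"
    using assms(1,2) unfolding nn_integral_l2[OF *] by (simp add: power2_le_iff_abs_le)
qed

lemma sq_integrable_bound:
  assumes "sq_integrable M f" "g \<in> borel_measurable M" "AE x in M. norm (g x) \<le> c * norm (f x)"
  shows "sq_integrable M g"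
proof (rule sq_integrableI[OF assms(2)])
  have "integrable M (\<lambda>x. c\<^sup>2 * (norm (f x))\<^sup>2)"
    using assms(1) by (simp add: sq_integrable_def)
  then show "integrable M (\<lambda>x. (norm (g x))\<^sup>2)"
  proof (rule Bochner_Integration.integrable_bound)
    show "AE x in M. norm ((norm (g x))\<^sup>2) \<le> norm (c\<^sup>2 * (norm (f x))\<^sup>2)"
      using assms(3) 
    proof eventually_elim
      case (elim x)
      then have "(norm (g x))\<^sup>2 \<le> (c * norm (f x))\<^sup>2"
        by (intro power_mono) auto
      then show ?case by (simp add: power_mult_distrib)
    qed
  qed (use assms in simp)
qed

lemma l2_mono:
  assumes "sq_integrable M f" "g \<in> borel_measurable M" "AE x in M. norm (g x) \<le> norm (f x)"
  shows "l2 M g \<le> l2 M f"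
  unfolding l2_def
proof (intro real_sqrt_le_mono integral_mono_AE)
  show "integrable M (\<lambda>x. (norm (g x))\<^sup>2)"
    by (rule sq_integrableD[OF sq_integrable_bound[of _ f _ 1]]) (use assms in auto)
  show "AE x in M. (norm (g x))\<^sup>2 \<le> (norm (f x))\<^sup>2"
    using assms(3) by eventually_elim (intro power_mono, auto)
qed (use assms in \<open>auto dest: sq_integrableD\<close>)

lemma sq_integrable_add:
  assumes "sq_integrable M f" "sq_integrable M g"
  shows "sq_integrable M (\<lambda>x. f x + g x)"
proof (rule sq_integrableI)
  show "(\<lambda>x. f x + g x) \<in> borel_measurable M"
    using assms by measurable
  have "integrable M (\<lambda>x. 2 * (norm (f x))\<^sup>2 + 2 * (norm (g x))\<^sup>2)"
    by (intro Bochner_Integration.integrable_add integrable_mult_right sq_integrableD assms)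
  then show "integrable M (\<lambda>x. (norm (f x + g x))\<^sup>2)"
  proof (rule Bochner_Integration.integrable_bound)
    have "(norm (f x + g x))\<^sup>2 \<le> 2 * (norm (f x))\<^sup>2 + 2 * (norm (g x))\<^sup>2" for x
    proof -
      have "(norm (f x + g x))\<^sup>2 \<le> (norm (f x) + norm (g x))\<^sup>2"
        by (intro power_mono norm_triangle_ineq) auto
      also have "\<dots> \<le> 2 * (norm (f x))\<^sup>2 + 2 * (norm (g x))\<^sup>2"
        using sum_squares_bound[of "norm (f x)" "norm (g x)"] by (simp add: power2_sum)
      finally show ?thesis .
    qed
    then show "AE x in M. norm ((norm (f x + g x))\<^sup>2) \<le> norm (2 * (norm (f x))\<^sup>2 + 2 * (norm (g x))\<^sup>2)"
      by (auto simp: abs_of_nonneg)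
  qed (use assms in measurable)
qed

lemma sq_integrable_scaleR:
  "sq_integrable M f \<Longrightarrow> sq_integrable M (\<lambda>x. c *\<^sub>R f x)"
  by (rule sq_integrable_bound[of _ f _ "\<bar>c\<bar>"]) (auto dest: sq_integrable_measurable)

lemma sq_integrable_cmult:
  fixes f :: "'a \<Rightarrow> complex"
  shows "sq_integrable M f \<Longrightarrow> sq_integrable M (\<lambda>x. c * f x)"
  by (rule sq_integrable_bound[of _ f _ "norm c"]) (auto simp: norm_mult dest: sq_integrable_measurable)

lemma l2_cmult:
  fixes f :: "'a \<Rightarrow> complex"
  shows "l2 M (\<lambda>x. c * f x) = norm c * l2 M f"
  by (simp add: l2_def norm_mult power_mult_distrib real_sqrt_mult)

lemma sq_integrable_minus: "sq_integrable M f \<Longrightarrow> sq_integrable M (\<lambda>x. - f x)"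
  using sq_integrable_scaleR[of M f "-1"] by simp

lemma sq_integrable_diff:
  "sq_integrable M f \<Longrightarrow> sq_integrable M g \<Longrightarrow> sq_integrable M (\<lambda>x. f x - g x)"
  using sq_integrable_add[OF _ sq_integrable_minus, of M f g] by simp

lemma l2_uminus: "l2 M (\<lambda>x. - f x) = l2 M f"
  by (simp add: l2_def)

lemma l2_diff_commute: "l2 M (\<lambda>x. f x - g x) = l2 M (\<lambda>x. g x - f x)"
  by (simp add: l2_def norm_minus_commute)

lemma ennreal_power2_le_imp_le:
  assumes "x\<^sup>2 \<le> (ennreal b)\<^sup>2" "0 \<le> b"
  shows "x \<le> ennreal b"
proof (cases x)
  case (real r)
  then show ?thesis
    using assms by (simp add: ennreal_power power2_le_iff_abs_le)
next
  case top
  then show ?thesis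
    using assms by (simp add: ennreal_power top_unique)
qed

lemma borel_measurable_cnj [measurable]: "cnj \<in> borel_measurable borel"
  by (intro borel_measurable_continuous_onI continuous_intros)

lemma l2_Cauchy_Schwarz:
  assumes "sq_integrable M f" "sq_integrable M g"
  shows "integrable M (\<lambda>x. norm (f x) * norm (g x))"
    and "(\<integral>x. norm (f x) * norm (g x) \<partial>M) \<le> l2 M f * l2 M g"
proof -
  have [measurable]: "f \<in> borel_measurable M" "g \<in> borel_measurable M"
    using assms by (auto dest: sq_integrable_measurable)
  have "(\<integral>\<^sup>+x. ennreal (norm (f x)) * ennreal (norm (g x)) \<partial>M)\<^sup>2
      \<le> (\<integral>\<^sup>+x. (ennreal (norm (f x)))\<^sup>2 \<partial>M) * (\<integral>\<^sup>+x. (ennreal (norm (g x)))\<^sup>2 \<partial>M)"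
    by (rule Cauchy_Schwarz_nn_integral) measurable
  also have "\<dots> = ennreal ((l2 M f)\<^sup>2) * ennreal ((l2 M g)\<^sup>2)"
    using assms by (simp add: nn_integral_l2 ennreal_power)
  also have "\<dots> = (ennreal (l2 M f * l2 M g))\<^sup>2"
    by (simp add: ennreal_mult[symmetric] ennreal_power power_mult_distrib)
  finally have "(\<integral>\<^sup>+x. ennreal (norm (f x)) * ennreal (norm (g x)) \<partial>M) \<le> ennreal (l2 M f * l2 M g)"
    by (rule ennreal_power2_le_imp_le) simp
  then have *: "(\<integral>\<^sup>+x. ennreal (norm (f x) * norm (g x)) \<partial>M) \<le> ennreal (l2 M f * l2 M g)"
    by (simp add: ennreal_mult)
  then show i: "integrable M (\<lambda>x. norm (f x) * norm (g x))"
    by (intro integrableI_nonneg) (auto simp: order_le_less_trans)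
  show "(\<integral>x. norm (f x) * norm (g x) \<partial>M) \<le> l2 M f * l2 M g"
    using * by (subst (asm) nn_integral_eq_integral[OF i]) auto
qed

lemma sq_integrable_mult:
  fixes f g :: "'a \<Rightarrow> complex"
  assumes "sq_integrable M f" "sq_integrable M g"
  shows "integrable M (\<lambda>x. f x * g x)"
    and "norm (\<integral>x. f x * g x \<partial>M) \<le> l2 M f * l2 M g"
proof -
  have [measurable]: "f \<in> borel_measurable M" "g \<in> borel_measurable M"
    using assms by (auto dest: sq_integrable_measurable)
  show "integrable M (\<lambda>x. f x * g x)"
    by (rule Bochner_Integration.integrable_bound[OF l2_Cauchy_Schwarz(1)[OF assms]])
       (auto simp: norm_mult)
  show "norm (\<integral>x. f x * g x \<partial>M) \<le> l2 M f * l2 M g"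
    by (rule order_trans[OF integral_norm_bound]) (simp add: norm_mult l2_Cauchy_Schwarz(2)[OF assms])
qed

lemma sq_integrable_cnj: "sq_integrable M f \<Longrightarrow> sq_integrable M (\<lambda>x. cnj (f x))"
  by (rule sq_integrable_bound[of _ f _ 1]) (auto dest: sq_integrable_measurable)

lemma l2_cnj: "l2 M (\<lambda>x. cnj (f x)) = l2 M f"
  by (simp add: l2_def)

lemma l2_triangle:
  assumes "sq_integrable M f" "sq_integrable M g"
  shows "l2 M (\<lambda>x. f x + g x) \<le> l2 M f + l2 M g"
proof (rule power2_le_imp_le)
  have i: "integrable M (\<lambda>x. norm (f x) * norm (g x))" "integrable M (\<lambda>x. (norm (f x))\<^sup>2)"
     "integrable M (\<lambda>x. (norm (g x))\<^sup>2)" "integrable M (\<lambda>x. (norm (f x + g x))\<^sup>2)"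
    using assms by (auto intro!: l2_Cauchy_Schwarz sq_integrableD sq_integrable_add)
  have "(l2 M (\<lambda>x. f x + g x))\<^sup>2
      \<le> (\<integral>x. (norm (f x))\<^sup>2 + 2 * (norm (f x) * norm (g x)) + (norm (g x))\<^sup>2 \<partial>M)"
    unfolding l2_power2
  proof (intro integral_mono)
    fix x
    have "(norm (f x + g x))\<^sup>2 \<le> (norm (f x) + norm (g x))\<^sup>2"
      by (intro power_mono norm_triangle_ineq) auto
    then show "(norm (f x + g x))\<^sup>2 \<le> (norm (f x))\<^sup>2 + 2 * (norm (f x) * norm (g x)) + (norm (g x))\<^sup>2"
      by (simp add: power2_sum algebra_simps)
  qed (use i in auto)
  also have "\<dots> = (l2 M f)\<^sup>2 + 2 * (\<integral>x. norm (f x) * norm (g x) \<partial>M) + (l2 M g)\<^sup>2"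
    using i by (simp add: l2_power2)
  also have "\<dots> \<le> (l2 M f + l2 M g)\<^sup>2"
    using l2_Cauchy_Schwarz(2)[OF assms] by (simp add: power2_sum)
  finally show "(l2 M (\<lambda>x. f x + g x))\<^sup>2 \<le> (l2 M f + l2 M g)\<^sup>2" .
qed auto

lemma l2_triangle_diff:
  assumes "sq_integrable M f" "sq_integrable M g"
  shows "l2 M (\<lambda>x. f x - g x) \<le> l2 M f + l2 M g"
  using l2_triangle[OF assms(1) sq_integrable_minus[OF assms(2)]] by (simp add: l2_uminus)

lemma l2_inner_tendsto:
  fixes f h :: "'a \<Rightarrow> complex"
  assumes "\<And>k::nat. sq_integrable M (u k)" "sq_integrable M f" "sq_integrable M h"
    and "(\<lambda>k. l2 M (\<lambda>x. u k x - f x)) \<longlonglongrightarrow> 0"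
  shows "(\<lambda>k. \<integral>x. h x * cnj (u k x) \<partial>M) \<longlonglongrightarrow> (\<integral>x. h x * cnj (f x) \<partial>M)"
proof -
  have "norm ((\<integral>x. h x * cnj (u k x) \<partial>M) - (\<integral>x. h x * cnj (f x) \<partial>M)) \<le> l2 M h * l2 M (\<lambda>x. u k x - f x)" for k
  proof -
    have "(\<integral>x. h x * cnj (u k x) \<partial>M) - (\<integral>x. h x * cnj (f x) \<partial>M) = (\<integral>x. h x * cnj (u k x - f x) \<partial>M)"
      using assms by (subst Bochner_Integration.integral_diff[symmetric])
        (auto intro!: sq_integrable_mult sq_integrable_cnj simp: algebra_simps)
    then show ?thesis
      using sq_integrable_mult(2)[OF assms(3) sq_integrable_cnj[OF sq_integrable_diff[OF assms(1,2)]], of k]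
      by (simp only: l2_cnj)
  qed
  then have "(\<lambda>k. (\<integral>x. h x * cnj (u k x) \<partial>M) - (\<integral>x. h x * cnj (f x) \<partial>M)) \<longlonglongrightarrow> 0"
    by (intro Lim_null_comparison[OF _ tendsto_mult_right_zero[OF assms(4), of "l2 M h"]])
       auto
  then show ?thesis by (simp add: LIM_zero_iff)
qed

lemma l2_dominated_convergence:
  assumes "\<And>k::nat. u k \<in> borel_measurable M" "f \<in> borel_measurable M" "sq_integrable M w"
    and "AE x in M. (\<lambda>k. u k x) \<longlonglongrightarrow> f x"
    and "\<And>k. AE x in M. norm (u k x - f x) \<le> norm (w x)"
  shows "(\<lambda>k. l2 M (\<lambda>x. u k x - f x)) \<longlonglongrightarrow> 0"
proof -
  have "(\<lambda>k. \<integral>x. (norm (u k x - f x))\<^sup>2 \<partial>M) \<longlonglongrightarrow> (\<integral>x. 0 \<partial>M)"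
  proof (rule integral_dominated_convergence)
    show "integrable M (\<lambda>x. (norm (w x))\<^sup>2)" using assms(3) by (rule sq_integrableD)
    show "AE x in M. (\<lambda>k. (norm (u k x - f x))\<^sup>2) \<longlonglongrightarrow> 0"
      using assms(4)
    proof eventually_elim
      case (elim x)
      then have "(\<lambda>k. norm (u k x - f x)) \<longlonglongrightarrow> 0"
        by (simp add: LIM_zero tendsto_norm_zero)
      from tendsto_power[OF this, of 2] show ?case by simp
    qed
    show "AE x in M. norm ((norm (u k x - f x))\<^sup>2) \<le> (norm (w x))\<^sup>2" for k
      using assms(5)[of k] by eventually_elim (auto intro: power_mono)
  qed (use assms in auto)
  from tendsto_real_sqrt[OF this] show ?thesis by (simp add: l2_def)
qed

section \<open>Translations and their continuity in quadratic mean\<close>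

lemma lborel_integral_translate:
  fixes f :: "'a::euclidean_space \<Rightarrow> 'b::{banach,second_countable_topology}"
  assumes [measurable]: "f \<in> borel_measurable borel"
  shows "(\<integral>x. f (c + x) \<partial>lborel) = (\<integral>x. f x \<partial>lborel)"
proof -
  have "(\<integral>x. f x \<partial>lborel) = (\<integral>x. f x \<partial>(distr lborel borel ((+) c)))"
    by (simp add: lborel_distr_plus)
  also have "\<dots> = (\<integral>x. f (c + x) \<partial>lborel)"
    by (rule integral_distr) auto
  finally show ?thesis ..
qed

lemma lborel_nn_integral_translate:
  fixes f :: "'a::euclidean_space \<Rightarrow> ennreal"
  assumes [measurable]: "f \<in> borel_measurable borel"
  shows "(\<integral>\<^sup>+x. f (c + x) \<partial>lborel) = (\<integral>\<^sup>+x. f x \<partial>lborel)"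
proof -
  have "(\<integral>\<^sup>+x. f x \<partial>lborel) = (\<integral>\<^sup>+x. f x \<partial>(distr lborel borel ((+) c)))"
    by (simp add: lborel_distr_plus)
  also have "\<dots> = (\<integral>\<^sup>+x. f (c + x) \<partial>lborel)"
    by (rule nn_integral_distr) auto
  finally show ?thesis ..
qed

lemma lborel_integrable_translate:
  fixes f :: "'a::euclidean_space \<Rightarrow> 'b::{banach,second_countable_topology}"
  assumes "integrable lborel f"
  shows "integrable lborel (\<lambda>x. f (c + x))"
proof -
  have [measurable]: "f \<in> borel_measurable borel"
    using borel_measurable_integrable[OF assms] by simp
  have "integrable (distr lborel borel ((+) c)) f"
    using assms by (simp add: lborel_distr_plus)
  then show ?thesis
    by (subst (asm) integrable_distr_eq) auto
qed

lemma sq_integrable_translate: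
  fixes f :: "'a::euclidean_space \<Rightarrow> 'b::euclidean_space"
  assumes "sq_integrable lborel f"
  shows "sq_integrable lborel (\<lambda>x. f (c + x))"
proof (rule sq_integrableI)
  have [measurable]: "f \<in> borel_measurable borel"
    using sq_integrable_measurable[OF assms] by simp
  show "(\<lambda>x. f (c + x)) \<in> borel_measurable lborel" by simp
  show "integrable lborel (\<lambda>x. (norm (f (c + x)))\<^sup>2)"
    using lborel_integrable_translate[OF sq_integrableD[OF assms]] .
qed

lemma l2_translate:
  fixes f :: "'a::euclidean_space \<Rightarrow> 'b::euclidean_space"
  assumes [measurable]: "f \<in> borel_measurable borel"
  shows "l2 lborel (\<lambda>x. f (c + x)) = l2 lborel f"
  unfolding l2_def using lborel_integral_translate[of "\<lambda>x. (norm (f x))\<^sup>2" c] by simp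

lemma sq_integrable_indicator_bounded:
  fixes c :: real
  assumes "bounded S" "S \<in> sets borel"
  shows "sq_integrable (lborel :: 'a::euclidean_space measure) (\<lambda>x. c * indicator S x)"
proof (rule sq_integrableI)
  have "integrable lborel (indicator S :: 'a \<Rightarrow> real)"
    using emeasure_bounded_finite[OF assms(1)] assms(2) by (intro integrable_real_indicator) auto
  then have "integrable lborel (\<lambda>x. c\<^sup>2 * indicator S x :: real)"
    by simp
  moreover have "(\<lambda>x. (norm (c * indicator S x))\<^sup>2) = (\<lambda>x. c\<^sup>2 * indicator S x :: real)"
    by (auto simp: fun_eq_iff indicator_def)
  ultimately show "integrable lborel (\<lambda>x::'a. (norm (c * indicator S x))\<^sup>2)"
    by simp
qed (use assms in measurable)

text \<open>Truncation in the values and in the argument brings \<open>h\<close> close to a bounded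
  function of bounded support. That function is then reached by continuous ones through almost
  everywhere convergence, the same truncations supplying the majorant.\<close>

lemma l2_continuous_approximation:
  fixes h :: "'a::euclidean_space \<Rightarrow> 'b::euclidean_space"
  assumes h: "sq_integrable lborel h" and "e > 0"
  obtains \<phi> r c where "continuous_on UNIV \<phi>" "\<And>x. norm (\<phi> x) \<le> c" "\<And>x. norm x > r \<Longrightarrow> \<phi> x = 0"
    "l2 lborel (\<lambda>x. h x - \<phi> x) < e"
proof -
  have hm [measurable]: "h \<in> borel_measurable borel"
    using sq_integrable_measurable[OF h] by simp
  \<comment> \<open>For r > 0, \<open>clip r\<close> is the radial retraction onto the ball of
    radius r: continuous, the identity on the ball, and never increasing the norm.
    \<open>tent r\<close> is 1 up to radius r and 0 from radius r + 1 on.\<close>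
  define clip :: "real \<Rightarrow> 'b \<Rightarrow> 'b" where "clip r v = (1 / max 1 (norm v / r)) *\<^sub>R v" for r v
  define tent :: "real \<Rightarrow> 'a \<Rightarrow> real" where "tent r x = max 0 (min 1 (r + 1 - norm x))" for r x
  have clip_cont: "continuous_on UNIV (clip r)" for r
    unfolding clip_def by (cases "r = 0") (auto intro!: continuous_intros)
  have tent_cont: "continuous_on UNIV (tent r)" for r
    unfolding tent_def by (intro continuous_intros)
  have [measurable]: "clip r \<in> borel_measurable borel" "tent r \<in> borel_measurable borel" for r
    using clip_cont tent_cont by (auto intro: borel_measurable_continuous_onI)
  have clip_le: "norm (clip r v) \<le> r" if "r > 0" for r v
  proof -
    have "norm v \<le> r * max 1 (norm v / r)"
      using that by (auto simp: max_def field_simps)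
    then show ?thesis
      by (simp add: clip_def divide_simps)
  qed
  have clip_le': "norm (clip r v) \<le> norm v" for r v
  proof -
    have "norm (clip r v) = (1 / max 1 (norm v / r)) * norm v"
      by (simp add: clip_def)
    also have "\<dots> \<le> 1 * norm v"
      by (intro mult_right_mono) (auto simp: divide_le_eq_1)
    finally show ?thesis by simp
  qed
  have tent_le: "0 \<le> tent r x" "tent r x \<le> 1" for r x
    by (auto simp: tent_def)
  define H where "H k x = tent (real (Suc k)) x *\<^sub>R clip (real (Suc k)) (h x)" for k x
  have [measurable]: "H k \<in> borel_measurable borel" for k
    unfolding H_def[abs_def] by measurable
  have "(\<lambda>k. l2 lborel (\<lambda>x. H k x - h x)) \<longlonglongrightarrow> 0"
  proof (rule l2_dominated_convergence)
    show "sq_integrable lborel (\<lambda>x. 2 *\<^sub>R h x)"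
      by (intro sq_integrable_scaleR h)
    show "AE x in lborel. (\<lambda>k. H k x) \<longlonglongrightarrow> h x"
    proof (intro AE_I2 tendsto_eventually)
      fix x
      obtain m :: nat where m: "norm x \<le> real m" "norm (h x) \<le> real m"
        using real_arch_simple[of "max (norm x) (norm (h x))"] by auto
      show "\<forall>\<^sub>F k in sequentially. H k x = h x"
        using eventually_ge_at_top[of m]
      proof eventually_elim
        case (elim k)
        have "real m \<le> real k" using elim by simp
        then have "norm x \<le> real (Suc k)" "norm (h x) \<le> real (Suc k)" using m by auto
        then show ?case
          by (auto simp: H_def tent_def clip_def max_def min_def divide_simps)
      qed
    qed
    show "AE x in lborel. norm (H k x - h x) \<le> norm (2 *\<^sub>R h x)" for k
    proof (rule AE_I2)
      fix x
      have "norm (H k x) \<le> 1 * norm (clip (real (Suc k)) (h x))"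
        unfolding H_def norm_scaleR using tent_le[of "real (Suc k)" x] by (intro mult_right_mono) auto
      also have "\<dots> \<le> norm (h x)" using clip_le' by simp
      finally show "norm (H k x - h x) \<le> norm (2 *\<^sub>R h x)"
        using norm_triangle_ineq4[of "H k x" "h x"] by simp
    qed
  qed measurable
  then obtain k where k: "l2 lborel (\<lambda>x. H k x - h x) < e / 2"
    using order_tendstoD(2)[of _ 0 sequentially "e/2"] \<open>e > 0\<close> by (auto simp: eventually_sequentially)
  define r where "r = real (Suc k)"
  have r: "r > 0" by (simp add: r_def)
  \<comment> \<open>Measurability gives continuous \<open>g n\<close> converging to \<open>h\<close>
    off a negligible set, with no control of their size. \<open>clip r\<close> and
    \<open>tent r\<close> make the approximants uniformly bounded and supported in one ball, and
    continuity of \<open>clip r\<close> preserves the limit.\<close>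
  have "h measurable_on UNIV"
    by (intro lebesgue_measurable_imp_measurable_on measurable_completion) auto
  then obtain N g where N: "negligible N" and g: "\<And>n. continuous_on UNIV (g n)"
    and lim: "\<And>x. x \<notin> N \<Longrightarrow> (\<lambda>n. g n x) \<longlonglongrightarrow> h x"
    by (auto simp: measurable_on_def)
  define G where "G n x = tent r x *\<^sub>R clip r (g n x)" for n x
  have G_cont: "continuous_on UNIV (G n)" for n
    unfolding G_def
    by (intro continuous_intros tent_cont continuous_on_compose2[OF clip_cont] g) auto
  have [measurable]: "G n \<in> borel_measurable borel" for n
    using G_cont by (auto intro: borel_measurable_continuous_onI)
  have bd: "norm (tent r x *\<^sub>R clip r v) \<le> r * indicator (cball 0 (r + 1)) x" for x v
  proof (cases "norm x \<le> r + 1")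
    case True
    have "norm (tent r x *\<^sub>R clip r v) \<le> 1 * r"
      unfolding norm_scaleR using tent_le[of r x] clip_le[OF r] r by (intro mult_mono) auto
    then show ?thesis using True by simp
  qed (auto simp: tent_def)
  have Geq: "H k x = tent r x *\<^sub>R clip r (h x)" for x by (simp add: H_def r_def)
  have "(\<lambda>n. l2 lborel (\<lambda>x. G n x - H k x)) \<longlonglongrightarrow> 0"
  proof (rule l2_dominated_convergence)
    show "sq_integrable lborel (\<lambda>x. 2 * r * indicator (cball (0::'a) (r + 1)) x)"
      by (rule sq_integrable_indicator_bounded) auto
    have "AE x in lebesgue. x \<notin> N"
      using N by (intro AE_not_in) (simp add: negligible_iff_null_sets)
    then have "AE x in lborel. x \<notin> N"
      by (simp add: AE_completion_iff)
    then show "AE x in lborel. (\<lambda>n. G n x) \<longlonglongrightarrow> H k x"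
    proof eventually_elim
      case (elim x)
      have "isCont (clip r) (h x)"
        using clip_cont by (simp add: continuous_on_eq_continuous_at)
      from isCont_tendsto_compose[OF this lim[OF elim]] show ?case
        unfolding G_def Geq by (intro tendsto_intros)
    qed
    show "AE x in lborel. norm (G n x - H k x) \<le> norm (2 * r * indicator (cball 0 (r + 1)) x)" for n
    proof (rule AE_I2)
      fix x :: 'a
      have "norm (G n x - H k x) \<le> r * indicator (cball 0 (r + 1)) x + r * indicator (cball 0 (r + 1)) x"
        unfolding G_def Geq by (rule order_trans[OF norm_triangle_ineq4 add_mono[OF bd bd]])
      then show "norm (G n x - H k x) \<le> norm (2 * r * indicator (cball 0 (r + 1)) x)"
        using r by (simp add: abs_mult)
    qed
  qed measurable
  then obtain n where n: "l2 lborel (\<lambda>x. G n x - H k x) < e / 2"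
    using order_tendstoD(2)[of _ 0 sequentially "e/2"] \<open>e > 0\<close> by (auto simp: eventually_sequentially)
  have dom: "sq_integrable lborel (\<lambda>x::'a. r * indicator (cball 0 (r + 1)) x)"
    by (rule sq_integrable_indicator_bounded) auto
  have sG: "sq_integrable lborel (G n)"
    by (rule sq_integrable_bound[OF dom, of _ 1]) (use bd r in \<open>auto simp: G_def abs_mult\<close>)
  have sH: "sq_integrable lborel (H k)"
    by (rule sq_integrable_bound[OF dom, of _ 1]) (use bd r in \<open>auto simp: Geq abs_mult\<close>)
  have "l2 lborel (\<lambda>x. h x - G n x) = l2 lborel (\<lambda>x. (G n x - H k x) + (H k x - h x))"
    by (subst l2_diff_commute) simp
  also have "\<dots> \<le> l2 lborel (\<lambda>x. G n x - H k x) + l2 lborel (\<lambda>x. H k x - h x)"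
    by (intro l2_triangle sq_integrable_diff sG sH h)
  also have "\<dots> < e" using n k by simp
  finally have fin: "l2 lborel (\<lambda>x. h x - G n x) < e" .
  show ?thesis
  proof (rule that[OF G_cont _ _ fin])
    show "norm (G n x) \<le> r" for x
      unfolding G_def by (rule order_trans[OF bd]) (use r in \<open>auto simp: indicator_def\<close>)
    show "G n x = 0" if "norm x > r + 1" for x
      using that by (auto simp: G_def tent_def)
  qed
qed

text \<open>Translation preserves the norm, so an approximation of \<open>h\<close> by a continuous
  \<open>\<phi>\<close> is equally good after translating, and only the middle term of a three-term
  triangle inequality has to vanish. For \<open>\<phi>\<close> convergence is pointwise, and
  boundedness of the sequence \<open>z\<close> keeps all supports in one ball.\<close>

lemma l2_translate_tendsto:
  fixes h :: "'a::euclidean_space \<Rightarrow> 'b::euclidean_space"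
  assumes h: "sq_integrable lborel h" and z: "z \<longlonglongrightarrow> 0"
  shows "(\<lambda>k. l2 lborel (\<lambda>x. h (z k + x) - h x)) \<longlonglongrightarrow> 0"
proof (rule LIMSEQ_I)
  fix e :: real assume "e > 0"
  have hm [measurable]: "h \<in> borel_measurable borel"
    using sq_integrable_measurable[OF h] by simp
  obtain \<phi> r c where \<phi>: "continuous_on UNIV \<phi>" "\<And>x. norm (\<phi> x) \<le> c" "\<And>x. norm x > r \<Longrightarrow> \<phi> x = 0"
    and near: "l2 lborel (\<lambda>x. h x - \<phi> x) < e / 4"
    by (rule l2_continuous_approximation[OF h, of "e/4"]) (use \<open>e > 0\<close> in auto)
  have [measurable]: "\<phi> \<in> borel_measurable borel"
    using \<phi>(1) by (rule borel_measurable_continuous_onI)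
  have c: "0 \<le> c" using \<phi>(2)[of 0] norm_ge_zero order_trans by blast
  obtain B where B: "\<And>k. norm (z k) \<le> B"
    using convergent_imp_Bseq[of z] z by (auto simp: Bseq_def convergent_def)
  have s\<phi>: "sq_integrable lborel \<phi>"
  proof (rule sq_integrable_bound[of _ "\<lambda>x. c * indicator (cball 0 r) x" _ 1])
    show "sq_integrable lborel (\<lambda>x::'a. c * indicator (cball 0 r) x)"
      by (rule sq_integrable_indicator_bounded) auto
    show "AE x in lborel. norm (\<phi> x) \<le> 1 * norm (c * indicator (cball 0 r) x)"
      using \<phi>(2,3) c by (intro AE_I2) (auto simp: indicator_def not_le)
  qed auto
  have "(\<lambda>k. l2 lborel (\<lambda>x. \<phi> (z k + x) - \<phi> x)) \<longlonglongrightarrow> 0"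
  proof (rule l2_dominated_convergence)
    show "sq_integrable lborel (\<lambda>x::'a. 2 * c * indicator (cball 0 (r + B)) x)"
      by (rule sq_integrable_indicator_bounded) auto
    show "AE x in lborel. (\<lambda>k. \<phi> (z k + x)) \<longlonglongrightarrow> \<phi> x"
    proof (rule AE_I2)
      fix x
      have "isCont \<phi> x" using \<phi>(1) by (simp add: continuous_on_eq_continuous_at)
      moreover have "(\<lambda>k. z k + x) \<longlonglongrightarrow> x"
        using tendsto_add[OF z tendsto_const[of x]] by simp
      ultimately show "(\<lambda>k. \<phi> (z k + x)) \<longlonglongrightarrow> \<phi> x"
        by (rule isCont_tendsto_compose)
    qed
    show "AE x in lborel. norm (\<phi> (z k + x) - \<phi> x) \<le> norm (2 * c * indicator (cball 0 (r + B)) x)" for k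
    proof (rule AE_I2)
      fix x
      show "norm (\<phi> (z k + x) - \<phi> x) \<le> norm (2 * c * indicator (cball 0 (r + B)) x)"
      proof (cases "norm x \<le> r + B")
        case True
        then show ?thesis
          using norm_triangle_ineq4[of "\<phi> (z k + x)" "\<phi> x"] \<phi>(2)[of x] \<phi>(2)[of "z k + x"] c
          by (simp add: abs_mult)
      next
        case False
        have "norm x \<le> norm (z k + x) + norm (z k)"
          using norm_triangle_ineq4[of "z k + x" "z k"] by simp
        then have "norm (z k + x) > r" using False B[of k] by simp
        moreover have "norm x > r"
          using False B[of k] norm_ge_zero[of "z k"] by linarith
        ultimately show ?thesis using \<phi>(3) by simp
      qed
    qed
  qed auto
  from LIMSEQ_D[OF this, of "e/2"] \<open>e > 0\<close>
  obtain K where K: "\<And>k. k \<ge> K \<Longrightarrow> l2 lborel (\<lambda>x. \<phi> (z k + x) - \<phi> x) < e / 2"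
    by auto
  have "l2 lborel (\<lambda>x. h (z k + x) - h x) < e" if "k \<ge> K" for k
  proof -
    have t: "sq_integrable lborel (\<lambda>x. h (z k + x))" "sq_integrable lborel (\<lambda>x. \<phi> (z k + x))"
      by (intro sq_integrable_translate h s\<phi>)+
    have eq: "h (z k + x) - h x = ((h (z k + x) - \<phi> (z k + x)) + (\<phi> (z k + x) - \<phi> x)) + (\<phi> x - h x)" for x
      by simp
    have "l2 lborel (\<lambda>x. h (z k + x) - h x)
        \<le> l2 lborel (\<lambda>x. (h (z k + x) - \<phi> (z k + x)) + (\<phi> (z k + x) - \<phi> x)) + l2 lborel (\<lambda>x. \<phi> x - h x)"
      by (subst eq) (intro l2_triangle sq_integrable_add sq_integrable_diff h s\<phi> t)
    also have "l2 lborel (\<lambda>x. (h (z k + x) - \<phi> (z k + x)) + (\<phi> (z k + x) - \<phi> x))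
        \<le> l2 lborel (\<lambda>x. h (z k + x) - \<phi> (z k + x)) + l2 lborel (\<lambda>x. \<phi> (z k + x) - \<phi> x)"
      by (intro l2_triangle sq_integrable_add sq_integrable_diff h s\<phi> t)
    also have "l2 lborel (\<lambda>x. h (z k + x) - \<phi> (z k + x)) = l2 lborel (\<lambda>x. h x - \<phi> x)"
      by (rule l2_translate[of "\<lambda>x. h x - \<phi> x"]) simp
    finally show ?thesis
      using near K[OF that] l2_diff_commute[of lborel h \<phi>] by simp
  qed
  then show "\<exists>K. \<forall>k\<ge>K. norm (l2 lborel (\<lambda>x. h (z k + x) - h x) - 0) < e"
    by auto
qed

subsection \<open>Plancherel theorem\<close>

definition fourier_char :: "'a::euclidean_space \<Rightarrow> 'a \<Rightarrow> complex" where
  "fourier_char \<xi> x = cis (- 2 * pi * (\<xi> \<bullet> x))"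

lemma norm_fourier_char [simp]: "norm (fourier_char \<xi> x) = 1"
  by (simp add: fourier_char_def)

lemma fourier_char_zero [simp]: "fourier_char \<xi> 0 = 1"
  by (simp add: fourier_char_def)

lemma fourier_char_add: "fourier_char \<xi> (x + y) = fourier_char \<xi> x * fourier_char \<xi> y"
  by (simp add: fourier_char_def cis_mult algebra_simps)

lemma fourier_char_diff: "fourier_char \<xi> (x - y) = fourier_char \<xi> x * cnj (fourier_char \<xi> y)"
  by (simp add: fourier_char_def cis_mult cis_cnj algebra_simps)

lemma fourier_char_commute: "fourier_char \<xi> x = fourier_char x \<xi>"
  by (simp add: fourier_char_def inner_commute)

lemma fourier_char_measurable [measurable]:
  assumes [measurable]: "f \<in> borel_measurable M" "g \<in> borel_measurable M"
  shows "(\<lambda>x. fourier_char (f x) (g x)) \<in> borel_measurable M"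
proof -
  have [measurable]: "cis \<in> borel_measurable borel"
    by (intro borel_measurable_continuous_onI continuous_intros)
  show ?thesis unfolding fourier_char_def by measurable
qed

lemma fourier_L1_eq: "fourier_L1 f \<xi> = (\<integral>x. f x * fourier_char \<xi> x \<partial>lebesgue)"
proof -
  have "exp (- 2 * complex_of_real pi * \<i> * complex_of_real (\<xi> \<bullet> x)) = fourier_char \<xi> x" for x :: 'a
    unfolding fourier_char_def cis_conv_exp by (intro arg_cong[where f = exp]) simp
  then show ?thesis by (simp only: fourier_L1_def)
qed

lemma fourier_L1_lborel:
  assumes [measurable]: "f \<in> borel_measurable borel"
  shows "fourier_L1 f \<xi> = (\<integral>x. f x * fourier_char \<xi> x \<partial>lborel)"
  unfolding fourier_L1_eq by (rule integral_completion) simp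

lemma fourier_L1_cong:
  fixes f g :: "'a::euclidean_space \<Rightarrow> complex"
  assumes "AE x in lebesgue. f x = g x" "f \<in> borel_measurable lebesgue" "g \<in> borel_measurable lebesgue"
  shows "fourier_L1 f = fourier_L1 g"
proof
  fix \<xi> :: 'a
  have m: "(\<lambda>x. h x * fourier_char \<xi> x) \<in> borel_measurable lebesgue" 
    if "h \<in> borel_measurable lebesgue" for h
  proof -
    have "fourier_char \<xi> \<in> borel_measurable lebesgue"
      by (intro measurable_completion) simp
    then show ?thesis using that by (intro borel_measurable_times)
  qed
  show "fourier_L1 f \<xi> = fourier_L1 g \<xi>"
    unfolding fourier_L1_eq
    by (intro integral_cong_AE m assms(2,3)) (use assms(1) in \<open>eventually_elim, simp\<close>)
qed

lemma fourier_L1_measurable [measurable]: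
  assumes [measurable]: "f \<in> borel_measurable borel"
  shows "fourier_L1 f \<in> borel_measurable borel"
  unfolding fourier_L1_lborel[OF assms, abs_def] by measurable

lemma integrable_times_fourier_char:
  "integrable lborel f \<Longrightarrow> integrable lborel (\<lambda>x. f x * fourier_char \<xi> x)"
  by (rule Bochner_Integration.integrable_bound[of _ f]) (auto simp: norm_mult)

lemma norm_fourier_L1_le:
  assumes "integrable lborel f"
  shows "norm (fourier_L1 f \<xi>) \<le> (\<integral>x. norm (f x) \<partial>lborel)"
proof -
  have "f \<in> borel_measurable borel" using borel_measurable_integrable[OF assms] by simp
  then show ?thesis
    unfolding fourier_L1_lborel
    by (subst fourier_L1_lborel) (auto intro!: order_trans[OF integral_norm_bound] simp: norm_mult)
qed

lemma fourier_L1_add: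
  assumes "integrable lborel f" "integrable lborel g"
  shows "fourier_L1 (\<lambda>x. f x + g x) = (\<lambda>\<xi>. fourier_L1 f \<xi> + fourier_L1 g \<xi>)"
proof -
  have [measurable]: "f \<in> borel_measurable borel" "g \<in> borel_measurable borel"
    using assms by (auto dest: borel_measurable_integrable)
  show ?thesis
    using assms by (simp add: fourier_L1_lborel integrable_times_fourier_char algebra_simps fun_eq_iff)
qed

lemma fourier_L1_cmult:
  assumes "integrable lborel f"
  shows "fourier_L1 (\<lambda>x. c * f x) = (\<lambda>\<xi>. c * fourier_L1 f \<xi>)"
proof -
  have [measurable]: "f \<in> borel_measurable borel"
    using assms by (auto dest: borel_measurable_integrable)
  show ?thesis
    using assms by (simp add: fourier_L1_lborel integrable_times_fourier_char mult.assoc fun_eq_iff)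
qed

lemma fourier_L1_diff:
  assumes "integrable lborel f" "integrable lborel g"
  shows "fourier_L1 (\<lambda>x. f x - g x) = (\<lambda>\<xi>. fourier_L1 f \<xi> - fourier_L1 g \<xi>)"
  using fourier_L1_add[OF assms(1), of "\<lambda>x. -1 * g x"] fourier_L1_cmult[OF assms(2), of "-1"] assms(2)
  by simp

lemma fourier_L1_translate:
  assumes "integrable lborel f"
  shows "fourier_L1 (\<lambda>x. f (c + x)) \<xi> = fourier_char \<xi> (- c) * fourier_L1 f \<xi>"
proof -
  have [measurable]: "f \<in> borel_measurable borel"
    using assms by (auto dest: borel_measurable_integrable)
  have eq: "f (c + x) * fourier_char \<xi> x = fourier_char \<xi> (- c) * (f (c + x) * fourier_char \<xi> (c + x))" for x
  proof -
    have "fourier_char \<xi> x = fourier_char \<xi> (- c) * fourier_char \<xi> (c + x)"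
      by (simp add: fourier_char_add[symmetric])
    then show ?thesis by simp
  qed
  have "fourier_L1 (\<lambda>x. f (c + x)) \<xi> = (\<integral>x. fourier_char \<xi> (- c) * (f (c + x) * fourier_char \<xi> (c + x)) \<partial>lborel)"
    by (subst fourier_L1_lborel) (simp_all only: eq, simp)
  also have "\<dots> = fourier_char \<xi> (- c) * (\<integral>x. f (c + x) * fourier_char \<xi> (c + x) \<partial>lborel)"
    by simp
  also have "(\<integral>x. f (c + x) * fourier_char \<xi> (c + x) \<partial>lborel) = (\<integral>x. f x * fourier_char \<xi> x \<partial>lborel)"
    by (rule lborel_integral_translate[of "\<lambda>x. f x * fourier_char \<xi> x"]) simp
  finally show ?thesis by (simp add: fourier_L1_lborel)
qed

section \<open>Affine substitutions and product integrals\<close>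

lemma lborel_integral_affine:
  fixes f :: "'a::euclidean_space \<Rightarrow> 'b::{banach,second_countable_topology}"
  assumes [measurable]: "f \<in> borel_measurable borel" and "c \<noteq> 0"
  shows "(\<integral>x. f x \<partial>lborel) = \<bar>c\<bar> ^ DIM('a) *\<^sub>R (\<integral>x. f (t + c *\<^sub>R x) \<partial>lborel)"
  by (subst lborel_affine[OF assms(2), of t])
     (subst integral_density, auto simp: integral_distr)

lemma lborel_nn_integral_affine:
  fixes f :: "'a::euclidean_space \<Rightarrow> ennreal"
  assumes [measurable]: "f \<in> borel_measurable borel" and "c \<noteq> 0"
  shows "(\<integral>\<^sup>+x. f x \<partial>lborel) = \<bar>c\<bar> ^ DIM('a) * (\<integral>\<^sup>+x. f (t + c *\<^sub>R x) \<partial>lborel)"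
  by (subst lborel_affine[OF assms(2), of t])
     (simp add: nn_integral_density nn_integral_distr nn_integral_cmult ennreal_power)

lemma lborel_integrable_affine:
  fixes f :: "'a::euclidean_space \<Rightarrow> 'b::{banach,second_countable_topology}"
  assumes "integrable lborel f" and c: "c \<noteq> 0"
  shows "integrable lborel (\<lambda>x. f (t + c *\<^sub>R x))"
proof -
  have [measurable]: "f \<in> borel_measurable borel"
    using assms(1) by (auto dest: borel_measurable_integrable)
  have "integrable (density (distr lborel borel (\<lambda>x. t + c *\<^sub>R x)) (\<lambda>_. ennreal (\<bar>c\<bar> ^ DIM('a)))) f"
    using assms(1) lborel_affine[OF c, of t] by simp
  then have "integrable (distr lborel borel (\<lambda>x. t + c *\<^sub>R x)) (\<lambda>x. \<bar>c\<bar> ^ DIM('a) *\<^sub>R f x)"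
    by (subst (asm) integrable_density) auto
  then have "integrable lborel (\<lambda>x. \<bar>c\<bar> ^ DIM('a) *\<^sub>R f (t + c *\<^sub>R x))"
    by (subst (asm) integrable_distr_eq) auto
  from integrable_scaleR_right[OF this, of "1 / \<bar>c\<bar> ^ DIM('a)"] show ?thesis
    using c by simp
qed

lemma lborel_integral_prod:
  fixes f :: "'a::euclidean_space \<Rightarrow> real \<Rightarrow> complex"
  assumes "\<And>b. b \<in> Basis \<Longrightarrow> integrable lborel (f b)"
  shows "(\<integral>x. (\<Prod>b\<in>Basis. f b (x \<bullet> b)) \<partial>lborel) = (\<Prod>b\<in>Basis. (\<integral>x. f b x \<partial>lborel))"
proof -
  have [measurable]: "f b \<in> borel_measurable borel" if "b \<in> Basis" for b
    using assms[OF that] by (auto dest: borel_measurable_integrable)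
  interpret product_sigma_finite "\<lambda>_::'a. lborel :: real measure" ..
  have "(\<integral>x. (\<Prod>b\<in>Basis. f b (x \<bullet> b)) \<partial>lborel)
      = (\<integral>x. (\<Prod>b\<in>Basis. f b ((\<Sum>b\<in>Basis. x b *\<^sub>R b) \<bullet> b)) \<partial>(\<Pi>\<^sub>M b\<in>Basis. lborel))"
    by (subst lborel_eq) (subst integral_distr, auto)
  also have "\<dots> = (\<integral>x. (\<Prod>b\<in>Basis. f b (x b)) \<partial>(\<Pi>\<^sub>M b\<in>Basis. lborel))"
    by (intro Bochner_Integration.integral_cong prod.cong) auto
  also have "\<dots> = (\<Prod>b\<in>Basis. (\<integral>x. f b x \<partial>lborel))"
    by (rule product_integral_prod) (auto intro: assms)
  finally show ?thesis .
qed

lemma lborel_prod_integrable: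
  fixes f :: "'a::euclidean_space \<Rightarrow> complex" and g :: "'b::euclidean_space \<Rightarrow> complex"
  assumes "integrable lborel f" "integrable lborel g"
  shows "integrable lborel (\<lambda>(x, y). f x * g y)"
    and "(\<integral>p. f (fst p) * g (snd p) \<partial>lborel) = (\<integral>x. f x \<partial>lborel) * (\<integral>y. g y \<partial>lborel)"
proof -
  have [measurable]: "f \<in> borel_measurable borel" "g \<in> borel_measurable borel"
    using assms by (auto dest: borel_measurable_integrable)
  have m: "(\<lambda>(x, y). f x * g y) \<in> borel_measurable (lborel \<Otimes>\<^sub>M lborel)"
    by measurable
  have i: "integrable (lborel \<Otimes>\<^sub>M lborel) (\<lambda>(x, y). f x * g y)"
    by (rule lborel_pair.Fubini_integrable[OF m]) (use assms in \<open>auto simp: norm_mult\<close>)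
  then show "integrable lborel (\<lambda>(x, y). f x * g y)"
    by (simp add: lborel_prod)
  have "(\<integral>p. f (fst p) * g (snd p) \<partial>lborel) = (\<integral>p. (\<lambda>(x, y). f x * g y) p \<partial>(lborel \<Otimes>\<^sub>M lborel))"
    by (simp add: lborel_prod case_prod_beta)
  also have "\<dots> = (\<integral>x. \<integral>y. f x * g y \<partial>lborel \<partial>lborel)"
    using lborel_pair.integral_fst'[OF i] by simp
  finally show "(\<integral>p. f (fst p) * g (snd p) \<partial>lborel) = (\<integral>x. f x \<partial>lborel) * (\<integral>y. g y \<partial>lborel)"
    by simp
qed

section \<open>Gaussian averages of the squared Fourier transform\<close>

definition gauss :: "'a::euclidean_space \<Rightarrow> real" where
  "gauss x = (\<Prod>b\<in>Basis. exp (- (x \<bullet> b)\<^sup>2 / 2))"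

text \<open>The Fourier transform of \<open>gauss\<close>. Each factor is the normal density with
  standard deviation 1/(2 pi), so the kernel has mass 1 and its dilates \<open>scaled_kernel\<close>
  form an approximate identity.\<close>

definition gauss_kernel :: "'a::euclidean_space \<Rightarrow> real" where
  "gauss_kernel x = (\<Prod>b\<in>Basis. sqrt (2 * pi) * exp (- (2 * pi * (x \<bullet> b))\<^sup>2 / 2))"

lemma gauss_measurable [measurable]: "gauss \<in> borel_measurable borel"
  "gauss_kernel \<in> borel_measurable borel"
  unfolding gauss_def[abs_def] gauss_kernel_def[abs_def] by measurable

lemma gauss_kernel_nonneg [simp]: "0 \<le> gauss_kernel x"
  unfolding gauss_kernel_def by (intro prod_nonneg) auto

lemma gauss_kernel_uminus: "gauss_kernel (- x) = gauss_kernel x"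
  by (simp add: gauss_kernel_def)

lemma gauss_nonneg [simp]: "0 \<le> gauss x"
  unfolding gauss_def by (intro prod_nonneg) auto

lemma gauss_exp: "gauss x = exp (- (norm x)\<^sup>2 / 2)"
proof -
  have "gauss x = exp (\<Sum>b\<in>Basis. - (x \<bullet> b)\<^sup>2 / 2)"
    unfolding gauss_def by (rule exp_sum[symmetric]) auto
  also have "(\<Sum>b\<in>Basis. - (x \<bullet> b)\<^sup>2 / 2) = - (norm x)\<^sup>2 / 2"
    unfolding power2_norm_eq_inner euclidean_inner[of x x] 
    by (simp add: sum_divide_distrib[symmetric] sum_negf power2_eq_square)
  finally show ?thesis .
qed

lemma nn_integral_normal_density: "\<sigma> > 0 \<Longrightarrow> (\<integral>\<^sup>+x. ennreal (normal_density 0 \<sigma> x) \<partial>lborel) = 1"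
  by (subst nn_integral_eq_integral) auto

lemma nn_integral_gauss_kernel: "(\<integral>\<^sup>+x. ennreal (gauss_kernel x) \<partial>(lborel :: 'a::euclidean_space measure)) = 1"
proof -
  have eq: "sqrt (2 * pi) * exp (- (2 * pi * y)\<^sup>2 / 2) = normal_density 0 (1 / (2 * pi)) y" for y :: real
    by (simp add: normal_density_def power2_eq_square real_sqrt_divide real_sqrt_mult field_simps)
  have "(\<integral>\<^sup>+x. ennreal (gauss_kernel x) \<partial>(lborel :: 'a measure))
      = (\<integral>\<^sup>+x. (\<Prod>b\<in>(Basis :: 'a set). ennreal (normal_density 0 (1 / (2 * pi)) (x \<bullet> b))) \<partial>lborel)"
    unfolding gauss_kernel_def eq by (subst prod_ennreal) auto
  also have "\<dots> = (\<Prod>b\<in>(Basis :: 'a set). \<integral>\<^sup>+x. ennreal (normal_density 0 (1 / (2 * pi)) x) \<partial>lborel)"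
    by (rule nn_integral_lborel_prod) auto
  also have "\<dots> = 1" by (simp add: nn_integral_normal_density)
  finally show ?thesis .
qed

lemma integrable_gauss_1:
  "integrable lborel (\<lambda>x::real. complex_of_real (exp (- x\<^sup>2 / 2)))"
proof -
  have "integrable lborel (\<lambda>x. sqrt (2 * pi) * std_normal_density x)"
    by auto
  moreover have "(\<lambda>x. sqrt (2 * pi) * std_normal_density x) = (\<lambda>x::real. exp (- x\<^sup>2 / 2))"
    by (auto simp: std_normal_density_def fun_eq_iff)
  ultimately have "integrable lborel (\<lambda>x::real. exp (- x\<^sup>2 / 2))" by simp
  then show ?thesis by (rule integrable_of_real)
qed

lemma integrable_gauss: "integrable lborel (\<lambda>x::'a::euclidean_space. gauss x)"
proof (rule integrableI_nonneg)
  have i: "integrable lborel (\<lambda>x::real. exp (- x\<^sup>2 / 2))"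
    using integrable_Re[OF integrable_gauss_1] by simp
  have "(\<integral>\<^sup>+x. ennreal (gauss x) \<partial>(lborel :: 'a measure))
      = (\<integral>\<^sup>+x. (\<Prod>b\<in>(Basis :: 'a set). ennreal (exp (- (x \<bullet> b)\<^sup>2 / 2))) \<partial>lborel)"
    unfolding gauss_def by (subst prod_ennreal) auto
  also have "\<dots> = (\<Prod>b\<in>(Basis :: 'a set). \<integral>\<^sup>+x. ennreal (exp (- x\<^sup>2 / 2)) \<partial>lborel)"
    by (rule nn_integral_lborel_prod) auto
  also have "\<dots> = (\<Prod>b\<in>(Basis :: 'a set). ennreal (\<integral>x. exp (- x\<^sup>2 / 2) \<partial>lborel))"
    by (subst nn_integral_eq_integral[OF i]) auto
  also have "\<dots> < \<infinity>"
    by (simp add: ennreal_power less_top[symmetric])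
  finally show "(\<integral>\<^sup>+x. ennreal (gauss (x::'a)) \<partial>lborel) < \<infinity>" .
qed auto

text \<open>This is the characteristic function of the standard normal distribution, with the factor
  1/sqrt (2 pi) of its density moved to the other side.\<close>

lemma fourier_gauss_1:
  "(\<integral>x. complex_of_real (exp (- x\<^sup>2 / 2)) * cis (t * x) \<partial>lborel) = complex_of_real (sqrt (2 * pi) * exp (- t\<^sup>2 / 2))"
proof -
  have "complex_of_real (exp (- t\<^sup>2 / 2)) = (\<integral>x. iexp (t * x) \<partial>std_normal_distribution)"
    using fun_cong[OF char_std_normal_distribution, of t] by (simp add: char_def)
  also have "\<dots> = (\<integral>x. std_normal_density x *\<^sub>R iexp (t * x) \<partial>lborel)"
    by (rule integral_density) auto
  also have "\<dots> = (\<integral>x. complex_of_real (1 / sqrt (2 * pi)) * (complex_of_real (exp (- x\<^sup>2 / 2)) * cis (t * x)) \<partial>lborel)"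
    by (simp add: std_normal_density_def cis_conv_exp scaleR_conv_of_real mult.assoc)
  also have "\<dots> = complex_of_real (1 / sqrt (2 * pi)) * (\<integral>x. complex_of_real (exp (- x\<^sup>2 / 2)) * cis (t * x) \<partial>lborel)"
    by simp
  finally show ?thesis by (simp add: field_simps)
qed

lemma cis_sum: "finite A \<Longrightarrow> cis (\<Sum>x\<in>A. f x) = (\<Prod>x\<in>A. cis (f x))"
  by (induction rule: finite_induct) (auto simp: cis_mult[symmetric])

lemma fourier_gauss:
  "(\<integral>x. complex_of_real (gauss x) * fourier_char x z \<partial>lborel) = complex_of_real (gauss_kernel z)"
  for z :: "'a::euclidean_space"
proof -
  have "(\<integral>x. complex_of_real (gauss x) * fourier_char x z \<partial>lborel)
     = (\<integral>x. (\<Prod>b\<in>Basis. complex_of_real (exp (- (x \<bullet> b)\<^sup>2 / 2)) * cis ((- 2 * pi * (z \<bullet> b)) * (x \<bullet> b))) \<partial>lborel)"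
  proof (intro Bochner_Integration.integral_cong refl)
    fix x :: 'a
    have "fourier_char x z = (\<Prod>b\<in>Basis. cis ((- 2 * pi * (z \<bullet> b)) * (x \<bullet> b)))"
    proof -
      have "- 2 * pi * (x \<bullet> z) = (\<Sum>b\<in>Basis. (- 2 * pi * (z \<bullet> b)) * (x \<bullet> b))"
        by (subst euclidean_inner) (simp add: sum_distrib_left mult_ac)
      then show ?thesis
        unfolding fourier_char_def by (simp only: cis_sum[OF finite_Basis])
    qed
    then show "complex_of_real (gauss x) * fourier_char x z
        = (\<Prod>b\<in>Basis. complex_of_real (exp (- (x \<bullet> b)\<^sup>2 / 2)) * cis ((- 2 * pi * (z \<bullet> b)) * (x \<bullet> b)))"
      by (simp add: gauss_def prod.distrib)
  qed
  also have "\<dots> = (\<Prod>b\<in>Basis. \<integral>x. complex_of_real (exp (- x\<^sup>2 / 2)) * cis ((- 2 * pi * (z \<bullet> b)) * x) \<partial>lborel)"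
  proof (rule lborel_integral_prod)
    have [measurable]: "cis \<in> borel_measurable borel"
      by (intro borel_measurable_continuous_onI continuous_intros)
    show "integrable lborel (\<lambda>x. complex_of_real (exp (- x\<^sup>2 / 2)) * cis ((- 2 * pi * (z \<bullet> b)) * x))" for b
      by (rule Bochner_Integration.integrable_bound[OF integrable_gauss_1]) (auto simp: norm_mult)
  qed
  also have "\<dots> = complex_of_real (gauss_kernel z)"
    unfolding fourier_gauss_1 gauss_kernel_def by (simp add: power_mult_distrib)
  finally show ?thesis .
qed

lemma fourier_gauss_scaled:
  fixes z :: "'a::euclidean_space"
  assumes "\<epsilon> > 0"
  shows "(\<integral>x. complex_of_real (gauss (\<epsilon> *\<^sub>R x)) * fourier_char x z \<partial>lborel)
    = complex_of_real (gauss_kernel ((1 / \<epsilon>) *\<^sub>R z) / \<epsilon> ^ DIM('a))"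
proof -
  have "complex_of_real (gauss_kernel ((1 / \<epsilon>) *\<^sub>R z)) = (\<integral>x. complex_of_real (gauss x) * fourier_char x ((1 / \<epsilon>) *\<^sub>R z) \<partial>lborel)"
    by (rule fourier_gauss[symmetric])
  also have "\<dots> = \<epsilon> ^ DIM('a) *\<^sub>R (\<integral>x. complex_of_real (gauss (\<epsilon> *\<^sub>R x)) * fourier_char (\<epsilon> *\<^sub>R x) ((1 / \<epsilon>) *\<^sub>R z) \<partial>lborel)"
    using assms lborel_integral_affine[of "\<lambda>x. complex_of_real (gauss x) * fourier_char x ((1 / \<epsilon>) *\<^sub>R z)" \<epsilon> 0]
    by simp
  also have "(\<lambda>x. fourier_char (\<epsilon> *\<^sub>R x) ((1 / \<epsilon>) *\<^sub>R z)) = (\<lambda>x. fourier_char x z)"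
    using assms by (simp add: fourier_char_def fun_eq_iff)
  finally show ?thesis using assms by (simp add: scaleR_conv_of_real fun_eq_iff fourier_char_def)
qed

lemma borel_measurable_fst_snd [measurable (raw)]:
  fixes f :: "'a \<Rightarrow> 'b::euclidean_space \<times> 'c::euclidean_space"
  assumes "f \<in> borel_measurable M"
  shows "(\<lambda>x. fst (f x)) \<in> borel_measurable M" "(\<lambda>x. snd (f x)) \<in> borel_measurable M"
proof -
  have "fst \<in> borel_measurable (borel :: ('b \<times> 'c) measure)" "snd \<in> borel_measurable (borel :: ('b \<times> 'c) measure)"
    by (intro borel_measurable_continuous_onI continuous_intros)+
  then show "(\<lambda>x. fst (f x)) \<in> borel_measurable M" "(\<lambda>x. snd (f x)) \<in> borel_measurable M"
    using assms by (auto intro: measurable_compose)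
qed

definition scaled_kernel :: "real \<Rightarrow> 'a::euclidean_space \<Rightarrow> real" where
  "scaled_kernel \<epsilon> z = gauss_kernel ((1 / \<epsilon>) *\<^sub>R z) / \<epsilon> ^ DIM('a)"

lemma scaled_kernel_measurable [measurable]: "scaled_kernel \<epsilon> \<in> borel_measurable borel"
  unfolding scaled_kernel_def[abs_def] by measurable

lemma scaled_kernel_nonneg [simp]: "\<epsilon> > 0 \<Longrightarrow> 0 \<le> scaled_kernel \<epsilon> z"
  by (simp add: scaled_kernel_def)

lemma scaled_kernel_uminus: "scaled_kernel \<epsilon> (- x) = scaled_kernel \<epsilon> x"
  using gauss_kernel_uminus[of "(1 / \<epsilon>) *\<^sub>R x"] by (simp add: scaled_kernel_def)

text \<open>The substitution y = x - \<epsilon> w makes the kernel independent of \<epsilon>, which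
  moves into the argument of \<open>\<phi>\<close>.\<close>

lemma nn_integral_scaled_kernel:
  fixes \<phi> :: "'a::euclidean_space \<Rightarrow> ennreal"
  assumes [measurable]: "\<phi> \<in> borel_measurable borel" and "\<epsilon> > 0"
  shows "(\<integral>\<^sup>+y. \<phi> y * ennreal (scaled_kernel \<epsilon> (x - y)) \<partial>lborel)
    = (\<integral>\<^sup>+w. \<phi> (x - \<epsilon> *\<^sub>R w) * ennreal (gauss_kernel w) \<partial>lborel)"
proof -
  have "(\<integral>\<^sup>+y. \<phi> y * ennreal (scaled_kernel \<epsilon> (x - y)) \<partial>lborel)
     = ennreal (\<epsilon> ^ DIM('a)) * (\<integral>\<^sup>+w. \<phi> (x - \<epsilon> *\<^sub>R w) * ennreal (gauss_kernel w / \<epsilon> ^ DIM('a)) \<partial>lborel)"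
    using lborel_nn_integral_affine[of "\<lambda>y. \<phi> y * ennreal (scaled_kernel \<epsilon> (x - y))" "- \<epsilon>" x] assms(2)
    by (simp add: scaled_kernel_def ennreal_power)
  also have "\<dots> = (\<integral>\<^sup>+w. ennreal (\<epsilon> ^ DIM('a)) * (\<phi> (x - \<epsilon> *\<^sub>R w) * ennreal (gauss_kernel w / \<epsilon> ^ DIM('a))) \<partial>lborel)"
    by (rule nn_integral_cmult[symmetric]) measurable
  also have "\<dots> = (\<integral>\<^sup>+w. \<phi> (x - \<epsilon> *\<^sub>R w) * ennreal (gauss_kernel w) \<partial>lborel)"
  proof (intro nn_integral_cong)
    fix w :: 'a
    have "ennreal (\<epsilon> ^ DIM('a)) * ennreal (gauss_kernel w / \<epsilon> ^ DIM('a)) = ennreal (gauss_kernel w)"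
      using assms(2) by (subst ennreal_mult[symmetric]) auto
    then show "ennreal (\<epsilon> ^ DIM('a)) * (\<phi> (x - \<epsilon> *\<^sub>R w) * ennreal (gauss_kernel w / \<epsilon> ^ DIM('a)))
       = \<phi> (x - \<epsilon> *\<^sub>R w) * ennreal (gauss_kernel w)"
      by (simp only: mult.left_commute[of _ "\<phi> _"])
  qed
  finally show ?thesis .
qed

lemma nn_integral_lborel_pair:
  fixes f :: "'a::euclidean_space \<times> 'b::euclidean_space \<Rightarrow> ennreal"
  assumes [measurable]: "f \<in> borel_measurable borel"
  shows "(\<integral>\<^sup>+p. f p \<partial>lborel) = (\<integral>\<^sup>+x. \<integral>\<^sup>+y. f (x, y) \<partial>lborel \<partial>lborel)"
    and "(\<integral>\<^sup>+p. f p \<partial>lborel) = (\<integral>\<^sup>+y. \<integral>\<^sup>+x. f (x, y) \<partial>lborel \<partial>lborel)"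
proof -
  have m: "f \<in> borel_measurable (lborel \<Otimes>\<^sub>M lborel)"
    unfolding lborel_prod by simp
  show "(\<integral>\<^sup>+p. f p \<partial>lborel) = (\<integral>\<^sup>+x. \<integral>\<^sup>+y. f (x, y) \<partial>lborel \<partial>lborel)"
    using lborel.nn_integral_fst[OF m] by (simp add: lborel_prod)
  show "(\<integral>\<^sup>+p. f p \<partial>lborel) = (\<integral>\<^sup>+y. \<integral>\<^sup>+x. f (x, y) \<partial>lborel \<partial>lborel)"
    using lborel_pair.nn_integral_snd[OF m] by (simp add: lborel_prod)
qed

text \<open>The Gaussian makes the integral over one frequency and two positions absolutely
  convergent, which permits integrating the frequency first. That inner integral is the transform of
  a dilated Gaussian at the difference of the positions.\<close>

lemma gauss_mean_fourier:
  fixes h :: "'a::euclidean_space \<Rightarrow> complex"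
  assumes h: "integrable lborel h" and "\<epsilon> > 0"
  shows "(\<integral>\<xi>. complex_of_real (gauss (\<epsilon> *\<^sub>R \<xi>) * (cmod (fourier_L1 h \<xi>))\<^sup>2) \<partial>lborel)
    = (\<integral>p. h (fst p) * cnj (h (snd p)) * complex_of_real (scaled_kernel \<epsilon> (fst p - snd p)) \<partial>lborel)"
proof -
  have [measurable]: "h \<in> borel_measurable borel"
    using h by (auto dest: borel_measurable_integrable)
  define H where "H p = h (fst p) * cnj (h (snd p))" for p
  have [measurable]: "H \<in> borel_measurable borel"
    unfolding H_def[abs_def] by measurable
  have hc: "integrable lborel (\<lambda>y. cnj (h y))"
    by (rule Bochner_Integration.integrable_bound[OF h]) auto
  have H: "integrable lborel H"
    using lborel_prod_integrable(1)[OF h hc] by (simp add: H_def[abs_def] case_prod_beta')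
  have sq: "complex_of_real ((cmod (fourier_L1 h \<xi>))\<^sup>2) = (\<integral>p. H p * fourier_char \<xi> (fst p - snd p) \<partial>lborel)" for \<xi>
  proof -
    have i: "integrable lborel (\<lambda>x. h x * fourier_char \<xi> x)"
      by (rule integrable_times_fourier_char[OF h])
    have i': "integrable lborel (\<lambda>x. cnj (h x * fourier_char \<xi> x))"
      by (rule Bochner_Integration.integrable_bound[OF i]) (simp_all only: complex_mod_cnj, auto)
    have "complex_of_real ((cmod (fourier_L1 h \<xi>))\<^sup>2) = fourier_L1 h \<xi> * cnj (fourier_L1 h \<xi>)"
      by (rule complex_norm_square)
    also have "\<dots> = (\<integral>x. h x * fourier_char \<xi> x \<partial>lborel) * (\<integral>x. cnj (h x * fourier_char \<xi> x) \<partial>lborel)"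
      unfolding fourier_L1_lborel[OF \<open>h \<in> borel_measurable borel\<close>]
      by (subst Bochner_Integration.integral_cnj) (rule refl)
    also have "\<dots> = (\<integral>p. (h (fst p) * fourier_char \<xi> (fst p)) * cnj (h (snd p) * fourier_char \<xi> (snd p)) \<partial>lborel)"
      by (rule lborel_prod_integrable(2)[OF i i', symmetric])
    also have "\<dots> = (\<integral>p. H p * fourier_char \<xi> (fst p - snd p) \<partial>lborel)"
      by (simp add: H_def fourier_char_diff mult_ac)
    finally show ?thesis .
  qed
  have g: "integrable lborel (\<lambda>\<xi>::'a. complex_of_real (gauss (\<epsilon> *\<^sub>R \<xi>)))"
    using lborel_integrable_affine[OF integrable_of_real[OF integrable_gauss[where 'a = 'a]], of \<epsilon> 0] assms(2) by simp
  define F where "F \<xi> p = complex_of_real (gauss (\<epsilon> *\<^sub>R \<xi>)) * (H p * fourier_char \<xi> (fst p - snd p))" for \<xi> p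
  \<comment> \<open>Characters have modulus 1, so the product of the Gaussian with \<open>H\<close>
    is an integrable majorant.\<close>
  have Fi: "integrable (lborel \<Otimes>\<^sub>M lborel) (case_prod F)"
    unfolding lborel_prod
  proof (rule Bochner_Integration.integrable_bound[OF lborel_prod_integrable(1)[OF g H]])
    have "case_prod F = (\<lambda>q. complex_of_real (gauss (\<epsilon> *\<^sub>R fst q)) * (H (snd q) * fourier_char (fst q) (fst (snd q) - snd (snd q))))"
      by (auto simp: F_def fun_eq_iff)
    also have "\<dots> \<in> borel_measurable lborel"
      by measurable
    finally show "case_prod F \<in> borel_measurable lborel" .
    show "AE x in lborel. cmod (case x of (\<xi>, p) \<Rightarrow> F \<xi> p)
       \<le> cmod (case x of (\<xi>, p) \<Rightarrow> complex_of_real (gauss (\<epsilon> *\<^sub>R \<xi>)) * H p)"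
      by (intro AE_I2) (auto simp: F_def norm_mult)
  qed
  have "(\<integral>\<xi>. complex_of_real (gauss (\<epsilon> *\<^sub>R \<xi>) * (cmod (fourier_L1 h \<xi>))\<^sup>2) \<partial>lborel)
      = (\<integral>\<xi>. (\<integral>p. F \<xi> p \<partial>lborel) \<partial>lborel)"
    by (simp only: of_real_mult sq F_def integral_mult_right_zero)
  also have "\<dots> = (\<integral>p. (\<integral>\<xi>. F \<xi> p \<partial>lborel) \<partial>lborel)"
    by (rule lborel_pair.Fubini_integral[OF Fi, symmetric])
  also have "\<dots> = (\<integral>p. H p * (\<integral>\<xi>. complex_of_real (gauss (\<epsilon> *\<^sub>R \<xi>)) * fourier_char \<xi> (fst p - snd p) \<partial>lborel) \<partial>lborel)"
    by (simp add: F_def integral_mult_right_zero[symmetric] mult.left_commute del: integral_mult_right_zero)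
  also have "\<dots> = (\<integral>p. H p * complex_of_real (scaled_kernel \<epsilon> (fst p - snd p)) \<partial>lborel)"
    by (simp only: fourier_gauss_scaled[OF assms(2)] scaled_kernel_def)
  finally show ?thesis by (simp only: H_def)
qed

text \<open>
  Polarisation \<open>2 Re (u v\<^sup>*) = |u|\<^sup>2 + |v|\<^sup>2 - |u - v|\<^sup>2\<close> isolates the error term, which vanishes as \<open>\<epsilon>\<close> tends to \<open>0\<close>
  because translations are continuous in quadratic mean.
\<close>

lemma autocorrelation_mean:
  fixes h :: "'a::euclidean_space \<Rightarrow> complex"
  assumes h: "sq_integrable lborel h" and e: "\<epsilon> > 0"
  defines "k \<equiv> \<lambda>p. scaled_kernel \<epsilon> (fst p - snd p)"
  shows "Re (\<integral>p. h (fst p) * cnj (h (snd p)) * complex_of_real (k p) \<partial>lborel)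
    = (l2 lborel h)\<^sup>2 - (\<integral>p. (cmod (h (fst p) - h (snd p)))\<^sup>2 * k p \<partial>lborel) / 2"
    and "integrable lborel (\<lambda>p. (cmod (h (fst p) - h (snd p)))\<^sup>2 * k p)"
proof -
  have [measurable]: "h \<in> borel_measurable borel"
    using sq_integrable_measurable[OF h] by simp
  have [measurable]: "k \<in> borel_measurable borel"
    unfolding k_def by measurable
  have kn: "0 \<le> k p" for p using e by (simp add: k_def)
  \<comment> \<open>Mass 1 in each variable makes both diagonal terms \<open>A\<close> and
    \<open>B\<close> integrate to the squared norm of \<open>h\<close>.\<close>
  have one: "(\<integral>\<^sup>+y. ennreal (scaled_kernel \<epsilon> (x - y)) \<partial>lborel) = 1" for x :: 'a
    using nn_integral_scaled_kernel[of "\<lambda>_. 1" \<epsilon> x] e nn_integral_gauss_kernel by simp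
  have one': "(\<integral>\<^sup>+x. ennreal (scaled_kernel \<epsilon> (x - y)) \<partial>lborel) = 1" for y :: 'a
    using one[of y] scaled_kernel_uminus[of \<epsilon> "y - _"] by simp
  define A B D where "A p = (cmod (h (fst p)))\<^sup>2 * k p" and "B p = (cmod (h (snd p)))\<^sup>2 * k p"
    and "D p = (cmod (h (fst p) - h (snd p)))\<^sup>2 * k p" for p
  have [measurable]: "A \<in> borel_measurable borel" "B \<in> borel_measurable borel" "D \<in> borel_measurable borel"
    unfolding A_def[abs_def] B_def[abs_def] D_def[abs_def] by measurable
  have nn: "0 \<le> A p" "0 \<le> B p" "0 \<le> D p" for p using kn by (auto simp: A_def B_def D_def)
  have A1: "(\<integral>\<^sup>+p. ennreal (A p) \<partial>lborel) = ennreal ((l2 lborel h)\<^sup>2)"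
  proof -
    have "(\<integral>\<^sup>+p. ennreal (A p) \<partial>lborel) = (\<integral>\<^sup>+x. \<integral>\<^sup>+y. ennreal ((cmod (h x))\<^sup>2) * ennreal (scaled_kernel \<epsilon> (x - y)) \<partial>lborel \<partial>lborel)"
      by (subst nn_integral_lborel_pair(1)) (simp_all add: A_def k_def ennreal_mult e)
    also have "\<dots> = (\<integral>\<^sup>+x. ennreal ((cmod (h x))\<^sup>2) \<partial>lborel)"
      by (simp add: nn_integral_cmult one)
    finally show ?thesis using nn_integral_l2[OF h] by simp
  qed
  have B1: "(\<integral>\<^sup>+p. ennreal (B p) \<partial>lborel) = ennreal ((l2 lborel h)\<^sup>2)"
  proof -
    have "(\<integral>\<^sup>+p. ennreal (B p) \<partial>lborel) = (\<integral>\<^sup>+y. \<integral>\<^sup>+x. ennreal ((cmod (h y))\<^sup>2) * ennreal (scaled_kernel \<epsilon> (x - y)) \<partial>lborel \<partial>lborel)"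
      by (subst nn_integral_lborel_pair(2)) (simp_all add: B_def k_def ennreal_mult e)
    also have "\<dots> = (\<integral>\<^sup>+x. ennreal ((cmod (h x))\<^sup>2) \<partial>lborel)"
      by (simp add: nn_integral_cmult one')
    finally show ?thesis using nn_integral_l2[OF h] by simp
  qed
  have Ai: "integrable lborel A" "integrable lborel B"
    by (auto intro!: integrableI_nonneg simp: nn A1 B1)
  have Av: "(\<integral>p. A p \<partial>lborel) = (l2 lborel h)\<^sup>2" "(\<integral>p. B p \<partial>lborel) = (l2 lborel h)\<^sup>2"
    by (subst integral_eq_nn_integral; simp add: nn A1 B1)+
  have AB: "integrable lborel (\<lambda>p. 2 * A p + 2 * B p)" using Ai by simp
  have Di: "integrable lborel D"
  proof (rule Bochner_Integration.integrable_bound[OF AB])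
    show "AE p in lborel. norm (D p) \<le> norm (2 * A p + 2 * B p)"
    proof (rule AE_I2)
      fix p
      have "(cmod (h (fst p) - h (snd p)))\<^sup>2 \<le> (cmod (h (fst p)) + cmod (h (snd p)))\<^sup>2"
        by (intro power_mono norm_triangle_ineq4) auto
      also have "\<dots> \<le> 2 * (cmod (h (fst p)))\<^sup>2 + 2 * (cmod (h (snd p)))\<^sup>2"
        using sum_squares_bound[of "cmod (h (fst p))" "cmod (h (snd p))"] by (simp add: power2_sum)
      finally have le: "(cmod (h (fst p) - h (snd p)))\<^sup>2 \<le> 2 * (cmod (h (fst p)))\<^sup>2 + 2 * (cmod (h (snd p)))\<^sup>2" .
      from mult_right_mono[OF le kn[of p]] have "D p \<le> 2 * A p + 2 * B p"
        by (simp add: A_def B_def D_def ring_distribs mult.assoc)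
      then show "norm (D p) \<le> norm (2 * A p + 2 * B p)"
        using nn[of p] by simp
    qed
  qed simp
  then show "integrable lborel (\<lambda>p. (cmod (h (fst p) - h (snd p)))\<^sup>2 * k p)"
    by (simp only: D_def[abs_def])
  have id: "Re (u * cnj v) = ((cmod u)\<^sup>2 + (cmod v)\<^sup>2 - (cmod (u - v))\<^sup>2) / 2" for u v
    unfolding cmod_power2 by (simp add: power2_eq_square algebra_simps)
  have RP: "Re (h (fst p) * cnj (h (snd p)) * complex_of_real (k p)) = (A p + B p - D p) / 2" for p
  proof -
    have *: "Re (z * complex_of_real r) = Re z * r" for z r by simp
    have **: "((a + b - c) / 2) * r = (a * r + b * r - c * r) / 2" for a b c r :: real
      by (simp add: field_simps)
    have "Re (h (fst p) * cnj (h (snd p)) * complex_of_real (k p)) = Re (h (fst p) * cnj (h (snd p))) * k p"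
      by (rule *)
    also have "\<dots> = (A p + B p - D p) / 2"
      unfolding id A_def B_def D_def by (rule **)
    finally show ?thesis .
  qed
  have Pi: "integrable lborel (\<lambda>p. h (fst p) * cnj (h (snd p)) * complex_of_real (k p))"
  proof (rule Bochner_Integration.integrable_bound[OF AB])
    show "AE p in lborel. norm (h (fst p) * cnj (h (snd p)) * complex_of_real (k p)) \<le> norm (2 * A p + 2 * B p)"
    proof (rule AE_I2)
      fix p
      have "cmod (h (fst p)) * cmod (h (snd p)) \<le> 2 * (cmod (h (fst p)))\<^sup>2 + 2 * (cmod (h (snd p)))\<^sup>2"
        using sum_squares_bound[of "cmod (h (fst p))" "cmod (h (snd p))"]
          mult_nonneg_nonneg[OF norm_ge_zero[of "h (fst p)"] norm_ge_zero[of "h (snd p)"]]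
          zero_le_power2[of "cmod (h (fst p))"] zero_le_power2[of "cmod (h (snd p))"]
        by linarith
      from mult_right_mono[OF this kn[of p]]
      show "norm (h (fst p) * cnj (h (snd p)) * complex_of_real (k p)) \<le> norm (2 * A p + 2 * B p)"
        using kn[of p] by (simp add: A_def B_def norm_mult ring_distribs mult.assoc)
    qed
  qed measurable
  have "Re (\<integral>p. h (fst p) * cnj (h (snd p)) * complex_of_real (k p) \<partial>lborel) = (\<integral>p. (A p + B p - D p) / 2 \<partial>lborel)"
    by (simp only: integral_Re[OF Pi, symmetric] RP)
  also have "\<dots> = (l2 lborel h)\<^sup>2 - (\<integral>p. D p \<partial>lborel) / 2"
    using Ai Di Av by simp
  finally show "Re (\<integral>p. h (fst p) * cnj (h (snd p)) * complex_of_real (k p) \<partial>lborel)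
    = (l2 lborel h)\<^sup>2 - (\<integral>p. (cmod (h (fst p) - h (snd p)))\<^sup>2 * k p \<partial>lborel) / 2"
    by (simp only: D_def)
qed

text \<open>In the variable w = (x - y)/\<epsilon> the defect becomes the mean of the squared
  modulus of continuity \<open>\<omega>\<close> at - \<epsilon> w against a fixed probability
  density. The integrand tends to 0 pointwise by continuity of translations, and
  \<open>\<omega>\<close> never exceeds \<open>(2 * l2 lborel h)\<^sup>2\<close>.\<close>

lemma mean_translation_defect_tendsto:
  fixes h :: "'a::euclidean_space \<Rightarrow> complex"
  assumes h: "sq_integrable lborel h" and e: "\<And>j. \<epsilon> j > 0" "\<epsilon> \<longlonglongrightarrow> 0"
  shows "(\<lambda>j. \<integral>p. (cmod (h (fst p) - h (snd p)))\<^sup>2 * scaled_kernel (\<epsilon> j) (fst p - snd p) \<partial>lborel) \<longlonglongrightarrow> 0"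
proof -
  have [measurable]: "h \<in> borel_measurable borel"
    using sq_integrable_measurable[OF h] by simp
  define \<omega> where "\<omega> z = (\<integral>\<^sup>+x. ennreal ((cmod (h (z + x) - h x))\<^sup>2) \<partial>lborel)" for z
  have [measurable]: "\<omega> \<in> borel_measurable borel"
    unfolding \<omega>_def[abs_def] by measurable
  have \<omega>: "\<omega> z = ennreal ((l2 lborel (\<lambda>x. h (z + x) - h x))\<^sup>2)" for z
    unfolding \<omega>_def by (intro nn_integral_l2 sq_integrable_diff sq_integrable_translate h)
  have eq: "(\<integral>p. (cmod (h (fst p) - h (snd p)))\<^sup>2 * scaled_kernel (\<epsilon> j) (fst p - snd p) \<partial>lborel)
     = enn2real (\<integral>\<^sup>+w. \<omega> (- \<epsilon> j *\<^sub>R w) * ennreal (gauss_kernel w) \<partial>lborel)" for j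
  proof -
    have "(\<integral>p. (cmod (h (fst p) - h (snd p)))\<^sup>2 * scaled_kernel (\<epsilon> j) (fst p - snd p) \<partial>lborel)
      = enn2real (\<integral>\<^sup>+p. ennreal ((cmod (h (fst p) - h (snd p)))\<^sup>2 * scaled_kernel (\<epsilon> j) (fst p - snd p)) \<partial>lborel)"
      by (rule integral_eq_nn_integral) (auto simp: e(1))
    also have "(\<integral>\<^sup>+p. ennreal ((cmod (h (fst p) - h (snd p)))\<^sup>2 * scaled_kernel (\<epsilon> j) (fst p - snd p)) \<partial>lborel)
       = (\<integral>\<^sup>+x. \<integral>\<^sup>+y. ennreal ((cmod (h x - h y))\<^sup>2) * ennreal (scaled_kernel (\<epsilon> j) (x - y)) \<partial>lborel \<partial>lborel)"
      by (subst nn_integral_lborel_pair(1)) (simp_all add: ennreal_mult e(1))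
    also have "\<dots> = (\<integral>\<^sup>+x. \<integral>\<^sup>+w. ennreal ((cmod (h x - h (x - \<epsilon> j *\<^sub>R w)))\<^sup>2) * ennreal (gauss_kernel w) \<partial>lborel \<partial>lborel)"
      by (subst nn_integral_scaled_kernel) (auto simp: e(1))
    also have "\<dots> = (\<integral>\<^sup>+w. \<integral>\<^sup>+x. ennreal ((cmod (h x - h (x - \<epsilon> j *\<^sub>R w)))\<^sup>2) * ennreal (gauss_kernel w) \<partial>lborel \<partial>lborel)"
      by (rule lborel_pair.Fubini') (simp add: case_prod_beta)
    also have "\<dots> = (\<integral>\<^sup>+w. \<omega> (- \<epsilon> j *\<^sub>R w) * ennreal (gauss_kernel w) \<partial>lborel)"
      by (simp add: nn_integral_multc \<omega>_def norm_minus_commute[of "h _" "h (_ - _)"])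
    finally show ?thesis .
  qed
  have "(\<lambda>j. \<integral>\<^sup>+w. \<omega> (- \<epsilon> j *\<^sub>R w) * ennreal (gauss_kernel w) \<partial>lborel) \<longlonglongrightarrow> (\<integral>\<^sup>+w. 0 \<partial>(lborel :: 'a measure))"
  proof (rule nn_integral_dominated_convergence)
    show "(\<integral>\<^sup>+w. ennreal ((2 * l2 lborel h)\<^sup>2) * ennreal (gauss_kernel w) \<partial>(lborel :: 'a measure)) < \<infinity>"
      by (simp add: nn_integral_cmult nn_integral_gauss_kernel)
    show "AE w in lborel. \<omega> (- \<epsilon> j *\<^sub>R w) * ennreal (gauss_kernel w) \<le> ennreal ((2 * l2 lborel h)\<^sup>2) * ennreal (gauss_kernel w)" for j
    proof (intro AE_I2 mult_right_mono)
      fix w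
      have "l2 lborel (\<lambda>x. h (- \<epsilon> j *\<^sub>R w + x) - h x) \<le> l2 lborel (\<lambda>x. h (- \<epsilon> j *\<^sub>R w + x)) + l2 lborel h"
        by (intro l2_triangle_diff sq_integrable_translate h)
      also have "\<dots> = 2 * l2 lborel h"
        by (subst l2_translate) auto
      finally show "\<omega> (- \<epsilon> j *\<^sub>R w) \<le> ennreal ((2 * l2 lborel h)\<^sup>2)"
        unfolding \<omega> by (intro ennreal_leI power_mono) auto
    qed auto
    show "AE w in lborel. (\<lambda>j. \<omega> (- \<epsilon> j *\<^sub>R w) * ennreal (gauss_kernel w)) \<longlonglongrightarrow> 0"
    proof (rule AE_I2)
      fix w :: 'a
      have "(\<lambda>j. - \<epsilon> j *\<^sub>R w) \<longlonglongrightarrow> - 0 *\<^sub>R w"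
        by (intro tendsto_intros e(2))
      then have "(\<lambda>j. - \<epsilon> j *\<^sub>R w) \<longlonglongrightarrow> 0" by simp
      from tendsto_power[OF l2_translate_tendsto[OF h this], of 2]
      have "(\<lambda>j. (l2 lborel (\<lambda>x. h (- \<epsilon> j *\<^sub>R w + x) - h x))\<^sup>2 * gauss_kernel w) \<longlonglongrightarrow> 0"
        by (intro tendsto_mult_left_zero) simp
      then have "(\<lambda>j. ennreal ((l2 lborel (\<lambda>x. h (- \<epsilon> j *\<^sub>R w + x) - h x))\<^sup>2 * gauss_kernel w)) \<longlonglongrightarrow> ennreal 0"
        by (rule tendsto_ennrealI)
      then show "(\<lambda>j. \<omega> (- \<epsilon> j *\<^sub>R w) * ennreal (gauss_kernel w)) \<longlonglongrightarrow> 0"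
        unfolding \<omega> by (simp add: ennreal_mult)
    qed
  qed measurable
  then have "(\<lambda>j. enn2real (\<integral>\<^sup>+w. \<omega> (- \<epsilon> j *\<^sub>R w) * ennreal (gauss_kernel w) \<partial>lborel)) \<longlonglongrightarrow> enn2real 0"
    by (intro tendsto_enn2real) auto
  then show ?thesis unfolding eq by simp
qed

text \<open>As \<epsilon> decreases to 0 the Gaussian weights increase to 1. Monotone convergence on
  the frequency side therefore produces square integrability of the transform together with its
  norm, while the other side converges by \<open>autocorrelation_mean\<close> and
  \<open>mean_translation_defect_tendsto\<close>.\<close>

theorem plancherel_L1:
  fixes h :: "'a::euclidean_space \<Rightarrow> complex"
  assumes h1: "integrable lborel h" and h2: "sq_integrable lborel h"
  shows "sq_integrable lborel (fourier_L1 h)" and "l2 lborel (fourier_L1 h) = l2 lborel h"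
proof -
  have [measurable]: "h \<in> borel_measurable borel"
    using sq_integrable_measurable[OF h2] by simp
  define \<epsilon> where "\<epsilon> j = 1 / real (Suc j)" for j
  have e: "\<And>j. \<epsilon> j > 0" "\<epsilon> \<longlonglongrightarrow> 0"
    using LIMSEQ_inverse_real_of_nat by (auto simp: \<epsilon>_def[abs_def] inverse_eq_divide)
  define I where "I j = (\<integral>\<xi>. gauss (\<epsilon> j *\<^sub>R \<xi>) * (cmod (fourier_L1 h \<xi>))\<^sup>2 \<partial>lborel)" for j
  have I: "I j = (l2 lborel h)\<^sup>2 - (\<integral>p. (cmod (h (fst p) - h (snd p)))\<^sup>2 * scaled_kernel (\<epsilon> j) (fst p - snd p) \<partial>lborel) / 2" for j
  proof -
    have "complex_of_real (I j) = (\<integral>\<xi>. complex_of_real (gauss (\<epsilon> j *\<^sub>R \<xi>) * (cmod (fourier_L1 h \<xi>))\<^sup>2) \<partial>lborel)"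
      unfolding I_def by (rule integral_complex_of_real[symmetric])
    then have "I j = Re (\<integral>\<xi>. complex_of_real (gauss (\<epsilon> j *\<^sub>R \<xi>) * (cmod (fourier_L1 h \<xi>))\<^sup>2) \<partial>lborel)"
      by (metis Re_complex_of_real)
    then show ?thesis
      by (simp only: gauss_mean_fourier[OF h1 e(1)] autocorrelation_mean(1)[OF h2 e(1)])
  qed
  have "(\<lambda>j. (l2 lborel h)\<^sup>2 - (\<integral>p. (cmod (h (fst p) - h (snd p)))\<^sup>2 * scaled_kernel (\<epsilon> j) (fst p - snd p) \<partial>lborel) / 2)
     \<longlonglongrightarrow> (l2 lborel h)\<^sup>2 - 0 / 2"
    by (intro tendsto_intros mean_translation_defect_tendsto h2 e) simp
  then have "(\<lambda>j. ennreal (I j)) \<longlonglongrightarrow> ennreal ((l2 lborel h)\<^sup>2)"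
    unfolding I by (intro tendsto_ennrealI) simp
  moreover have "(\<lambda>j. \<integral>\<^sup>+\<xi>. ennreal (gauss (\<epsilon> j *\<^sub>R \<xi>) * (cmod (fourier_L1 h \<xi>))\<^sup>2) \<partial>lborel)
      \<longlonglongrightarrow> (\<integral>\<^sup>+\<xi>. ennreal ((cmod (fourier_L1 h \<xi>))\<^sup>2) \<partial>lborel)"
  proof (rule nn_integral_LIMSEQ)
    show "incseq (\<lambda>j \<xi>. ennreal (gauss (\<epsilon> j *\<^sub>R \<xi>) * (cmod (fourier_L1 h \<xi>))\<^sup>2))"
    proof (intro incseq_SucI le_funI ennreal_leI mult_right_mono)
      fix j :: nat and \<xi> :: 'a
      have "\<epsilon> (Suc j) * norm \<xi> \<le> \<epsilon> j * norm \<xi>"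
        by (intro mult_right_mono) (auto simp: \<epsilon>_def field_simps)
      then have "(\<epsilon> (Suc j) * norm \<xi>)\<^sup>2 \<le> (\<epsilon> j * norm \<xi>)\<^sup>2"
        using e(1)[of "Suc j"] by (intro power_mono) auto
      then show "gauss (\<epsilon> j *\<^sub>R \<xi>) \<le> gauss (\<epsilon> (Suc j) *\<^sub>R \<xi>)"
        by (simp add: gauss_exp power_mult_distrib)
    qed auto
    show "(\<lambda>j. ennreal (gauss (\<epsilon> j *\<^sub>R \<xi>) * (cmod (fourier_L1 h \<xi>))\<^sup>2)) \<longlonglongrightarrow> ennreal ((cmod (fourier_L1 h \<xi>))\<^sup>2)" for \<xi> :: 'a
    proof -
      have "(\<lambda>j. exp (- (norm (\<epsilon> j *\<^sub>R \<xi>))\<^sup>2 / 2) * (cmod (fourier_L1 h \<xi>))\<^sup>2) \<longlonglongrightarrow> exp (- (norm (0 *\<^sub>R \<xi>))\<^sup>2 / 2) * (cmod (fourier_L1 h \<xi>))\<^sup>2"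
        by (intro tendsto_intros e(2)) simp
      then show ?thesis by (intro tendsto_ennrealI) (simp add: gauss_exp)
    qed
  qed measurable
  moreover have "(\<integral>\<^sup>+\<xi>. ennreal (gauss (\<epsilon> j *\<^sub>R \<xi>) * (cmod (fourier_L1 h \<xi>))\<^sup>2) \<partial>lborel) = ennreal (I j)" for j
    unfolding I_def
  proof (rule nn_integral_eq_integral)
    \<comment> \<open>For each fixed j the transform is bounded by the L^1 norm of \<open>h\<close>,
      so the weighted square is integrable and its two integrals agree.\<close>
    have g: "integrable lborel (\<lambda>\<xi>::'a. gauss (\<epsilon> j *\<^sub>R \<xi>) * (\<integral>x. norm (h x) \<partial>lborel)\<^sup>2)"
      using lborel_integrable_affine[OF integrable_gauss[where 'a = 'a], of "\<epsilon> j" 0] e(1)[of j] by simp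
    show "integrable lborel (\<lambda>\<xi>. gauss (\<epsilon> j *\<^sub>R \<xi>) * (cmod (fourier_L1 h \<xi>))\<^sup>2)"
      by (rule Bochner_Integration.integrable_bound[OF g])
         (auto intro!: mult_left_mono power_mono norm_fourier_L1_le h1 simp: abs_mult)
  qed auto
  ultimately have *: "(\<integral>\<^sup>+\<xi>. ennreal ((cmod (fourier_L1 h \<xi>))\<^sup>2) \<partial>lborel) = ennreal ((l2 lborel h)\<^sup>2)"
    by (simp add: LIMSEQ_unique)
  show s: "sq_integrable lborel (fourier_L1 h)"
    by (rule sq_integrable_nn_integral) (simp_all add: *)
  have "(l2 lborel (fourier_L1 h))\<^sup>2 = (l2 lborel h)\<^sup>2"
    using * nn_integral_l2[OF s] by simp
  then show "l2 lborel (fourier_L1 h) = l2 lborel h"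
    by (simp add: power2_eq_iff_nonneg)
qed

subsection \<open>The Fourier transform of square integrable functions\<close>

lemma Re_integral_mult_cnj:
  assumes "sq_integrable M f" "sq_integrable M g"
  shows "Re (\<integral>x. f x * cnj (g x) \<partial>M) = ((l2 M (\<lambda>x. f x + g x))\<^sup>2 - (l2 M f)\<^sup>2 - (l2 M g)\<^sup>2) / 2"
proof -
  have i: "integrable M (\<lambda>x. f x * cnj (g x))"
    by (intro sq_integrable_mult sq_integrable_cnj assms)
  have j: "integrable M (\<lambda>x. (norm (f x))\<^sup>2)" "integrable M (\<lambda>x. (norm (g x))\<^sup>2)"
     "integrable M (\<lambda>x. (norm (f x + g x))\<^sup>2)"
    using assms by (auto intro: sq_integrableD sq_integrable_add)
  have id: "Re (u * cnj v) = ((cmod (u + v))\<^sup>2 - (cmod u)\<^sup>2 - (cmod v)\<^sup>2) / 2" for u v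
    unfolding cmod_power2 by (simp add: power2_eq_square algebra_simps)
  have "Re (\<integral>x. f x * cnj (g x) \<partial>M) = (\<integral>x. ((cmod (f x + g x))\<^sup>2 - (cmod (f x))\<^sup>2 - (cmod (g x))\<^sup>2) / 2 \<partial>M)"
    by (simp only: integral_Re[OF i, symmetric] id)
  then show ?thesis
    using j by (simp add: l2_power2)
qed

text \<open>Polarisation: the real part is determined by norms, which Plancherel preserves, and
  replacing \<open>g\<close> by \<i> \<open>g\<close> gives the imaginary part.\<close>

theorem parseval_L1:
  assumes "integrable lborel f" "sq_integrable lborel f" "integrable lborel g" "sq_integrable lborel g"
  shows "(\<integral>x. f x * cnj (g x) \<partial>lborel) = (\<integral>\<xi>. fourier_L1 f \<xi> * cnj (fourier_L1 g \<xi>) \<partial>lborel)"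
proof -
  have Re: "Re (\<integral>x. f x * cnj (g x) \<partial>lborel) = Re (\<integral>\<xi>. fourier_L1 f \<xi> * cnj (fourier_L1 g \<xi>) \<partial>lborel)"
    if "integrable lborel g" "sq_integrable lborel g" for g
  proof -
    have "l2 lborel (\<lambda>x. fourier_L1 f x + fourier_L1 g x) = l2 lborel (fourier_L1 (\<lambda>x. f x + g x))"
      using assms that by (simp add: fourier_L1_add)
    also have "\<dots> = l2 lborel (\<lambda>x. f x + g x)"
      using assms that by (intro plancherel_L1 sq_integrable_add) auto
    finally show ?thesis
      using assms that by (simp add: Re_integral_mult_cnj plancherel_L1)
  qed
  have Im: "Im z = Re (- \<i> * z)" for z by simp
  have rot: "- \<i> * (\<integral>x. u x * cnj (v x) \<partial>lborel) = (\<integral>x. u x * cnj (\<i> * v x) \<partial>lborel)" for u v :: "'a \<Rightarrow> complex"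
    by (simp only: integral_mult_right_zero[symmetric]) (simp add: mult.left_commute)
  have "Im (\<integral>x. f x * cnj (g x) \<partial>lborel) = Re (\<integral>x. f x * cnj (\<i> * g x) \<partial>lborel)"
    by (simp only: Im rot)
  also have "\<dots> = Re (\<integral>\<xi>. fourier_L1 f \<xi> * cnj (fourier_L1 (\<lambda>x. \<i> * g x) \<xi>) \<partial>lborel)"
    using assms by (intro Re sq_integrable_cmult) auto
  also have "\<dots> = Im (\<integral>\<xi>. fourier_L1 f \<xi> * cnj (fourier_L1 g \<xi>) \<partial>lborel)"
    using assms by (simp only: Im rot fourier_L1_cmult)
  finally show ?thesis
    using Re[OF assms(3,4)] by (intro complex_eqI)
qed

section \<open>Completeness and the extension of the transform by limits\<close>

text \<open>Along a subsequence with steps of norm at most \<open>(1/4) ^ k\<close>, the sum of 2^k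
  |d k|^2 has finite integral and so is finite almost everywhere. Pointwise summability of |d k|
  follows from the inequality of means, in place of an infinite triangle inequality in norm. Fatou
  then upgrades the almost everywhere limit to a limit in norm.\<close>

theorem riesz_fischer:
  fixes u :: "nat \<Rightarrow> 'a \<Rightarrow> 'b::euclidean_space"
  assumes u: "\<And>k. sq_integrable M (u k)"
    and cauchy: "\<And>e. e > 0 \<Longrightarrow> \<exists>N. \<forall>m\<ge>N. \<forall>n\<ge>N. l2 M (\<lambda>x. u m x - u n x) < e"
  obtains H where "sq_integrable M H" "(\<lambda>k. l2 M (\<lambda>x. u k x - H x)) \<longlonglongrightarrow> 0"
proof -
  have [measurable]: "u k \<in> borel_measurable M" for k
    using u by (rule sq_integrable_measurable)
  define r where "r k = (SOME N. \<forall>m\<ge>N. \<forall>n\<ge>N. l2 M (\<lambda>x. u m x - u n x) < (1/4) ^ k)" for k :: nat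
  have r: "l2 M (\<lambda>x. u m x - u n x) < (1/4) ^ k" if "m \<ge> r k" "n \<ge> r k" for m n k
    using someI_ex[OF cauchy[of "(1/4) ^ k"]] that unfolding r_def by auto
  \<comment> \<open>The maximum over all earlier thresholds puts both \<open>s k\<close> and
    \<open>s (Suc k)\<close> beyond \<open>r k\<close>; the summand k makes
    \<open>s k \<ge> k\<close>, so the subsequence runs to infinity.\<close>
  define s where "s k = k + Max (r ` {..k})" for k
  have s: "s k \<ge> r k" "s (Suc k) \<ge> r k" "s k \<ge> k" for k
  proof -
    have "r k \<le> Max (r ` {..k})" "r k \<le> Max (r ` {..Suc k})" by (auto intro: Max_ge)
    then show "s k \<ge> r k" "s (Suc k) \<ge> r k" "s k \<ge> k" unfolding s_def by linarith+
  qed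
  define d where "d k x = u (s (Suc k)) x - u (s k) x" for k x
  have [measurable]: "d k \<in> borel_measurable M" for k
    unfolding d_def[abs_def] by measurable
  have d: "l2 M (d k) \<le> (1/4) ^ k" for k
    using r[OF s(2) s(1), of k] by (simp add: d_def[abs_def])
  have ds: "sq_integrable M (d k)" for k
    unfolding d_def[abs_def] by (intro sq_integrable_diff u)
  have "(\<integral>\<^sup>+x. (\<Sum>k. ennreal (2 ^ k * (norm (d k x))\<^sup>2)) \<partial>M) = (\<Sum>k. \<integral>\<^sup>+x. ennreal (2 ^ k * (norm (d k x))\<^sup>2) \<partial>M)"
    by (rule nn_integral_suminf) measurable
  also have "\<dots> \<le> (\<Sum>k. ennreal ((1/2) ^ k))"
  proof (rule suminf_le)
    fix k
    have "(\<integral>\<^sup>+x. ennreal (2 ^ k * (norm (d k x))\<^sup>2) \<partial>M) = ennreal (2 ^ k * (l2 M (d k))\<^sup>2)"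
      by (simp add: ennreal_mult nn_integral_cmult nn_integral_l2[OF ds])
    also have "\<dots> \<le> ennreal (2 ^ k * ((1/4) ^ k)\<^sup>2)"
      by (intro ennreal_leI mult_left_mono power_mono d) auto
    also have "2 ^ k * ((1/4) ^ k)\<^sup>2 \<le> (1/2::real) ^ k"
    proof -
      have "2 ^ k * ((1/4) ^ k)\<^sup>2 = (1/8::real) ^ k"
        by (simp add: power2_eq_square power_mult_distrib[symmetric])
      also have "\<dots> \<le> (1/2) ^ k" by (intro power_mono) auto
      finally show ?thesis .
    qed
    finally show "(\<integral>\<^sup>+x. ennreal (2 ^ k * (norm (d k x))\<^sup>2) \<partial>M) \<le> ennreal ((1/2) ^ k)"
      by (simp add: ennreal_leI)
  qed auto
  also have "\<dots> = ennreal (\<Sum>k. (1/2) ^ k)"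
    by (rule suminf_ennreal2) auto
  finally have "(\<integral>\<^sup>+x. (\<Sum>k. ennreal (2 ^ k * (norm (d k x))\<^sup>2)) \<partial>M) \<noteq> \<infinity>"
    by (auto simp: top_unique)
  then have "AE x in M. (\<Sum>k. ennreal (2 ^ k * (norm (d k x))\<^sup>2)) \<noteq> \<infinity>"
    by (intro nn_integral_PInf_AE) auto
  then have conv: "AE x in M. convergent (\<lambda>k. u (s k) x)"
  proof eventually_elim
    case (elim x)
    then have "summable (\<lambda>k. 2 ^ k * (norm (d k x))\<^sup>2)"
      by (intro summable_suminf_not_top) auto
    then have "summable (\<lambda>k. (1/2) ^ k + 2 ^ k * (norm (d k x))\<^sup>2)"
      by (intro summable_add) auto
    then have "summable (\<lambda>k. norm (d k x))"
    proof (rule summable_comparison_test'[where N = 0])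
      fix k :: nat
      \<comment> \<open>Expand
        \<open>(1/2) ^ k * (2 ^ k * norm (d k x) - 1)\<^sup>2 \<ge> 0\<close>; with these weights
        both terms on the right are summable in k.\<close>
      have "2 * norm (d k x) \<le> (1/2) ^ k + 2 ^ k * (norm (d k x))\<^sup>2"
      proof -
        have "0 \<le> (1/2) ^ k * (2 ^ k * norm (d k x) - 1)\<^sup>2" by simp
        also have "\<dots> = (1/2) ^ k * (2 ^ k)\<^sup>2 * (norm (d k x))\<^sup>2 - 2 * ((1/2) ^ k * 2 ^ k) * norm (d k x) + (1/2) ^ k"
          by (simp add: power2_eq_square algebra_simps)
        also have "(1/2) ^ k * 2 ^ k = (1::real)" by (simp add: power_mult_distrib[symmetric])
        also have "(1/2) ^ k * (2 ^ k)\<^sup>2 = (2::real) ^ k" by (simp add: power2_eq_square power_one_over)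
        finally show ?thesis by simp
      qed
      then show "norm (norm (d k x)) \<le> (1/2) ^ k + 2 ^ k * (norm (d k x))\<^sup>2"
        using norm_ge_zero[of "d k x"] unfolding real_norm_def abs_norm_cancel by linarith
    qed
    then have "summable (\<lambda>k. d k x)" by (rule summable_norm_cancel)
    then have "convergent (\<lambda>n. \<Sum>k<n. d k x)"
      by (simp add: summable_iff_convergent)
    then have "convergent (\<lambda>n. u (s n) x - u (s 0) x)"
      by (simp add: d_def sum_lessThan_telescope[of "\<lambda>k. u (s k) x"])
    then show "convergent (\<lambda>k. u (s k) x)"
      using convergent_add_const_iff[of "- u (s 0) x" "\<lambda>n. u (s n) x"] by simp
  qed
  define H where "H x = lim (\<lambda>k. u (s k) x)" for x
  have [measurable]: "H \<in> borel_measurable M"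
    unfolding H_def[abs_def] by (rule borel_measurable_lim_metric) measurable
  have bound: "(\<integral>\<^sup>+x. ennreal ((norm (u m x - H x))\<^sup>2) \<partial>M) \<le> ennreal (e\<^sup>2)"
    if e: "e > 0" and N: "\<And>m n. m \<ge> N \<Longrightarrow> n \<ge> N \<Longrightarrow> l2 M (\<lambda>x. u m x - u n x) < e" and m: "m \<ge> N" for e N m
  proof -
    have "(\<integral>\<^sup>+x. ennreal ((norm (u m x - H x))\<^sup>2) \<partial>M) = (\<integral>\<^sup>+x. liminf (\<lambda>k. ennreal ((norm (u m x - u (s k) x))\<^sup>2)) \<partial>M)"
    proof (rule nn_integral_cong_AE)
      show "AE x in M. ennreal ((norm (u m x - H x))\<^sup>2) = liminf (\<lambda>k. ennreal ((norm (u m x - u (s k) x))\<^sup>2))"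
        using conv
      proof eventually_elim
        case (elim x)
        then have "(\<lambda>k. u (s k) x) \<longlonglongrightarrow> H x"
          unfolding H_def by (simp add: convergent_LIMSEQ_iff)
        then have "(\<lambda>k. ennreal ((norm (u m x - u (s k) x))\<^sup>2)) \<longlonglongrightarrow> ennreal ((norm (u m x - H x))\<^sup>2)"
          by (intro tendsto_ennrealI tendsto_intros)
        then show ?case by (rule lim_imp_Liminf[OF sequentially_bot, symmetric])
      qed
    qed
    also have "\<dots> \<le> liminf (\<lambda>k. \<integral>\<^sup>+x. ennreal ((norm (u m x - u (s k) x))\<^sup>2) \<partial>M)"
      by (rule nn_integral_liminf) measurable
    also have "\<dots> \<le> limsup (\<lambda>k. \<integral>\<^sup>+x. ennreal ((norm (u m x - u (s k) x))\<^sup>2) \<partial>M)"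
      by (rule Liminf_le_Limsup) simp
    also have "\<dots> \<le> ennreal (e\<^sup>2)"
    proof (rule Limsup_bounded)
      show "\<forall>\<^sub>F k in sequentially. (\<integral>\<^sup>+x. ennreal ((norm (u m x - u (s k) x))\<^sup>2) \<partial>M) \<le> ennreal (e\<^sup>2)"
        using eventually_ge_at_top[of N]
      proof eventually_elim
        case (elim k)
        then have "s k \<ge> N" using s(3)[of k] by simp
        from N[OF m this] show ?case
          by (subst nn_integral_l2) (auto intro!: sq_integrable_diff u ennreal_leI power_mono)
      qed
    qed
    finally show ?thesis .
  qed
  have close: "\<exists>N. \<forall>m\<ge>N. sq_integrable M (\<lambda>x. u m x - H x) \<and> l2 M (\<lambda>x. u m x - H x) \<le> e" if e: "e > 0" for e
  proof -
    obtain N where N: "\<And>m n. m \<ge> N \<Longrightarrow> n \<ge> N \<Longrightarrow> l2 M (\<lambda>x. u m x - u n x) < e"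
      using cauchy[OF e] by blast
    have "sq_integrable M (\<lambda>x. u m x - H x)" "l2 M (\<lambda>x. u m x - H x) \<le> e" if "m \<ge> N" for m
      using l2_le_nn_integral[OF bound[OF \<open>e > 0\<close> N that]] \<open>e > 0\<close> by auto
    then show ?thesis by blast
  qed
  show ?thesis
  proof (rule that)
    obtain m where "sq_integrable M (\<lambda>x. u m x - H x)" using close[of 1] by auto
    from sq_integrable_diff[OF u[of m] this] show "sq_integrable M H" by simp
    show "(\<lambda>k. l2 M (\<lambda>x. u k x - H x)) \<longlonglongrightarrow> 0"
    proof (rule LIMSEQ_I)
      fix e :: real assume "e > 0"
      then obtain N where "\<forall>m\<ge>N. l2 M (\<lambda>x. u m x - H x) \<le> e / 2" using close[of "e/2"] by auto
      then show "\<exists>N. \<forall>m\<ge>N. norm (l2 M (\<lambda>x. u m x - H x) - 0) < e"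
        using \<open>e > 0\<close> by (intro exI[of _ N]) fastforce
    qed
  qed
qed

text \<open>A relation, since the transform of an L^2 function is fixed only up to null sets. A
  single approximating sequence is required, which suits passing to limits, while
  \<open>is_fourier_L2\<close> demands convergence along all of them.\<close>

definition fourier_pair :: "('a::euclidean_space \<Rightarrow> complex) \<Rightarrow> ('a \<Rightarrow> complex) \<Rightarrow> bool" where
  "fourier_pair h H \<longleftrightarrow> sq_integrable lborel h \<and> sq_integrable lborel H \<and>
     (\<exists>u. (\<forall>k::nat. integrable lborel (u k) \<and> sq_integrable lborel (u k)) \<and>
        (\<lambda>k. l2 lborel (\<lambda>x. u k x - h x)) \<longlonglongrightarrow> 0 \<and>
        (\<lambda>k. l2 lborel (\<lambda>\<xi>. fourier_L1 (u k) \<xi> - H \<xi>)) \<longlonglongrightarrow> 0)"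

text \<open>Both inner products are continuous along the approximating sequence, where
  \<open>parseval_L1\<close> applies. In this form a function with a pointwise transform can be
  paired with a shearlet from L^2.\<close>

theorem parseval_pair:
  assumes f: "integrable lborel f" "sq_integrable lborel f" and "fourier_pair h H"
  shows "(\<integral>x. f x * cnj (h x) \<partial>lborel) = (\<integral>\<xi>. fourier_L1 f \<xi> * cnj (H \<xi>) \<partial>lborel)"
proof -
  obtain u where u: "\<And>k::nat. integrable lborel (u k)" "\<And>k. sq_integrable lborel (u k)"
    and l: "(\<lambda>k. l2 lborel (\<lambda>x. u k x - h x)) \<longlonglongrightarrow> 0"
      "(\<lambda>k. l2 lborel (\<lambda>\<xi>. fourier_L1 (u k) \<xi> - H \<xi>)) \<longlonglongrightarrow> 0"
    and hH: "sq_integrable lborel h" "sq_integrable lborel H"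
    using assms(3) by (auto simp: fourier_pair_def)
  have "(\<lambda>k. \<integral>x. f x * cnj (u k x) \<partial>lborel) \<longlonglongrightarrow> (\<integral>x. f x * cnj (h x) \<partial>lborel)"
    by (intro l2_inner_tendsto u hH f l)
  moreover have "(\<lambda>k. \<integral>\<xi>. fourier_L1 f \<xi> * cnj (fourier_L1 (u k) \<xi>) \<partial>lborel) \<longlonglongrightarrow> (\<integral>\<xi>. fourier_L1 f \<xi> * cnj (H \<xi>) \<partial>lborel)"
    by (intro l2_inner_tendsto u hH f l plancherel_L1)
  ultimately show ?thesis
    using parseval_L1[OF f u] by (simp add: LIMSEQ_unique)
qed

text \<open>Cauchy-Schwarz against the indicator of a ball makes a truncation integrable, so these
  are concrete approximations from L^1 and L^2.\<close>

lemma sq_integrable_truncation: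
  fixes h :: "'a::euclidean_space \<Rightarrow> complex"
  assumes h: "sq_integrable lborel h"
  defines "u \<equiv> \<lambda>k::nat. \<lambda>x. indicator (cball 0 (real k)) x *\<^sub>R h x"
  shows "integrable lborel (u k)" "sq_integrable lborel (u k)" "(\<lambda>k. l2 lborel (\<lambda>x. u k x - h x)) \<longlonglongrightarrow> 0"
proof -
  have [measurable]: "h \<in> borel_measurable borel"
    using sq_integrable_measurable[OF h] by simp
  have ind: "sq_integrable lborel (\<lambda>x::'a. 1 * indicator (cball 0 (real k)) x :: real)"
    by (rule sq_integrable_indicator_bounded) auto
  have [measurable]: "cball 0 r \<in> sets (borel :: 'a measure)" for r
    by auto
  have [measurable]: "u k \<in> borel_measurable borel" for k
    unfolding u_def by measurable
  show "integrable lborel (u k)"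
  proof (rule Bochner_Integration.integrable_bound[OF l2_Cauchy_Schwarz(1)[OF ind h]])
    show "u k \<in> borel_measurable lborel" by simp
  qed (auto simp: u_def)
  show "sq_integrable lborel (u k)"
  proof (rule sq_integrable_bound[OF h, of _ 1])
    show "u k \<in> borel_measurable lborel" by simp
  qed (auto simp: u_def indicator_def)
  show "(\<lambda>k. l2 lborel (\<lambda>x. u k x - h x)) \<longlonglongrightarrow> 0"
  proof (rule l2_dominated_convergence[OF _ _ h])
    show "u k \<in> borel_measurable lborel" "h \<in> borel_measurable lborel" for k by simp_all
    show "AE x in lborel. (\<lambda>k. u k x) \<longlonglongrightarrow> h x"
    proof (intro AE_I2 tendsto_eventually)
      fix x :: 'a
      obtain m :: nat where m: "norm x \<le> real m" using real_arch_simple by blast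
      show "\<forall>\<^sub>F k in sequentially. u k x = h x"
        using eventually_ge_at_top[of m]
      proof eventually_elim
        case (elim k)
        then have "real m \<le> real k" by simp
        then have "norm x \<le> real k" using m by linarith
        then show ?case by (simp add: u_def)
      qed
    qed
  qed (auto simp: u_def indicator_def)
qed

text \<open>Plancherel carries the Cauchy property from the truncations of \<open>h\<close> to their
  transforms, and completeness supplies the limit.\<close>

lemma fourier_pair_exists:
  fixes h :: "'a::euclidean_space \<Rightarrow> complex"
  assumes h: "sq_integrable lborel h"
  obtains H where "fourier_pair h H"
proof -
  obtain u where u: "\<And>k::nat. integrable lborel (u k)" "\<And>k. sq_integrable lborel (u k)"
    "(\<lambda>k. l2 lborel (\<lambda>x. u k x - h x)) \<longlonglongrightarrow> 0"
    by (rule that[OF sq_integrable_truncation[OF h]])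
  have iso: "l2 lborel (\<lambda>\<xi>. fourier_L1 (u m) \<xi> - fourier_L1 (u n) \<xi>) = l2 lborel (\<lambda>x. u m x - u n x)" for m n
    using plancherel_L1(2)[of "\<lambda>x. u m x - u n x"] u by (simp add: fourier_L1_diff sq_integrable_diff)
  obtain H where "sq_integrable lborel H" "(\<lambda>k. l2 lborel (\<lambda>x. fourier_L1 (u k) x - H x)) \<longlonglongrightarrow> 0"
  proof (rule riesz_fischer)
    show "sq_integrable lborel (fourier_L1 (u k))" for k
      by (intro plancherel_L1 u)
    fix e :: real assume "e > 0"
    then obtain N where N: "\<And>k. k \<ge> N \<Longrightarrow> l2 lborel (\<lambda>x. u k x - h x) < e / 2"
      using LIMSEQ_D[OF u(3), of "e/2"] by auto
    have "l2 lborel (\<lambda>x. u m x - u n x) < e" if "m \<ge> N" "n \<ge> N" for m n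
      using l2_triangle_diff[OF sq_integrable_diff[OF u(2) h] sq_integrable_diff[OF u(2) h], of m n]
        N[OF that(1)] N[OF that(2)] by simp
    then show "\<exists>N. \<forall>m\<ge>N. \<forall>n\<ge>N. l2 lborel (\<lambda>\<xi>. fourier_L1 (u m) \<xi> - fourier_L1 (u n) \<xi>) < e"
      unfolding iso by blast
  qed auto
  then show ?thesis
    using that[of H] u h by (auto simp: fourier_pair_def)
qed

text \<open>By Plancherel, two sequences with the same limit have transforms at vanishing distance,
  so the sequence in \<open>fourier_pair\<close> can be exchanged for any other. This yields the
  quantifier over all sequences in \<open>is_fourier_L2\<close>.\<close>

lemma fourier_pair_tendsto:
  assumes "fourier_pair h H" and v: "\<And>k::nat. integrable lborel (v k)" "\<And>k. sq_integrable lborel (v k)"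
    and "(\<lambda>k. l2 lborel (\<lambda>x. v k x - h x)) \<longlonglongrightarrow> 0"
  shows "(\<lambda>k. l2 lborel (\<lambda>\<xi>. fourier_L1 (v k) \<xi> - H \<xi>)) \<longlonglongrightarrow> 0"
proof -
  obtain u where u: "\<And>k::nat. integrable lborel (u k)" "\<And>k. sq_integrable lborel (u k)"
    and l: "(\<lambda>k. l2 lborel (\<lambda>x. u k x - h x)) \<longlonglongrightarrow> 0"
      "(\<lambda>k. l2 lborel (\<lambda>\<xi>. fourier_L1 (u k) \<xi> - H \<xi>)) \<longlonglongrightarrow> 0"
    and hH: "sq_integrable lborel h" "sq_integrable lborel H"
    using assms(1) by (auto simp: fourier_pair_def)
  have le: "l2 lborel (\<lambda>\<xi>. fourier_L1 (v k) \<xi> - H \<xi>)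
      \<le> (l2 lborel (\<lambda>x. v k x - h x) + l2 lborel (\<lambda>x. u k x - h x)) + l2 lborel (\<lambda>\<xi>. fourier_L1 (u k) \<xi> - H \<xi>)" for k
  proof -
    have "l2 lborel (\<lambda>\<xi>. fourier_L1 (v k) \<xi> - fourier_L1 (u k) \<xi>) = l2 lborel (\<lambda>x. v k x - u k x)"
      using plancherel_L1(2)[of "\<lambda>x. v k x - u k x"] u v by (simp add: fourier_L1_diff sq_integrable_diff)
    also have "\<dots> \<le> l2 lborel (\<lambda>x. v k x - h x) + l2 lborel (\<lambda>x. u k x - h x)"
      using l2_triangle_diff[OF sq_integrable_diff[OF v(2)[of k] hH(1)] sq_integrable_diff[OF u(2)[of k] hH(1)]] by simp
    finally have "l2 lborel (\<lambda>\<xi>. fourier_L1 (v k) \<xi> - fourier_L1 (u k) \<xi>) \<le> \<dots>" .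
    moreover have "l2 lborel (\<lambda>\<xi>. fourier_L1 (v k) \<xi> - H \<xi>)
       \<le> l2 lborel (\<lambda>\<xi>. fourier_L1 (v k) \<xi> - fourier_L1 (u k) \<xi>) + l2 lborel (\<lambda>\<xi>. fourier_L1 (u k) \<xi> - H \<xi>)"
      using l2_triangle[of lborel "\<lambda>\<xi>. fourier_L1 (v k) \<xi> - fourier_L1 (u k) \<xi>" "\<lambda>\<xi>. fourier_L1 (u k) \<xi> - H \<xi>"]
      by (simp add: sq_integrable_diff plancherel_L1 u v hH)
    ultimately show ?thesis by simp
  qed
  have "(\<lambda>k. (l2 lborel (\<lambda>x. v k x - h x) + l2 lborel (\<lambda>x. u k x - h x)) + l2 lborel (\<lambda>\<xi>. fourier_L1 (u k) \<xi> - H \<xi>)) \<longlonglongrightarrow> (0 + 0) + 0"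
    by (intro tendsto_intros assms(4) l)
  then have lim: "(\<lambda>k. (l2 lborel (\<lambda>x. v k x - h x) + l2 lborel (\<lambda>x. u k x - h x)) + l2 lborel (\<lambda>\<xi>. fourier_L1 (u k) \<xi> - H \<xi>)) \<longlonglongrightarrow> 0"
    by (simp only: add_0_right)
  have "norm (l2 lborel (\<lambda>\<xi>. fourier_L1 (v k) \<xi> - H \<xi>))
      \<le> (l2 lborel (\<lambda>x. v k x - h x) + l2 lborel (\<lambda>x. u k x - h x)) + l2 lborel (\<lambda>\<xi>. fourier_L1 (u k) \<xi> - H \<xi>)" for k
    unfolding real_norm_def abs_of_nonneg[OF l2_nonneg] by (rule le)
  then show ?thesis
    by (rule Lim_null_comparison[OF always_eventually[OF allI] lim])
qed

section \<open>Borel representatives of Lebesgue measurable functions\<close>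

text \<open>Real functions measurable for a completion have such representatives, so real and
  imaginary parts are treated separately. Working with representatives on \<open>lborel\<close>
  makes the product structure and joint measurability available.\<close>

lemma lebesgue_borel_representative:
  fixes f :: "'a::euclidean_space \<Rightarrow> complex"
  assumes f: "f \<in> borel_measurable lebesgue"
  obtains f' where "f' \<in> borel_measurable borel" "AE x in lborel. f x = f' x"
proof -
  have "(\<lambda>x. Re (f x)) \<in> borel_measurable (completion lborel)" "(\<lambda>x. Im (f x)) \<in> borel_measurable (completion lborel)"
    using f by auto
  from this[THEN completion_ex_borel_measurable_real]
  obtain a b where [measurable]: "a \<in> borel_measurable lborel" "b \<in> borel_measurable lborel"
    and ab: "AE x in lborel. Re (f x) = a x" "AE x in lborel. Im (f x) = b x" by auto
  show ?thesis
  proof (rule that[of "\<lambda>x. Complex (a x) (b x)"])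
    have "(\<lambda>x. complex_of_real (a x) + \<i> * complex_of_real (b x)) \<in> borel_measurable lborel"
      by measurable
    then show "(\<lambda>x. Complex (a x) (b x)) \<in> borel_measurable borel"
      by (simp add: Complex_eq)
    show "AE x in lborel. f x = Complex (a x) (b x)"
      using ab by eventually_elim (simp add: complex_eq_iff)
  qed
qed

lemma lebesgue_measurable_of_borel: "f \<in> borel_measurable borel \<Longrightarrow> f \<in> borel_measurable lebesgue"
  by (intro measurable_completion) simp

lemma lebesgue_integral_representative:
  fixes f f' :: "'a::euclidean_space \<Rightarrow> 'b::{banach,second_countable_topology}"
  assumes "f \<in> borel_measurable lebesgue" "f' \<in> borel_measurable borel" "AE x in lborel. f x = f' x"
  shows "integrable lebesgue f \<longleftrightarrow> integrable lborel f'" "(\<integral>x. f x \<partial>lebesgue) = (\<integral>x. f' x \<partial>lborel)"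
proof -
  have AE: "AE x in lebesgue. f x = f' x" using assms(3) by (simp add: AE_completion)
  note m = lebesgue_measurable_of_borel[OF assms(2)]
  show "integrable lebesgue f \<longleftrightarrow> integrable lborel f'"
    using integrable_cong_AE[OF assms(1) m AE] integrable_completion[of f' lborel] assms(2) by simp
  show "(\<integral>x. f x \<partial>lebesgue) = (\<integral>x. f' x \<partial>lborel)"
    using integral_cong_AE[OF assms(1) m AE] integral_completion[of f' lborel] assms(2) by simp
qed

lemma L2_norm_eq_l2: "L2_norm f = l2 lebesgue f"
  by (simp add: L2_norm_def l2_def)

lemma Lp2_iff: "f \<in> Lp 2 \<longleftrightarrow> sq_integrable lebesgue f"
  by (simp add: Lp_def sq_integrable_def)

lemma Lp1_iff: "f \<in> Lp 1 \<longleftrightarrow> integrable lebesgue f"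
  by (auto simp: Lp_def integrable_norm_iff dest: borel_measurable_integrable)

lemma l2_representative:
  fixes f f' :: "'a::euclidean_space \<Rightarrow> 'b::euclidean_space"
  assumes "f \<in> borel_measurable lebesgue" "f' \<in> borel_measurable borel" "AE x in lborel. f x = f' x"
  shows "sq_integrable lebesgue f \<longleftrightarrow> sq_integrable lborel f'" "l2 lebesgue f = l2 lborel f'"
proof -
  have *: "(\<lambda>x. (norm (f x))\<^sup>2) \<in> borel_measurable lebesgue" "(\<lambda>x. (norm (f' x))\<^sup>2) \<in> borel_measurable borel"
    "AE x in lborel. (norm (f x))\<^sup>2 = (norm (f' x))\<^sup>2"
    by (rule borel_measurable_power[OF measurable_compose[OF assms(1) borel_measurable_norm]],
        rule borel_measurable_power[OF measurable_compose[OF assms(2) borel_measurable_norm]],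
        rule eventually_mono[OF assms(3)], simp)
  show "sq_integrable lebesgue f \<longleftrightarrow> sq_integrable lborel f'" "l2 lebesgue f = l2 lborel f'"
    using lebesgue_integral_representative[OF *] assms(1,2) by (simp_all add: sq_integrable_def l2_def)
qed

lemma fourier_L1_representative:
  assumes "f \<in> borel_measurable lebesgue" "f' \<in> borel_measurable borel" "AE x in lborel. f x = f' x"
  shows "fourier_L1 f = fourier_L1 f'"
  by (rule fourier_L1_cong[OF AE_completion[OF assms(3)] assms(1) lebesgue_measurable_of_borel[OF assms(2)]])

text \<open>This gives \<open>fourier_L2\<close> its meaning: without a witness the choice operator
  would return an unspecified function.\<close>

lemma is_fourier_L2_exists:
  fixes f :: "'a::euclidean_space \<Rightarrow> complex"
  assumes f: "f \<in> Lp 2"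
  shows "\<exists>g. is_fourier_L2 f g"
proof -
  have fm: "f \<in> borel_measurable lebesgue" using f by (simp add: Lp_def)
  obtain f' where f': "f' \<in> borel_measurable borel" "AE x in lborel. f x = f' x"
    by (rule lebesgue_borel_representative[OF fm])
  have sf': "sq_integrable lborel f'"
    using l2_representative(1)[OF fm f'] f by (simp add: Lp2_iff)
  obtain H where H: "fourier_pair f' H" by (rule fourier_pair_exists[OF sf'])
  have Hs: "sq_integrable lborel H" using H by (simp add: fourier_pair_def)
  have Hm: "H \<in> borel_measurable borel" using sq_integrable_measurable[OF Hs] by simp
  have "is_fourier_L2 f H"
    unfolding is_fourier_L2_def
  proof (intro conjI allI impI)
    show "H \<in> Lp 2"
      unfolding Lp2_iff using l2_representative(1)[OF lebesgue_measurable_of_borel[OF Hm] Hm] Hs by simp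
    fix u :: "nat \<Rightarrow> 'a \<Rightarrow> complex"
    assume u: "\<forall>k. u k \<in> Lp 1 \<inter> Lp 2" and lim: "(\<lambda>k. L2_norm (\<lambda>x. u k x - f x)) \<longlonglongrightarrow> 0"
    have um: "u k \<in> borel_measurable lebesgue" for k using u by (auto simp: Lp_def)
    have "\<forall>k. \<exists>u'. u' \<in> borel_measurable borel \<and> (AE x in lborel. u k x = u' x)"
      using lebesgue_borel_representative[OF um] by metis
    then obtain v where v: "\<And>k. v k \<in> borel_measurable borel" "\<And>k. AE x in lborel. u k x = v k x"
      by metis
    have vi: "integrable lborel (v k)" "sq_integrable lborel (v k)" for k
      using u lebesgue_integral_representative(1)[OF um v, of k] l2_representative(1)[OF um v, of k]
      by (auto simp: Lp1_iff Lp2_iff)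
    have "L2_norm (\<lambda>x. u k x - f x) = l2 lborel (\<lambda>x. v k x - f' x)" for k
      unfolding L2_norm_eq_l2
    proof (rule l2_representative)
      show "(\<lambda>x. u k x - f x) \<in> borel_measurable lebesgue" using um fm by measurable
      show "(\<lambda>x. v k x - f' x) \<in> borel_measurable borel" using v f' by measurable
      show "AE x in lborel. u k x - f x = v k x - f' x"
        using v(2)[of k] f'(2) by eventually_elim simp
    qed
    then have "(\<lambda>k. l2 lborel (\<lambda>\<xi>. fourier_L1 (v k) \<xi> - H \<xi>)) \<longlonglongrightarrow> 0"
      using fourier_pair_tendsto[OF H vi] lim by simp
    moreover have "l2 lborel (\<lambda>\<xi>. fourier_L1 (v k) \<xi> - H \<xi>) = L2_norm (\<lambda>\<xi>. fourier_L1 (u k) \<xi> - H \<xi>)" for k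
      unfolding L2_norm_eq_l2 fourier_L1_representative[OF um v]
      using v(1) Hm by (intro l2_representative(2)[symmetric] lebesgue_measurable_of_borel) auto
    ultimately show "(\<lambda>k. L2_norm (\<lambda>\<xi>. fourier_L1 (u k) \<xi> - H \<xi>)) \<longlonglongrightarrow> 0"
      by simp
  qed (rule f)
  then show ?thesis by blast
qed

text \<open>Specialising the quantifier over all sequences to truncations of \<open>f'\<close>
  provides the single sequence that \<open>fourier_pair\<close> asks for.\<close>

lemma is_fourier_L2_pair:
  fixes f :: "'a::euclidean_space \<Rightarrow> complex"
  assumes "is_fourier_L2 f g"
    and f': "f' \<in> borel_measurable borel" "AE x in lborel. f x = f' x"
    and g': "g' \<in> borel_measurable borel" "AE x in lborel. g x = g' x"
  shows "fourier_pair f' g'"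
proof -
  have f: "f \<in> Lp 2" and g: "g \<in> Lp 2" using assms(1) by (auto simp: is_fourier_L2_def)
  have fm: "f \<in> borel_measurable lebesgue" and gm: "g \<in> borel_measurable lebesgue"
    using f g by (auto simp: Lp_def)
  have s: "sq_integrable lborel f'" "sq_integrable lborel g'"
    using l2_representative(1)[OF fm f'] l2_representative(1)[OF gm g'] f g by (auto simp: Lp2_iff)
  obtain u where u: "\<And>k::nat. integrable lborel (u k)" "\<And>k. sq_integrable lborel (u k)"
    "(\<lambda>k. l2 lborel (\<lambda>x. u k x - f' x)) \<longlonglongrightarrow> 0"
    by (rule that[OF sq_integrable_truncation[OF s(1)]])
  have ub: "u k \<in> borel_measurable borel" for k
    using sq_integrable_measurable[OF u(2)[of k]] by simp
  note um = lebesgue_measurable_of_borel[OF ub]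
  have uL: "u k \<in> Lp 1 \<inter> Lp 2" for k
    unfolding Int_iff Lp1_iff Lp2_iff
    using u lebesgue_integral_representative(1)[OF um[of k] ub[of k] AE_I2[OF refl]]
      l2_representative(1)[OF um[of k] ub[of k] AE_I2[OF refl]] by simp
  have "L2_norm (\<lambda>x. u k x - f x) = l2 lborel (\<lambda>x. u k x - f' x)" for k
    unfolding L2_norm_eq_l2
  proof (rule l2_representative)
    show "(\<lambda>x. u k x - f x) \<in> borel_measurable lebesgue" using um fm by measurable
    show "(\<lambda>x. u k x - f' x) \<in> borel_measurable borel" using ub f' by measurable
    show "AE x in lborel. u k x - f x = u k x - f' x"
      using f'(2) by eventually_elim simp
  qed
  then have "(\<lambda>k. L2_norm (\<lambda>\<xi>. fourier_L1 (u k) \<xi> - g \<xi>)) \<longlonglongrightarrow> 0"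
    using assms(1) uL u(3) unfolding is_fourier_L2_def by simp
  moreover have "L2_norm (\<lambda>\<xi>. fourier_L1 (u k) \<xi> - g \<xi>) = l2 lborel (\<lambda>\<xi>. fourier_L1 (u k) \<xi> - g' \<xi>)" for k
    unfolding L2_norm_eq_l2
  proof (rule l2_representative)
    have [measurable]: "fourier_L1 (u k) \<in> borel_measurable borel" using ub by measurable
    then have [measurable]: "fourier_L1 (u k) \<in> borel_measurable lebesgue" by (rule lebesgue_measurable_of_borel)
    show "(\<lambda>x. fourier_L1 (u k) x - g x) \<in> borel_measurable lebesgue" using gm by measurable
    show "(\<lambda>x. fourier_L1 (u k) x - g' x) \<in> borel_measurable borel" using g' by measurable
    show "AE x in lborel. fourier_L1 (u k) x - g x = fourier_L1 (u k) x - g' x"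
      using g'(2) by eventually_elim simp
  qed
  ultimately show ?thesis
    unfolding fourier_pair_def using s u by auto
qed

subsection \<open>Shearlet matrices\<close>

text \<open>In these coordinates the shear and dilation matrices act by explicit two-component
  formulas, so integrals can be substituted one component at a time.\<close>

definition vcons :: "real \<Rightarrow> real ^ 'm \<Rightarrow> real ^ ('m::finite option)" where
  "vcons u v = (\<chi> i. case i of None \<Rightarrow> u | Some k \<Rightarrow> v $ k)"

definition vtail :: "real ^ ('m::finite option) \<Rightarrow> real ^ 'm" where
  "vtail x = (\<chi> k. x $ Some k)"

lemma vcons_nth [simp]: "vcons u v $ None = u" "vcons u v $ Some k = v $ k"
  by (simp_all add: vcons_def)

lemma vcons_vtail [simp]: "vcons (x $ None) (vtail x) = x"
  by (simp add: vcons_def vtail_def vec_eq_iff split: option.splits)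

lemma sum_option: "(\<Sum>i\<in>(UNIV :: 'm::finite option set). f i) = f None + (\<Sum>k\<in>UNIV. f (Some k))"
proof -
  have "(\<Sum>i\<in>UNIV. f i) = f None + (\<Sum>i\<in>range Some. f i)"
    unfolding UNIV_option_conv by (subst sum.insert) auto
  then show ?thesis by (simp add: sum.reindex)
qed

lemma prod_option: "(\<Prod>i\<in>(UNIV :: 'm::finite option set). f i) = f None * (\<Prod>k\<in>UNIV. f (Some k))"
proof -
  have "(\<Prod>i\<in>UNIV. f i) = f None * (\<Prod>i\<in>range Some. f i)"
    unfolding UNIV_option_conv by (subst prod.insert) auto
  then show ?thesis by (simp add: prod.reindex)
qed

lemma prod_Basis_vec: "(\<Prod>b\<in>(Basis :: (real ^ 'k::finite) set). f b) = (\<Prod>i\<in>UNIV. f (axis i 1))"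
proof -
  have eq: "(Basis :: (real ^ 'k) set) = (\<lambda>i. axis i 1) ` UNIV"
    by (auto simp: Basis_vec_def)
  have "inj (\<lambda>i::'k. axis i (1::real))"
    by (auto simp: inj_on_def axis_eq_axis)
  from prod.reindex[OF this, of f] show ?thesis unfolding eq o_def .
qed

lemma continuous_on_vcons: "continuous_on UNIV (\<lambda>p. vcons (fst p) (snd p))"
  unfolding vcons_def
proof (rule continuous_on_vec_lambda)
  show "continuous_on UNIV (\<lambda>x. case i of None \<Rightarrow> fst x | Some k \<Rightarrow> snd x $ k)" for i :: "'a option"
    by (cases i) (auto intro!: continuous_intros)
qed

lemma vcons_measurable [measurable (raw)]:
  assumes "f \<in> borel_measurable M" "g \<in> borel_measurable M"
  shows "(\<lambda>x. vcons (f x) (g x)) \<in> borel_measurable M"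
  using borel_measurable_continuous_Pair[OF assms continuous_on_vcons] by simp

lemma vec_nth_measurable [measurable (raw)]:
  fixes f :: "'a \<Rightarrow> real ^ 'k::finite"
  assumes "f \<in> borel_measurable M"
  shows "(\<lambda>x. f x $ i) \<in> borel_measurable M"
proof -
  have "(\<lambda>x::real ^ 'k. x $ i) \<in> borel_measurable borel"
    by (intro borel_measurable_continuous_onI continuous_intros)
  from measurable_compose[OF assms this] show ?thesis .
qed

lemma vtail_measurable [measurable (raw)]:
  assumes "f \<in> borel_measurable M"
  shows "(\<lambda>x. vtail (f x)) \<in> borel_measurable M"
proof -
  have "vtail \<in> borel_measurable borel"
    unfolding vtail_def[abs_def]
    by (intro borel_measurable_continuous_onI continuous_on_vec_lambda continuous_intros)
  from measurable_compose[OF assms this] show ?thesis .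
qed

text \<open>Lebesgue measure is characterised by its values on boxes, and the preimage of a box
  under \<open>vcons\<close> is a product of two boxes.\<close>

lemma lborel_vcons: "lborel = distr lborel borel (\<lambda>p. vcons (fst p) (snd p :: real ^ 'm::finite))"
proof (rule lborel_eqI)
  fix l u :: "real ^ 'm option"
  assume "\<And>b. b \<in> Basis \<Longrightarrow> l \<bullet> b \<le> u \<bullet> b"
  then have le: "l $ i \<le> u $ i" for i
  proof -
    have "axis i 1 \<in> (Basis :: (real ^ 'm option) set)" by (auto simp: Basis_vec_def)
    from \<open>\<And>b. b \<in> Basis \<Longrightarrow> l \<bullet> b \<le> u \<bullet> b\<close>[OF this] show ?thesis
      by (simp add: inner_axis)
  qed
  have "(\<lambda>p. vcons (fst p) (snd p)) -` box l u = box (l $ None) (u $ None) \<times> box (vtail l) (vtail u)"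
    by (auto simp: mem_box_cart vtail_def split: option.splits) (metis option.exhaust vcons_nth)+
  then have "emeasure (distr lborel borel (\<lambda>p. vcons (fst p) (snd p))) (box l u)
      = emeasure (lborel \<Otimes>\<^sub>M lborel) (box (l $ None) (u $ None) \<times> box (vtail l) (vtail u))"
    by (subst emeasure_distr) (auto simp: lborel_prod)
  also have "\<dots> = emeasure lborel (box (l $ None) (u $ None)) * emeasure lborel (box (vtail l) (vtail u))"
    by (rule lborel.emeasure_pair_measure_Times) auto
  also have "emeasure lborel (box (l $ None) (u $ None)) = ennreal (u $ None - l $ None)"
    using le by (subst emeasure_lborel_box) auto
  also have "emeasure lborel (box (vtail l) (vtail u)) = ennreal (\<Prod>k\<in>UNIV. u $ Some k - l $ Some k)"
  proof -
    have "(\<Prod>b\<in>Basis. (vtail u - vtail l) \<bullet> b) = (\<Prod>k\<in>UNIV. u $ Some k - l $ Some k)"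
      by (simp add: prod_Basis_vec inner_axis vtail_def)
    moreover have "vtail l \<bullet> b \<le> vtail u \<bullet> b" if "b \<in> Basis" for b
      using that le by (auto simp: Basis_vec_def inner_axis vtail_def)
    ultimately show ?thesis by (subst emeasure_lborel_box) auto
  qed
  also have "ennreal (u $ None - l $ None) * ennreal (\<Prod>k\<in>UNIV. u $ Some k - l $ Some k)
     = ennreal (\<Prod>b\<in>Basis. (u - l) \<bullet> b)"
    using le by (simp add: prod_Basis_vec prod_option inner_axis ennreal_mult[symmetric] prod_nonneg)
  finally show "emeasure (distr lborel borel (\<lambda>p. vcons (fst p) (snd p))) (box l u) = ennreal (\<Prod>b\<in>Basis. (u - l) \<bullet> b)" .
qed simp

lemma nn_integral_vcons:
  assumes [measurable]: "H \<in> borel_measurable borel"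
  shows "(\<integral>\<^sup>+x. H x \<partial>lborel) = (\<integral>\<^sup>+u. \<integral>\<^sup>+v. H (vcons u v) \<partial>lborel \<partial>lborel)"
    and "(\<integral>\<^sup>+x. H x \<partial>lborel) = (\<integral>\<^sup>+v. \<integral>\<^sup>+u. H (vcons u v) \<partial>lborel \<partial>lborel)"
proof -
  have eq: "(\<integral>\<^sup>+x. H x \<partial>lborel) = (\<integral>\<^sup>+p. H (vcons (fst p) (snd p)) \<partial>lborel)"
    by (subst lborel_vcons, subst nn_integral_distr) auto
  show "(\<integral>\<^sup>+x. H x \<partial>lborel) = (\<integral>\<^sup>+u. \<integral>\<^sup>+v. H (vcons u v) \<partial>lborel \<partial>lborel)"
    unfolding eq by (subst nn_integral_lborel_pair(1)) auto
  show "(\<integral>\<^sup>+x. H x \<partial>lborel) = (\<integral>\<^sup>+v. \<integral>\<^sup>+u. H (vcons u v) \<partial>lborel \<partial>lborel)"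
    unfolding eq by (subst nn_integral_lborel_pair(2)) auto
qed

section \<open>Change of variables under shearlet matrices\<close>

text \<open>The scalar by which the dilation acts on the last n - 1 coordinates. The type argument
  carries n, which the real argument does not determine.\<close>

definition dil :: "'m::finite itself \<Rightarrow> real \<Rightarrow> real" where
  "dil _ a = sgn a * \<bar>a\<bar> powr (1 / real CARD('m option))"

lemma dil_nonzero [simp]: "dil TYPE('m::finite) a = 0 \<longleftrightarrow> a = 0"
  by (simp add: dil_def sgn_if)

lemma dil_measurable [measurable]: "dil TYPE('m::finite) \<in> borel_measurable borel"
  unfolding dil_def[abs_def] by measurable

lemma abs_dil: "\<bar>dil TYPE('m::finite) a\<bar> = \<bar>a\<bar> powr (1 / real CARD('m option))"
  by (simp add: dil_def abs_mult abs_sgn_eq)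

lemma if_not_swap: "(if \<not> P then x else y) = (if P then y else x)"
  by simp

lemma dilation_matrix_mult: "dilation_matrix a *v vcons u v = vcons (a * u) (dil TYPE('m::finite) a *\<^sub>R (v :: real ^ 'm))"
proof -
  have "(dilation_matrix a *v vcons u v) $ i = vcons (a * u) (dil TYPE('m) a *\<^sub>R v) $ i" for i
    by (cases i) (simp_all add: matrix_vector_mult_def sum_option dilation_matrix_def dil_def if_not_swap if_distrib[of "\<lambda>x. x * _"] sum.delta cong: if_cong)
  then show ?thesis by (simp add: vec_eq_iff)
qed

lemma shear_matrix_mult: "shear_matrix s *v vcons u v = vcons (u + s \<bullet> v) (v :: real ^ 'm::finite)"
proof -
  have "(shear_matrix s *v vcons u v) $ i = vcons (u + s \<bullet> v) v $ i" for i
    by (cases i) (simp_all add: matrix_vector_mult_def sum_option shear_matrix_def inner_vec_def if_distrib[of "\<lambda>x. x * _"] sum.delta cong: if_cong)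
  then show ?thesis by (simp add: vec_eq_iff)
qed

lemma transpose_shear_matrix_mult: "transpose (shear_matrix s) *v vcons u v = vcons u (u *\<^sub>R s + (v :: real ^ 'm::finite))"
proof -
  have "(transpose (shear_matrix s) *v vcons u v) $ i = vcons u (u *\<^sub>R s + v) $ i" for i
    by (cases i) (simp_all add: matrix_vector_mult_def transpose_def sum_option shear_matrix_def if_distrib[of "\<lambda>x. x * _"] sum.delta' sum.delta mult.commute[of u] cong: if_cong)
  then show ?thesis by (simp add: vec_eq_iff)
qed

lemma shearlet_matrix_mult:
  "shearlet_matrix s a *v vcons u v = vcons (a * u + dil TYPE('m::finite) a * (s \<bullet> v)) (dil TYPE('m) a *\<^sub>R (v :: real ^ 'm))"
  by (simp add: shearlet_matrix_def matrix_vector_mul_assoc[symmetric] dilation_matrix_mult shear_matrix_mult)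

lemma transpose_shearlet_matrix_mult:
  "transpose (shearlet_matrix s a) *v vcons u v = vcons (a * u) (dil TYPE('m::finite) a *\<^sub>R (u *\<^sub>R s + (v :: real ^ 'm)))"
proof -
  have "transpose (dilation_matrix a :: real ^ 'm option ^ 'm option) = dilation_matrix a"
    by (auto simp: transpose_def dilation_matrix_def vec_eq_iff)
  then show ?thesis
    by (simp add: shearlet_matrix_def matrix_transpose_mul matrix_vector_mul_assoc[symmetric] dilation_matrix_mult transpose_shear_matrix_mult del: transpose_matrix_vector)
qed

text \<open>The shear arises from the identity matrix by adding \<open>vcons 0 s\<close> to the
  first row, and that vector is a combination of the other rows.\<close>

lemma det_shear_matrix: "det (shear_matrix s :: real ^ 'm::finite option ^ 'm option) = 1"
proof -
  let ?I = "mat 1 :: real ^ 'm option ^ 'm option"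
  let ?x = "vcons 0 s"
  have rows: "row (Some k) ?I = axis (Some k) 1" for k
    by (auto simp: row_def mat_def axis_def vec_eq_iff)
  have "?x = (\<Sum>k\<in>UNIV. s $ k *\<^sub>R axis (Some k) 1)"
    by (auto simp: vec_eq_iff vcons_def axis_def if_distrib[of "\<lambda>x. _ * x"] split: option.splits cong: if_cong)
  also have "\<dots> \<in> span {row j ?I |j. j \<noteq> None}"
    by (intro span_sum span_mul span_base) (use rows in \<open>auto intro!: exI[of _ "Some _"]\<close>)
  finally have "?x \<in> vec.span {row j ?I |j. j \<noteq> None}"
    by (simp add: span_vec_eq)
  then have "det (\<chi> k. if k = None then row None ?I + ?x else row k ?I) = det ?I"
    by (rule det_row_span)
  moreover have "shear_matrix s = (\<chi> k. if k = None then row None ?I + ?x else row k ?I)"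
    by (auto simp: shear_matrix_def row_def mat_def vec_eq_iff vcons_def split: option.splits)
  ultimately show ?thesis by simp
qed

lemma abs_det_shearlet_matrix:
  "\<bar>det (shearlet_matrix s a :: real ^ 'm::finite option ^ 'm option)\<bar> = \<bar>a\<bar> * \<bar>dil TYPE('m) a\<bar> ^ CARD('m)"
proof -
  have "det (dilation_matrix a :: real ^ 'm option ^ 'm option) = (\<Prod>i\<in>UNIV. (dilation_matrix a :: real ^ 'm option ^ 'm option) $ i $ i)"
    by (rule det_diagonal) (simp add: dilation_matrix_def)
  also have "\<dots> = a * dil TYPE('m) a ^ CARD('m)"
    by (simp add: prod_option dilation_matrix_def dil_def)
  finally show ?thesis
    by (simp add: shearlet_matrix_def det_mul det_shear_matrix abs_mult power_abs)
qed

text \<open>The modulus of the determinant of M_sa, that is |a|^(2 - 1/n).\<close>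

definition dil_det :: "'m::finite itself \<Rightarrow> real \<Rightarrow> real" where
  "dil_det _ a = \<bar>a\<bar> * \<bar>dil TYPE('m) a\<bar> ^ CARD('m)"

lemma dil_det_pos: "a \<noteq> 0 \<Longrightarrow> 0 < dil_det TYPE('m::finite) a"
  by (simp add: dil_det_def)

lemma dil_det_measurable [measurable]: "dil_det TYPE('m::finite) \<in> borel_measurable borel"
  unfolding dil_det_def[abs_def] by measurable

text \<open>Both matrices are triangular in the splitting by \<open>vcons\<close>, so integrating
  block by block turns the shear into a translation of the inner variable. For the matrix itself the
  first coordinate has to be the inner variable, for the transpose the tail.\<close>

lemma nn_integral_shearlet_matrix:
  fixes H :: "real ^ 'm::finite option \<Rightarrow> ennreal"
  assumes [measurable]: "H \<in> borel_measurable borel" and a: "a \<noteq> 0"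
  shows "(\<integral>\<^sup>+x. H x \<partial>lborel) = ennreal (dil_det TYPE('m) a) * (\<integral>\<^sup>+x. H (shearlet_matrix s a *v x) \<partial>lborel)"
    and "(\<integral>\<^sup>+x. H x \<partial>lborel) = ennreal (dil_det TYPE('m) a) * (\<integral>\<^sup>+x. H (transpose (shearlet_matrix s a) *v x) \<partial>lborel)"
proof -
  let ?l = "dil TYPE('m) a"
  have [measurable]: "(\<lambda>x. A *v x) \<in> borel_measurable borel" for A :: "real ^ 'm option ^ 'm option"
    by (intro borel_measurable_continuous_onI linear_continuous_on matrix_vector_mul_bounded_linear)
  have l: "?l \<noteq> 0" using a by simp
  have v: "(\<integral>\<^sup>+v. F v \<partial>lborel) = ennreal (\<bar>?l\<bar> ^ CARD('m)) * (\<integral>\<^sup>+v. F (t + ?l *\<^sub>R v) \<partial>lborel)"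
    if "F \<in> borel_measurable borel" for F :: "real ^ 'm \<Rightarrow> ennreal" and t
    using lborel_nn_integral_affine[OF that l, of t] by (simp add: ennreal_power)
  have c: "ennreal (dil_det TYPE('m) a) = ennreal \<bar>a\<bar> * ennreal (\<bar>?l\<bar> ^ CARD('m))"
    by (simp add: dil_det_def ennreal_mult)
  have "(\<integral>\<^sup>+x. H x \<partial>lborel) = (\<integral>\<^sup>+v. \<integral>\<^sup>+u. H (vcons u v) \<partial>lborel \<partial>lborel)"
    by (rule nn_integral_vcons) simp
  also have "\<dots> = (\<integral>\<^sup>+v. \<integral>\<^sup>+u. H (vcons u (?l *\<^sub>R v)) \<partial>lborel \<partial>lborel) * ennreal (\<bar>?l\<bar> ^ CARD('m))"
    by (subst v[of _ 0]) (simp_all add: mult.commute)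
  also have "(\<integral>\<^sup>+v. \<integral>\<^sup>+u. H (vcons u (?l *\<^sub>R v)) \<partial>lborel \<partial>lborel)
     = (\<integral>\<^sup>+v. ennreal \<bar>a\<bar> * (\<integral>\<^sup>+u. H (vcons (?l * (s \<bullet> v) + a * u) (?l *\<^sub>R v)) \<partial>lborel) \<partial>lborel)"
    by (intro nn_integral_cong nn_integral_real_affine a) simp
  also have "\<dots> = ennreal \<bar>a\<bar> * (\<integral>\<^sup>+v. \<integral>\<^sup>+u. H (shearlet_matrix s a *v vcons u v) \<partial>lborel \<partial>lborel)"
    by (simp add: nn_integral_cmult shearlet_matrix_mult add.commute)
  also have "(\<integral>\<^sup>+v. \<integral>\<^sup>+u. H (shearlet_matrix s a *v vcons u v) \<partial>lborel \<partial>lborel) = (\<integral>\<^sup>+x. H (shearlet_matrix s a *v x) \<partial>lborel)"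
    by (rule nn_integral_vcons(2)[symmetric]) measurable
  finally show "(\<integral>\<^sup>+x. H x \<partial>lborel) = ennreal (dil_det TYPE('m) a) * (\<integral>\<^sup>+x. H (shearlet_matrix s a *v x) \<partial>lborel)"
    by (simp add: c mult_ac)
  have "(\<integral>\<^sup>+x. H x \<partial>lborel) = (\<integral>\<^sup>+u. \<integral>\<^sup>+v. H (vcons u v) \<partial>lborel \<partial>lborel)"
    by (rule nn_integral_vcons) simp
  also have "\<dots> = ennreal \<bar>a\<bar> * (\<integral>\<^sup>+u. \<integral>\<^sup>+v. H (vcons (a * u) v) \<partial>lborel \<partial>lborel)"
    using nn_integral_real_affine[of "\<lambda>u. \<integral>\<^sup>+v. H (vcons u v) \<partial>lborel" a 0] a by simp
  also have "(\<integral>\<^sup>+u. \<integral>\<^sup>+v. H (vcons (a * u) v) \<partial>lborel \<partial>lborel)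
     = (\<integral>\<^sup>+u. ennreal (\<bar>?l\<bar> ^ CARD('m)) * (\<integral>\<^sup>+v. H (vcons (a * u) ((?l * u) *\<^sub>R s + ?l *\<^sub>R v)) \<partial>lborel) \<partial>lborel)"
    by (intro nn_integral_cong v) simp
  also have "\<dots> = ennreal (\<bar>?l\<bar> ^ CARD('m)) * (\<integral>\<^sup>+u. \<integral>\<^sup>+v. H (transpose (shearlet_matrix s a) *v vcons u v) \<partial>lborel \<partial>lborel)"
    by (simp add: nn_integral_cmult transpose_shearlet_matrix_mult scaleR_add_right del: transpose_matrix_vector)
  also have "(\<integral>\<^sup>+u. \<integral>\<^sup>+v. H (transpose (shearlet_matrix s a) *v vcons u v) \<partial>lborel \<partial>lborel) = (\<integral>\<^sup>+x. H (transpose (shearlet_matrix s a) *v x) \<partial>lborel)"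
    by (rule nn_integral_vcons(1)[symmetric]) measurable
  finally show "(\<integral>\<^sup>+x. H x \<partial>lborel) = ennreal (dil_det TYPE('m) a) * (\<integral>\<^sup>+x. H (transpose (shearlet_matrix s a) *v x) \<partial>lborel)"
    by (simp add: c mult_ac)
qed

text \<open>A scaling rule for nonnegative integrals exhibits \<open>lborel\<close> as a multiple of
  its image under \<open>T\<close>, and in this form it passes to Bochner integrals.\<close>

lemma lborel_substitution:
  fixes T :: "'a::euclidean_space \<Rightarrow> 'a" and f :: "'a \<Rightarrow> 'b::{banach,second_countable_topology}"
  assumes T [measurable]: "T \<in> borel_measurable borel" and c: "c > 0"
    and subst: "\<And>H. H \<in> borel_measurable borel \<Longrightarrow> (\<integral>\<^sup>+x. H x \<partial>lborel) = ennreal c * (\<integral>\<^sup>+x. H (T x) \<partial>lborel)"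
    and f [measurable]: "f \<in> borel_measurable borel"
  shows "(\<integral>x. f x \<partial>lborel) = c *\<^sub>R (\<integral>x. f (T x) \<partial>lborel)"
    and "integrable lborel (\<lambda>x. f (T x)) \<longleftrightarrow> integrable lborel f"
proof -
  have eq: "lborel = density (distr lborel borel T) (\<lambda>_. ennreal c)"
  proof (rule measure_eqI)
    fix A :: "'a set" assume "A \<in> sets lborel"
    then have [measurable]: "A \<in> sets borel" by simp
    have "emeasure lborel A = (\<integral>\<^sup>+x. indicator A x \<partial>lborel)" by simp
    also have "\<dots> = ennreal c * (\<integral>\<^sup>+x. indicator A (T x) \<partial>lborel)"
      by (rule subst) measurable
    also have "(\<integral>\<^sup>+x. indicator A (T x) \<partial>lborel) = (\<integral>\<^sup>+x. indicator A x \<partial>distr lborel borel T)"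
      by (rule nn_integral_distr[symmetric]) measurable
    also have "ennreal c * \<dots> = emeasure (density (distr lborel borel T) (\<lambda>_. ennreal c)) A"
      by (simp add: emeasure_density nn_integral_cmult)
    finally show "emeasure lborel A = emeasure (density (distr lborel borel T) (\<lambda>_. ennreal c)) A" .
  qed simp
  have "(\<integral>x. f x \<partial>lborel) = (\<integral>x. f x \<partial>density (distr lborel borel T) (\<lambda>_. ennreal c))"
    by (subst eq) simp
  also have "\<dots> = c *\<^sub>R (\<integral>x. f (T x) \<partial>lborel)"
    using c by (subst integral_density) (auto simp: integral_distr)
  finally show "(\<integral>x. f x \<partial>lborel) = c *\<^sub>R (\<integral>x. f (T x) \<partial>lborel)" .
  have m: "(\<lambda>x. ennreal (norm (f x))) \<in> borel_measurable borel" by measurable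
  show "integrable lborel (\<lambda>x. f (T x)) \<longleftrightarrow> integrable lborel f"
    unfolding integrable_iff_bounded subst[OF m] using c by (auto simp: ennreal_mult_less_top)
qed

subsection \<open>Admissibility and isometry\<close>

declare transpose_matrix_vector [simp del]

text \<open>Joint measurability in the dilation, the shear and the vector is read off from the
  coordinate formulas.\<close>

lemma shearlet_matrix_mult_measurable [measurable (raw)]:
  fixes g :: "'a \<Rightarrow> real ^ 'm::finite"
  assumes [measurable]: "f \<in> borel_measurable M" "g \<in> borel_measurable M" "h \<in> borel_measurable M"
  shows "(\<lambda>x. shearlet_matrix (g x) (f x) *v h x) \<in> borel_measurable M"
    and "(\<lambda>x. transpose (shearlet_matrix (g x) (f x)) *v h x) \<in> borel_measurable M"
proof -
  have "shearlet_matrix (g x) (f x) *v h x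
     = vcons (f x * (h x $ None) + dil TYPE('m) (f x) * (g x \<bullet> vtail (h x))) (dil TYPE('m) (f x) *\<^sub>R vtail (h x))" for x
    using shearlet_matrix_mult[of "g x" "f x" "h x $ None" "vtail (h x)"] by simp
  moreover have "transpose (shearlet_matrix (g x) (f x)) *v h x
     = vcons (f x * (h x $ None)) (dil TYPE('m) (f x) *\<^sub>R ((h x $ None) *\<^sub>R g x + vtail (h x)))" for x
    using transpose_shearlet_matrix_mult[of "g x" "f x" "h x $ None" "vtail (h x)"] by simp
  ultimately show "(\<lambda>x. shearlet_matrix (g x) (f x) *v h x) \<in> borel_measurable M"
    "(\<lambda>x. transpose (shearlet_matrix (g x) (f x)) *v h x) \<in> borel_measurable M"
    by (simp_all only:) measurable
qed

text \<open>The substitution in s has a Jacobian of exponent (n - 1)/n in |a|. Together with the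
  exponent (n^2 - n + 1)/n of the admissibility condition this makes exactly n.\<close>

lemma dil_power:
  assumes "a \<noteq> 0"
  shows "\<bar>dil TYPE('m::finite) a\<bar> ^ CARD('m) * \<bar>a\<bar> powr (((real CARD('m option))\<^sup>2 - real CARD('m option) + 1) / real CARD('m option))
    = \<bar>a\<bar> ^ CARD('m option)"
proof -
  let ?n = "real CARD('m option)"
  have n: "?n > 0" by simp
  have m: "real CARD('m) = ?n - 1" by simp
  have "\<bar>dil TYPE('m) a\<bar> ^ CARD('m) = \<bar>a\<bar> powr (1 / ?n * real CARD('m))"
    using assms by (simp only: abs_dil powr_powr[symmetric]) (simp add: powr_realpow)
  then have "\<bar>dil TYPE('m) a\<bar> ^ CARD('m) * \<bar>a\<bar> powr ((?n\<^sup>2 - ?n + 1) / ?n)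
    = \<bar>a\<bar> powr (1 / ?n * (?n - 1) + (?n\<^sup>2 - ?n + 1) / ?n)"
    by (simp only: powr_add m)
  also have "1 / ?n * (?n - 1) + (?n\<^sup>2 - ?n + 1) / ?n = ?n"
  proof -
    have "1 / x * (x - 1) + (x\<^sup>2 - x + 1) / x = x" if "x > 0" for x :: real
      using that by (simp add: field_simps power2_eq_square)
    then show ?thesis using n by blast
  qed
  also have "\<bar>a\<bar> powr ?n = \<bar>a\<bar> ^ CARD('m option)"
    using assms by (intro powr_realpow) simp
  finally show ?thesis .
qed

text \<open>
  The substitution \<open>x = M\<^sub>s\<^sub>a\<^sup>T \<xi>\<close> with \<open>\<Psi>\<close> the Fourier transform of \<open>\<psi>\<close> turns the admissibility integral into \<open>\<integral> |\<Psi>(x)|\<^sup>2 / |x\<^sub>1|\<^sup>n dx\<close>,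
  which does not depend on \<open>\<xi>\<close>.
\<close>

definition radial_integral :: "(real ^ ('m::finite option) \<Rightarrow> ennreal) \<Rightarrow> ennreal" where
  "radial_integral H = (\<integral>\<^sup>+u. (\<integral>\<^sup>+v. H (vcons u v) \<partial>lborel) * ennreal (1 / \<bar>u\<bar> ^ CARD('m option)) \<partial>lborel)"

lemma admissibility_substitution:
  fixes H :: "real ^ ('m::finite option) \<Rightarrow> ennreal"
  assumes [measurable]: "H \<in> borel_measurable borel" and \<xi>: "\<xi> $ None \<noteq> 0"
  defines "p \<equiv> ((real CARD('m option))\<^sup>2 - real CARD('m option) + 1) / real CARD('m option)"
  shows "(\<integral>\<^sup>+s. \<integral>\<^sup>+a. H (transpose (shearlet_matrix s a) *v \<xi>) * ennreal (1 / \<bar>a\<bar> powr p) \<partial>lborel \<partial>lborel)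
    = radial_integral H"
proof -
  define x where "x = \<xi> $ None"
  define y where "y = vtail \<xi>"
  define \<Phi> where "\<Phi> u = (\<integral>\<^sup>+v. H (vcons u v) \<partial>lborel)" for u
  have [measurable]: "\<Phi> \<in> borel_measurable borel" unfolding \<Phi>_def[abs_def] by measurable
  have x: "x \<noteq> 0" using \<xi> by (simp add: x_def)
  have xy: "transpose (shearlet_matrix s a) *v \<xi> = vcons (a * x) (dil TYPE('m) a *\<^sub>R (x *\<^sub>R s + y))" for s a
    using transpose_shearlet_matrix_mult[of s a x y] by (simp only: x_def y_def vcons_vtail)
  \<comment> \<open>For fixed a the tail of the transformed vector is affine in s with factor
    \<open>dil TYPE('m) a * x\<close>, nonzero because a and x are. The substitution in s therefore
    removes \<open>y\<close> from the integral.\<close>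
  have inner: "(\<integral>\<^sup>+s. H (transpose (shearlet_matrix s a) *v \<xi>) * ennreal (1 / \<bar>a\<bar> powr p) \<partial>lborel)
     = ennreal \<bar>x\<bar> * (\<Phi> (0 + x * a) * ennreal (1 / \<bar>0 + x * a\<bar> ^ CARD('m option)))" if a: "a \<noteq> 0" for a
  proof -
    let ?l = "dil TYPE('m) a"
    have l: "?l * x \<noteq> 0" using a x by simp
    have c: "\<bar>?l * x\<bar> ^ CARD('m) > 0" using l by simp
    have eq: "vcons (a * x) (?l *\<^sub>R (x *\<^sub>R s + y)) = vcons (a * x) (?l *\<^sub>R y + (?l * x) *\<^sub>R s)" for s
      by (simp add: scaleR_add_right add.commute)
    have \<Phi>: "\<Phi> (a * x) = ennreal (\<bar>?l * x\<bar> ^ CARD('m)) * (\<integral>\<^sup>+s. H (vcons (a * x) (?l *\<^sub>R y + (?l * x) *\<^sub>R s)) \<partial>lborel)"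
      unfolding \<Phi>_def using lborel_nn_integral_affine[of "\<lambda>v. H (vcons (a * x) v)" "?l * x" "?l *\<^sub>R y", OF _ l]
      by (simp add: ennreal_power)
    have "(\<integral>\<^sup>+s. H (vcons (a * x) (?l *\<^sub>R y + (?l * x) *\<^sub>R s)) \<partial>lborel) = ennreal (1 / \<bar>?l * x\<bar> ^ CARD('m)) * \<Phi> (a * x)"
      unfolding \<Phi> mult.assoc[symmetric] using c by (simp add: ennreal_mult[symmetric] del: mult_eq_0_iff)
    then have "(\<integral>\<^sup>+s. H (transpose (shearlet_matrix s a) *v \<xi>) * ennreal (1 / \<bar>a\<bar> powr p) \<partial>lborel)
      = (ennreal (1 / \<bar>?l * x\<bar> ^ CARD('m)) * ennreal (1 / \<bar>a\<bar> powr p)) * \<Phi> (a * x)"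
      unfolding xy eq by (subst nn_integral_multc) (measurable, simp only: mult_ac)
    also have "ennreal (1 / \<bar>?l * x\<bar> ^ CARD('m)) * ennreal (1 / \<bar>a\<bar> powr p) = ennreal (\<bar>x\<bar> * (1 / \<bar>x * a\<bar> ^ CARD('m option)))"
    proof -
      have "1 / \<bar>?l * x\<bar> ^ CARD('m) * (1 / \<bar>a\<bar> powr p) = 1 / (\<bar>x\<bar> ^ CARD('m) * (\<bar>?l\<bar> ^ CARD('m) * \<bar>a\<bar> powr p))"
        by (simp add: abs_mult power_mult_distrib)
      also have "\<dots> = 1 / (\<bar>x\<bar> ^ CARD('m) * \<bar>a\<bar> ^ CARD('m option))"
        by (simp only: dil_power[OF a] p_def)
      also have "\<dots> = \<bar>x\<bar> * (1 / \<bar>x * a\<bar> ^ CARD('m option))"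
        using x by (simp add: abs_mult power_mult_distrib)
      finally show ?thesis by (simp add: ennreal_mult[symmetric])
    qed
    also have "ennreal (\<bar>x\<bar> * (1 / \<bar>x * a\<bar> ^ CARD('m option))) = ennreal \<bar>x\<bar> * ennreal (1 / \<bar>x * a\<bar> ^ CARD('m option))"
      by (rule ennreal_mult) auto
    finally show ?thesis unfolding add_0_left by (simp only: mult_ac)
  qed
  \<comment> \<open>The order is exchanged because the substitution in s needs a fixed; a = 0 is a
    null set, and the final rescaling from a to x a absorbs \<open>\<bar>x\<bar>\<close>.\<close>
  have "(\<integral>\<^sup>+s. \<integral>\<^sup>+a. H (transpose (shearlet_matrix s a) *v \<xi>) * ennreal (1 / \<bar>a\<bar> powr p) \<partial>lborel \<partial>lborel)
     = (\<integral>\<^sup>+a. \<integral>\<^sup>+s. H (transpose (shearlet_matrix s a) *v \<xi>) * ennreal (1 / \<bar>a\<bar> powr p) \<partial>lborel \<partial>lborel)"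
    by (rule lborel_pair.Fubini') (simp add: case_prod_beta' del: transpose_matrix_vector)
  also have "\<dots> = (\<integral>\<^sup>+a. ennreal \<bar>x\<bar> * (\<Phi> (0 + x * a) * ennreal (1 / \<bar>0 + x * a\<bar> ^ CARD('m option))) \<partial>lborel)"
  proof (rule nn_integral_cong_AE)
    show "AE a in lborel. (\<integral>\<^sup>+s. H (transpose (shearlet_matrix s a) *v \<xi>) * ennreal (1 / \<bar>a\<bar> powr p) \<partial>lborel)
       = ennreal \<bar>x\<bar> * (\<Phi> (0 + x * a) * ennreal (1 / \<bar>0 + x * a\<bar> ^ CARD('m option)))"
      using AE_lborel_singleton[of "0::real"] by eventually_elim (rule inner)
  qed
  also have "\<dots> = ennreal \<bar>x\<bar> * (\<integral>\<^sup>+a. \<Phi> (0 + x * a) * ennreal (1 / \<bar>0 + x * a\<bar> ^ CARD('m option)) \<partial>lborel)"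
    by (rule nn_integral_cmult) measurable
  also have "\<dots> = radial_integral H"
    unfolding radial_integral_def \<Phi>_def[symmetric]
    by (rule nn_integral_real_affine[OF _ x, symmetric]) measurable
  finally show ?thesis .
qed

text \<open>The integrand samples \<open>fourier_L2 \<psi>\<close> along the orbit of a single point
  \<xi>, where an exceptional null set might matter. The substitution applied to the indicator of a
  null set N shows that the orbit avoids N for almost all s and a, since almost every slice of N
  with fixed first coordinate is null.\<close>

lemma admissibility_integral_eq:
  fixes \<psi> :: "real ^ ('m::finite option) \<Rightarrow> complex"
  assumes g: "g \<in> borel_measurable borel" "AE x in lborel. fourier_L2 \<psi> x = g x"
    and \<xi>: "\<xi> $ None \<noteq> 0"
  shows "admissibility_integral \<psi> \<xi> = radial_integral (\<lambda>x. ennreal ((cmod (g x))\<^sup>2))"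
proof -
  let ?p = "((real CARD('m option))\<^sup>2 - real CARD('m option) + 1) / real CARD('m option)"
  note [measurable] = g(1)
  obtain N where N: "{x \<in> space lborel. \<not> fourier_L2 \<psi> x = g x} \<subseteq> N" "emeasure lborel N = 0" "N \<in> sets lborel"
    using AE_E[OF g(2)] by blast
  have [measurable]: "N \<in> sets borel" using N(3) by simp
  have "(\<integral>\<^sup>+u. \<integral>\<^sup>+v. indicator N (vcons u v) \<partial>lborel \<partial>lborel) = 0"
    using nn_integral_vcons(1)[of "indicator N"] N(2) by simp
  then have "AE u in lborel. (\<integral>\<^sup>+v. indicator N (vcons u v) \<partial>lborel) = 0"
    by (subst (asm) nn_integral_0_iff_AE) auto
  then have "radial_integral (indicator N) = 0"
    unfolding radial_integral_def by (subst nn_integral_0_iff_AE) (auto elim!: eventually_mono)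
  then have "(\<integral>\<^sup>+s. \<integral>\<^sup>+a. indicator N (transpose (shearlet_matrix s a) *v \<xi>) * ennreal (1 / \<bar>a\<bar> powr ?p) \<partial>lborel \<partial>lborel) = 0"
    by (subst admissibility_substitution[OF _ \<xi>]) auto
  then have "AE s in lborel. (\<integral>\<^sup>+a. indicator N (transpose (shearlet_matrix s a) *v \<xi>) * ennreal (1 / \<bar>a\<bar> powr ?p) \<partial>lborel) = 0"
    by (rule iffD1[OF nn_integral_0_iff_AE, rotated]) measurable
  then have ae: "AE s in lborel. AE a in lborel. indicator N (transpose (shearlet_matrix s a) *v \<xi>) * ennreal (1 / \<bar>a\<bar> powr ?p) = 0"
  proof eventually_elim
    case (elim s)
    then show ?case by (rule iffD1[OF nn_integral_0_iff_AE, rotated]) measurable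
  qed
  have "admissibility_integral \<psi> \<xi> = (\<integral>\<^sup>+s. \<integral>\<^sup>+a. ennreal ((cmod (fourier_L2 \<psi> (transpose (shearlet_matrix s a) *v \<xi>)))\<^sup>2 / \<bar>a\<bar> powr ?p) * indicator (UNIV - {0}) a \<partial>lborel \<partial>lborel)"
    unfolding admissibility_integral_def Let_def nn_integral_completion ..
  also have "\<dots> = (\<integral>\<^sup>+s. \<integral>\<^sup>+a. ennreal ((cmod (g (transpose (shearlet_matrix s a) *v \<xi>)))\<^sup>2) * ennreal (1 / \<bar>a\<bar> powr ?p) \<partial>lborel \<partial>lborel)"
  proof (rule nn_integral_cong_AE)
    show "AE s in lborel. (\<integral>\<^sup>+a. ennreal ((cmod (fourier_L2 \<psi> (transpose (shearlet_matrix s a) *v \<xi>)))\<^sup>2 / \<bar>a\<bar> powr ?p) * indicator (UNIV - {0}) a \<partial>lborel)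
      = (\<integral>\<^sup>+a. ennreal ((cmod (g (transpose (shearlet_matrix s a) *v \<xi>)))\<^sup>2) * ennreal (1 / \<bar>a\<bar> powr ?p) \<partial>lborel)"
      using ae
    proof eventually_elim
      case (elim s)
      show ?case
      proof (rule nn_integral_cong_AE)
        show "AE a in lborel. ennreal ((cmod (fourier_L2 \<psi> (transpose (shearlet_matrix s a) *v \<xi>)))\<^sup>2 / \<bar>a\<bar> powr ?p) * indicator (UNIV - {0}) a
           = ennreal ((cmod (g (transpose (shearlet_matrix s a) *v \<xi>)))\<^sup>2) * ennreal (1 / \<bar>a\<bar> powr ?p)"
          using elim AE_lborel_singleton[of "0::real"]
        proof eventually_elim
          case (elim a)
          then have "transpose (shearlet_matrix s a) *v \<xi> \<notin> N"
            by (auto simp: indicator_def divide_le_0_iff simp del: transpose_matrix_vector split: if_splits)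
          then have "fourier_L2 \<psi> (transpose (shearlet_matrix s a) *v \<xi>) = g (transpose (shearlet_matrix s a) *v \<xi>)"
            using N(1) by auto
          then show ?case using elim(2) by (simp add: ennreal_mult[symmetric] del: transpose_matrix_vector)
        qed
      qed
    qed
  qed
  also have "\<dots> = radial_integral (\<lambda>x. ennreal ((cmod (g x))\<^sup>2))"
    by (rule admissibility_substitution[OF _ \<xi>]) measurable
  finally show ?thesis .
qed

text \<open>Uniqueness under \<open>THE\<close> requires some point with nonzero first coordinate;
  \<open>vcons 1 0\<close> is one.\<close>

lemma admissibility_constant_eq:
  fixes \<psi> :: "real ^ ('m::finite option) \<Rightarrow> complex"
  assumes g: "g \<in> borel_measurable borel" "AE x in lborel. fourier_L2 \<psi> x = g x"
  shows "admissibility_constant \<psi> = radial_integral (\<lambda>x. ennreal ((cmod (g x))\<^sup>2))"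
  unfolding admissibility_constant_def
proof (rule the_equality)
  show "\<forall>\<xi>. \<xi> $ None \<noteq> 0 \<longrightarrow> admissibility_integral \<psi> \<xi> = radial_integral (\<lambda>x. ennreal ((cmod (g x))\<^sup>2))"
    using admissibility_integral_eq[OF g] by blast
  fix C assume "\<forall>\<xi>. \<xi> $ None \<noteq> 0 \<longrightarrow> admissibility_integral \<psi> \<xi> = C"
  then have "admissibility_integral \<psi> (vcons 1 0) = C" by simp
  then show "C = radial_integral (\<lambda>x. ennreal ((cmod (g x))\<^sup>2))"
    using admissibility_integral_eq[OF g, of "vcons 1 0"] by simp
qed

text \<open>The transform after the substitution \<open>x = t + M\<^sub>s\<^sub>a y\<close>, which makes measurability in \<open>(a, s, t)\<close> visible.\<close>

definition sht :: "(real ^ ('m::finite option) \<Rightarrow> complex) \<Rightarrow> (real ^ 'm option \<Rightarrow> complex) \<Rightarrow> real \<Rightarrow> real ^ 'm \<Rightarrow> real ^ 'm option \<Rightarrow> complex" where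
  "sht \<psi> f a s t = complex_of_real (sqrt (dil_det TYPE('m) a)) * (\<integral>y. f (t + shearlet_matrix s a *v y) * cnj (\<psi> y) \<partial>lborel)"

lemma sht_measurable [measurable (raw)]:
  assumes [measurable]: "\<psi> \<in> borel_measurable borel" "f \<in> borel_measurable borel"
    "h1 \<in> borel_measurable M" "h2 \<in> borel_measurable M" "h3 \<in> borel_measurable M"
  shows "(\<lambda>p. sht \<psi> f (h1 p) (h2 p) (h3 p)) \<in> borel_measurable M"
  unfolding sht_def by measurable

lemma matrix_mult_measurable: "(\<lambda>x. A *v x) \<in> borel_measurable borel" for A :: "real ^ 'k::finite ^ 'k"
  by (intro borel_measurable_continuous_onI linear_continuous_on matrix_vector_mul_bounded_linear)

text \<open>In a complete measure a preimage is measurable once it differs from a Borel set within a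
  null set. It serves for integrands that still contain the original functions rather than their
  representatives.\<close>

lemma measurable_lebesgue_AE:
  fixes f g :: "'a::euclidean_space \<Rightarrow> 'b::topological_space"
  assumes g: "g \<in> borel_measurable borel" and AE: "AE x in lborel. f x = g x"
  shows "f \<in> borel_measurable lebesgue"
proof (rule measurableI)
  fix A :: "'b set" assume A: "A \<in> sets borel"
  have "g -` A \<inter> space lborel \<in> sets lborel"
    using g A by (intro measurable_sets) auto
  then have gA: "g -` A \<in> sets lebesgue" by auto
  have ae: "AE x in lebesgue. x \<in> g -` A \<longleftrightarrow> x \<in> f -` A"
    using AE_completion[OF AE] by eventually_elim auto
  have "f -` A \<in> sets lebesgue"
    by (rule completion.in_sets_AE[OF ae gA]) auto
  then show "f -` A \<inter> space lebesgue \<in> sets lebesgue" by simp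
qed auto

lemma shearlet_matrix_subst:
  fixes f :: "real ^ ('m::finite option) \<Rightarrow> 'b::{banach,second_countable_topology}"
  assumes "a \<noteq> 0" "f \<in> borel_measurable borel"
  shows "(\<integral>x. f x \<partial>lborel) = dil_det TYPE('m) a *\<^sub>R (\<integral>x. f (shearlet_matrix s a *v x) \<partial>lborel)"
    and "integrable lborel (\<lambda>x. f (shearlet_matrix s a *v x)) \<longleftrightarrow> integrable lborel f"
    and "(\<integral>x. f x \<partial>lborel) = dil_det TYPE('m) a *\<^sub>R (\<integral>x. f (transpose (shearlet_matrix s a) *v x) \<partial>lborel)"
    and "integrable lborel (\<lambda>x. f (transpose (shearlet_matrix s a) *v x)) \<longleftrightarrow> integrable lborel f"
proof -
  show "(\<integral>x. f x \<partial>lborel) = dil_det TYPE('m) a *\<^sub>R (\<integral>x. f (shearlet_matrix s a *v x) \<partial>lborel)"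
     "integrable lborel (\<lambda>x. f (shearlet_matrix s a *v x)) \<longleftrightarrow> integrable lborel f"
    by (rule lborel_substitution[OF matrix_mult_measurable dil_det_pos[OF assms(1)] nn_integral_shearlet_matrix(1)[OF _ assms(1)] assms(2)]; assumption)+
  show "(\<integral>x. f x \<partial>lborel) = dil_det TYPE('m) a *\<^sub>R (\<integral>x. f (transpose (shearlet_matrix s a) *v x) \<partial>lborel)"
    "integrable lborel (\<lambda>x. f (transpose (shearlet_matrix s a) *v x)) \<longleftrightarrow> integrable lborel f"
    by (rule lborel_substitution[OF matrix_mult_measurable dil_det_pos[OF assms(1)] nn_integral_shearlet_matrix(2)[OF _ assms(1)] assms(2)]; assumption)+
qed

text \<open>The map y to t + M y carries the exceptional null set of \<open>\<psi>\<close> to a null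
  set, so replacing \<open>\<psi>\<close> and \<open>f\<close> by representatives leaves the
  transform unchanged at every parameter with a nonzero, not merely at almost every one.\<close>

lemma shearlet_transform_eq_sht:
  fixes \<psi> f :: "real ^ ('m::finite option) \<Rightarrow> complex"
  assumes \<psi>': "\<psi>' \<in> borel_measurable borel" "AE x in lborel. \<psi> x = \<psi>' x"
    and f': "f' \<in> borel_measurable borel" "AE x in lborel. f x = f' x" and a: "a \<noteq> 0"
  shows "shearlet_transform \<psi> f a s t = sht \<psi>' f' a s t"
proof -
  let ?M = "shearlet_matrix s a :: real ^ 'm option ^ 'm option"
  let ?\<delta> = "dil_det TYPE('m) a"
  note [measurable] = \<psi>'(1) f'(1) matrix_mult_measurable
  have pos: "?\<delta> > 0" using a by (rule dil_det_pos)
  have det: "\<bar>det ?M\<bar> = ?\<delta>" by (simp add: abs_det_shearlet_matrix dil_det_def)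
  then have "invertible ?M" using pos by (simp add: invertible_det_nz)
  then have "matrix_inv ?M ** ?M = mat 1"
    unfolding invertible_def matrix_inv_def by (rule someI2_ex) simp
  then have inv: "matrix_inv ?M *v (?M *v y) = y" for y
    by (simp add: matrix_vector_mul_assoc)
  obtain N where N: "{x \<in> space lborel. \<not> \<psi> x = \<psi>' x} \<subseteq> N" "emeasure lborel N = 0" "N \<in> sets lborel"
    using AE_E[OF \<psi>'(2)] by blast
  have [measurable]: "N \<in> sets borel" using N(3) by simp
  have "(\<integral>\<^sup>+x. indicator N (matrix_inv ?M *v (x - t)) \<partial>lborel) = (\<integral>\<^sup>+x. indicator N (matrix_inv ?M *v ((t + x) - t)) \<partial>lborel)"
    by (rule lborel_nn_integral_translate[symmetric]) measurable
  also have "\<dots> = ennreal ?\<delta> * (\<integral>\<^sup>+x. indicator N x \<partial>lborel)"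
    by (subst nn_integral_shearlet_matrix(1)[OF _ a, of _ s]) (simp_all add: inv)
  finally have "(\<integral>\<^sup>+x. indicator N (matrix_inv ?M *v (x - t)) \<partial>lborel) = 0"
    using N(2) by simp
  then have "AE x in lborel. matrix_inv ?M *v (x - t) \<notin> N"
    by (subst (asm) nn_integral_0_iff_AE) (auto simp: indicator_eq_0_iff elim!: eventually_mono)
  then have ae: "AE x in lborel. f x * cnj (shearlet \<psi> a s t x) = f' x * cnj (shearlet \<psi>' a s t x)"
    using f'(2)
  proof eventually_elim
    case (elim x)
    then have "\<psi> (matrix_inv ?M *v (x - t)) = \<psi>' (matrix_inv ?M *v (x - t))" using N(1) by auto
    then show ?case using elim(2) by (simp add: shearlet_def)
  qed
  have m: "(\<lambda>x. f' x * cnj (shearlet \<psi>' a s t x)) \<in> borel_measurable borel"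
    unfolding shearlet_def by measurable
  have "shearlet_transform \<psi> f a s t = (\<integral>x. f' x * cnj (shearlet \<psi>' a s t x) \<partial>lborel)"
    unfolding shearlet_transform_def
    by (rule lebesgue_integral_representative(2)[OF measurable_lebesgue_AE[OF m ae] m ae])
  also have "\<dots> = (\<integral>x. f' (t + x) * cnj (shearlet \<psi>' a s t (t + x)) \<partial>lborel)"
    by (rule lborel_integral_translate[symmetric, OF m])
  also have "\<dots> = ?\<delta> *\<^sub>R (\<integral>y. f' (t + ?M *v y) * cnj (shearlet \<psi>' a s t (t + ?M *v y)) \<partial>lborel)"
    by (rule shearlet_matrix_subst(1)[OF a]) (simp add: shearlet_def)
  also have "\<dots> = ?\<delta> *\<^sub>R (\<integral>y. complex_of_real (?\<delta> powr (- 1 / 2)) * (f' (t + ?M *v y) * cnj (\<psi>' y)) \<partial>lborel)"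
    by (simp add: shearlet_def det inv mult_ac)
  also have "\<dots> = complex_of_real (?\<delta> * ?\<delta> powr (- 1 / 2)) * (\<integral>y. f' (t + ?M *v y) * cnj (\<psi>' y) \<partial>lborel)"
    by (simp add: scaleR_conv_of_real)
  \<comment> \<open>The Jacobian times the normalisation |det|^(-1/2) leaves the square root that
    appears in \<open>sht\<close>.\<close>
  also have "?\<delta> * ?\<delta> powr (- 1 / 2) = sqrt ?\<delta>"
  proof -
    have "?\<delta> * ?\<delta> powr (- 1 / 2) = ?\<delta> powr 1 * ?\<delta> powr (- 1 / 2)" using pos by simp
    also have "\<dots> = ?\<delta> powr (1 / 2)" by (simp only: powr_add[symmetric]) simp
    finally show ?thesis using pos by (simp add: powr_half_sqrt)
  qed
  finally show ?thesis by (simp add: sht_def)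
qed

text \<open>
  By Parseval, \<open>t \<mapsto> sht \<psi> f a s t\<close> is, up to a factor, the reflected Fourier transform of
  \<open>f\<close>'s transform times the conjugate of \<open>\<Psi>(M\<^sub>s\<^sub>a\<^sup>T \<xi>)\<close>, which lies in \<open>L\<^sup>1\<close> and \<open>L\<^sup>2\<close>; so no convolution theorem is needed.
\<close>

lemma sht_slice:
  fixes \<psi> f :: "real ^ ('m::finite option) \<Rightarrow> complex"
  assumes pair: "fourier_pair \<psi> \<Psi>" and f: "integrable lborel f" "sq_integrable lborel f" and a: "a \<noteq> 0"
  shows "(\<integral>\<^sup>+t. ennreal ((cmod (sht \<psi> f a s t))\<^sup>2) \<partial>lborel)
    = ennreal (dil_det TYPE('m) a) * (\<integral>\<^sup>+\<xi>. ennreal ((cmod (fourier_L1 f \<xi>))\<^sup>2) * ennreal ((cmod (\<Psi> (transpose (shearlet_matrix s a) *v \<xi>)))\<^sup>2) \<partial>lborel)"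
proof -
  let ?M = "shearlet_matrix s a :: real ^ 'm option ^ 'm option"
  let ?\<delta> = "dil_det TYPE('m) a"
  have pos: "?\<delta> > 0" using a by (rule dil_det_pos)
  have s: "sq_integrable lborel \<psi>" "sq_integrable lborel \<Psi>" using pair by (auto simp: fourier_pair_def)
  have fm: "f \<in> borel_measurable borel" and \<Psi>m: "\<Psi> \<in> borel_measurable borel" and \<psi>m: "\<psi> \<in> borel_measurable borel"
    using sq_integrable_measurable[OF f(2)] sq_integrable_measurable[OF s(1)] sq_integrable_measurable[OF s(2)] by auto
  note [measurable] = fm \<Psi>m \<psi>m matrix_mult_measurable
  define k where "k \<xi> = fourier_L1 f \<xi> * cnj (\<Psi> (transpose ?M *v \<xi>))" for \<xi>
  have [measurable]: "k \<in> borel_measurable borel" unfolding k_def[abs_def] by measurable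
  have \<Psi>M: "sq_integrable lborel (\<lambda>\<xi>. \<Psi> (transpose ?M *v \<xi>))"
  proof (rule sq_integrableI)
    show "integrable lborel (\<lambda>x. (cmod (\<Psi> (transpose ?M *v x)))\<^sup>2)"
      by (subst shearlet_matrix_subst(4)[OF a, of "\<lambda>x. (cmod (\<Psi> x))\<^sup>2"]) (auto intro: sq_integrableD s)
  qed measurable
  \<comment> \<open>\<open>k\<close> is a product of two square integrable functions. It is also
    square integrable, because the transform of the integrable \<open>f\<close> is bounded; hence
    Plancherel applies to \<open>k\<close> itself.\<close>
  have k1: "integrable lborel k"
    unfolding k_def by (intro sq_integrable_mult(1) plancherel_L1 f sq_integrable_cnj \<Psi>M)
  have k2: "sq_integrable lborel k"
    by (rule sq_integrable_bound[OF \<Psi>M, of _ "\<integral>x. norm (f x) \<partial>lborel"])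
       (auto simp: k_def norm_mult intro!: mult_right_mono norm_fourier_L1_le f)
  have sht: "sht \<psi> f a s t = complex_of_real (sqrt ?\<delta>) * fourier_L1 k (- t)" for t
  proof -
    define G where "G y = f (t + ?M *v y)" for y
    have [measurable]: "G \<in> borel_measurable borel" unfolding G_def[abs_def] by measurable
    have G1: "integrable lborel G"
      unfolding G_def using shearlet_matrix_subst(2)[OF a, of "\<lambda>x. f (t + x)"] lborel_integrable_translate[OF f(1)] by simp
    have G2: "sq_integrable lborel G"
    proof (rule sq_integrableI)
      show "integrable lborel (\<lambda>x. (cmod (G x))\<^sup>2)"
        unfolding G_def using shearlet_matrix_subst(2)[OF a, of "\<lambda>x. (cmod (f (t + x)))\<^sup>2"]
          sq_integrableD[OF sq_integrable_translate[OF f(2)]] by simp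
    qed simp
    \<comment> \<open>Substituting x = M y turns the frequency M^T \<xi> into \<xi>, and the
      translation by t becomes a character in which - t plays the role of a frequency for
      \<open>k\<close>.\<close>
    have FG: "?\<delta> *\<^sub>R fourier_L1 G (transpose ?M *v \<xi>) = fourier_char (- t) \<xi> * fourier_L1 f \<xi>" for \<xi>
    proof -
      have char: "fourier_char (transpose ?M *v \<xi>) y = fourier_char \<xi> (?M *v y)" for y
        by (simp add: fourier_char_def transpose_matrix_vector dot_lmul_matrix)
      have "?\<delta> *\<^sub>R fourier_L1 G (transpose ?M *v \<xi>) = ?\<delta> *\<^sub>R (\<integral>y. f (t + ?M *v y) * fourier_char \<xi> (?M *v y) \<partial>lborel)"
        by (subst fourier_L1_lborel) (simp_all only: G_def char, measurable)
      also have "\<dots> = (\<integral>x. f (t + x) * fourier_char \<xi> x \<partial>lborel)"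
        by (rule shearlet_matrix_subst(1)[OF a, symmetric]) measurable
      also have "\<dots> = fourier_L1 (\<lambda>x. f (t + x)) \<xi>"
        by (rule fourier_L1_lborel[symmetric]) measurable
      also have "\<dots> = fourier_char (- t) \<xi> * fourier_L1 f \<xi>"
        by (simp add: fourier_L1_translate[OF f(1)] fourier_char_commute)
      finally show ?thesis .
    qed
    have "(\<integral>y. G y * cnj (\<psi> y) \<partial>lborel) = (\<integral>\<eta>. fourier_L1 G \<eta> * cnj (\<Psi> \<eta>) \<partial>lborel)"
      by (rule parseval_pair[OF G1 G2 pair])
    also have "\<dots> = ?\<delta> *\<^sub>R (\<integral>\<xi>. fourier_L1 G (transpose ?M *v \<xi>) * cnj (\<Psi> (transpose ?M *v \<xi>)) \<partial>lborel)"
      by (rule shearlet_matrix_subst(3)[OF a]) measurable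
    also have "\<dots> = (\<integral>\<xi>. (?\<delta> *\<^sub>R fourier_L1 G (transpose ?M *v \<xi>)) * cnj (\<Psi> (transpose ?M *v \<xi>)) \<partial>lborel)"
      by (simp del: transpose_matrix_vector)
    also have "\<dots> = (\<integral>\<xi>. k \<xi> * fourier_char (- t) \<xi> \<partial>lborel)"
      unfolding FG k_def by (simp only: mult_ac)
    also have "\<dots> = fourier_L1 k (- t)"
      by (rule fourier_L1_lborel[symmetric]) simp
    finally show ?thesis by (simp add: sht_def G_def)
  qed
  have "(\<integral>\<^sup>+t. ennreal ((cmod (sht \<psi> f a s t))\<^sup>2) \<partial>lborel) = (\<integral>\<^sup>+t. ennreal ?\<delta> * ennreal ((cmod (fourier_L1 k (- t)))\<^sup>2) \<partial>lborel)"
    using pos by (simp add: sht norm_mult power_mult_distrib ennreal_mult)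
  also have "\<dots> = ennreal ?\<delta> * (\<integral>\<^sup>+t. ennreal ((cmod (fourier_L1 k (- t)))\<^sup>2) \<partial>lborel)"
    by (rule nn_integral_cmult) measurable
  also have "(\<integral>\<^sup>+t. ennreal ((cmod (fourier_L1 k (- t)))\<^sup>2) \<partial>lborel) = (\<integral>\<^sup>+t. ennreal ((cmod (fourier_L1 k t))\<^sup>2) \<partial>lborel)"
    using lborel_nn_integral_affine[of "\<lambda>t. ennreal ((cmod (fourier_L1 k t))\<^sup>2)" "-1" 0] by simp
  also have "\<dots> = (\<integral>\<^sup>+\<xi>. ennreal ((cmod (k \<xi>))\<^sup>2) \<partial>lborel)"
    by (simp only: nn_integral_l2[OF plancherel_L1(1)[OF k1 k2]] nn_integral_l2[OF k2] plancherel_L1(2)[OF k1 k2])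
  also have "\<dots> = (\<integral>\<^sup>+\<xi>. ennreal ((cmod (fourier_L1 f \<xi>))\<^sup>2) * ennreal ((cmod (\<Psi> (transpose ?M *v \<xi>)))\<^sup>2) \<partial>lborel)"
    by (simp add: k_def norm_mult power_mult_distrib ennreal_mult del: transpose_matrix_vector)
  finally show ?thesis .
qed

text \<open>Integrating the slices over a and s and moving the frequency outside leaves, for almost
  every frequency, the admissibility integral at that frequency, which is \<open>C\<close>. All
  integrands are nonnegative, so Tonelli applies throughout.\<close>

theorem sht_isometry:
  fixes \<psi> f :: "real ^ ('m::finite option) \<Rightarrow> complex"
  assumes pair: "fourier_pair \<psi> \<Psi>" and f: "integrable lborel f" "sq_integrable lborel f"
    and C: "radial_integral (\<lambda>x. ennreal ((cmod (\<Psi> x))\<^sup>2)) = C"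
  shows "(\<integral>\<^sup>+p. ennreal ((cmod (sht \<psi> f (fst p) (fst (snd p)) (snd (snd p))))\<^sup>2) * ennreal (1 / \<bar>fst p\<bar> ^ (CARD('m option) + 1)) \<partial>lborel)
    = C * ennreal ((l2 lborel f)\<^sup>2)"
proof -
  let ?n = "CARD('m option)"
  let ?p = "((real CARD('m option))\<^sup>2 - real CARD('m option) + 1) / real CARD('m option)"
  have s: "sq_integrable lborel \<psi>" "sq_integrable lborel \<Psi>" using pair by (auto simp: fourier_pair_def)
  have fm: "f \<in> borel_measurable borel" and \<Psi>m: "\<Psi> \<in> borel_measurable borel" and \<psi>m: "\<psi> \<in> borel_measurable borel"
    using sq_integrable_measurable[OF f(2)] sq_integrable_measurable[OF s(1)] sq_integrable_measurable[OF s(2)] by auto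
  note [measurable] = fm \<Psi>m \<psi>m
  define F where "F \<xi> = ennreal ((cmod (fourier_L1 f \<xi>))\<^sup>2)" for \<xi>
  define P where "P s a \<xi> = ennreal ((cmod (\<Psi> (transpose (shearlet_matrix s a) *v \<xi>)))\<^sup>2)" for s a \<xi>
  have [measurable]: "F \<in> borel_measurable borel" unfolding F_def[abs_def] by measurable
  have Pm [measurable (raw)]: "(\<lambda>x. P (h2 x) (h1 x) (h3 x)) \<in> borel_measurable M"
    if [measurable]: "h1 \<in> borel_measurable M" "h2 \<in> borel_measurable M" "h3 \<in> borel_measurable M" for h1 h2 h3 and M :: "'z measure"
    unfolding P_def by measurable
  define Q where "Q p = ennreal ((cmod (sht \<psi> f (fst p) (fst (snd p)) (snd (snd p))))\<^sup>2) * ennreal (1 / \<bar>fst p\<bar> ^ (?n + 1))"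
    for p :: "real \<times> (real ^ 'm) \<times> (real ^ 'm option)"
  have [measurable]: "Q \<in> borel_measurable borel" unfolding Q_def[abs_def] by measurable
  have "(\<integral>\<^sup>+p. Q p \<partial>lborel) = (\<integral>\<^sup>+a. \<integral>\<^sup>+q. Q (a, q) \<partial>lborel \<partial>lborel)"
    by (rule nn_integral_lborel_pair) simp
  also have "\<dots> = (\<integral>\<^sup>+a. \<integral>\<^sup>+s. \<integral>\<^sup>+t. Q (a, s, t) \<partial>lborel \<partial>lborel \<partial>lborel)"
    by (intro nn_integral_cong nn_integral_lborel_pair(1)) measurable
  also have "\<dots> = (\<integral>\<^sup>+a. \<integral>\<^sup>+s. \<integral>\<^sup>+t. ennreal ((cmod (sht \<psi> f a s t))\<^sup>2) * ennreal (1 / \<bar>a\<bar> ^ (?n + 1)) \<partial>lborel \<partial>lborel \<partial>lborel)"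
    by (simp only: Q_def fst_conv snd_conv)
  also have "\<dots> = (\<integral>\<^sup>+a. \<integral>\<^sup>+s. \<integral>\<^sup>+\<xi>. F \<xi> * (P s a \<xi> * ennreal (1 / \<bar>a\<bar> powr ?p)) \<partial>lborel \<partial>lborel \<partial>lborel)"
  proof (rule nn_integral_cong_AE)
    show "AE a in lborel. (\<integral>\<^sup>+s. \<integral>\<^sup>+t. ennreal ((cmod (sht \<psi> f a s t))\<^sup>2) * ennreal (1 / \<bar>a\<bar> ^ (?n + 1)) \<partial>lborel \<partial>lborel)
       = (\<integral>\<^sup>+s. \<integral>\<^sup>+\<xi>. F \<xi> * (P s a \<xi> * ennreal (1 / \<bar>a\<bar> powr ?p)) \<partial>lborel \<partial>lborel)"
      using AE_lborel_singleton[of "0::real"]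
    proof eventually_elim
      case (elim a)
      show ?case
      proof (rule nn_integral_cong)
        fix s :: "real ^ 'm"
        \<comment> \<open>The determinant from the slice formula meets the weight of the parameter
          measure; by \<open>dil_power\<close> their product is the weight of the admissibility
          integral.\<close>
        have w: "ennreal (dil_det TYPE('m) a) * ennreal (1 / \<bar>a\<bar> ^ (?n + 1)) = ennreal (1 / \<bar>a\<bar> powr ?p)"
        proof -
          have "dil_det TYPE('m) a * (1 / \<bar>a\<bar> ^ (?n + 1)) = \<bar>dil TYPE('m) a\<bar> ^ CARD('m) / \<bar>a\<bar> ^ ?n"
            using elim unfolding dil_det_def power_add by (simp del: card_UNIV_option power_Suc add: field_simps)
          also have "\<dots> = 1 / \<bar>a\<bar> powr ?p"
            unfolding dil_power[OF elim, symmetric] using elim by simp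
          finally show ?thesis
            using dil_det_pos[OF elim, where 'm = 'm] by (simp only: ennreal_mult[symmetric] less_imp_le zero_le_divide_iff zero_le_power abs_ge_zero zero_le_one simp_thms)
        qed
        have "(\<integral>\<^sup>+t. ennreal ((cmod (sht \<psi> f a s t))\<^sup>2) * ennreal (1 / \<bar>a\<bar> ^ (?n + 1)) \<partial>lborel)
          = (\<integral>\<^sup>+t. ennreal ((cmod (sht \<psi> f a s t))\<^sup>2) \<partial>lborel) * ennreal (1 / \<bar>a\<bar> ^ (?n + 1))"
          by (rule nn_integral_multc) measurable
        also have "\<dots> = ennreal (1 / \<bar>a\<bar> powr ?p) * (\<integral>\<^sup>+\<xi>. F \<xi> * P s a \<xi> \<partial>lborel)"
          unfolding sht_slice[OF pair f elim] w[symmetric] F_def P_def by (simp only: mult_ac)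
        also have "\<dots> = (\<integral>\<^sup>+\<xi>. ennreal (1 / \<bar>a\<bar> powr ?p) * (F \<xi> * P s a \<xi>) \<partial>lborel)"
          by (rule nn_integral_cmult[symmetric]) measurable
        finally show "(\<integral>\<^sup>+t. ennreal ((cmod (sht \<psi> f a s t))\<^sup>2) * ennreal (1 / \<bar>a\<bar> ^ (?n + 1)) \<partial>lborel)
          = (\<integral>\<^sup>+\<xi>. F \<xi> * (P s a \<xi> * ennreal (1 / \<bar>a\<bar> powr ?p)) \<partial>lborel)"
          by (simp only: mult_ac)
      qed
    qed
  qed
  \<comment> \<open>Three exchanges bring the frequency outside and put s before a, as in the
    admissibility integral.\<close>
  also have "\<dots> = (\<integral>\<^sup>+a. \<integral>\<^sup>+\<xi>. \<integral>\<^sup>+s. F \<xi> * (P s a \<xi> * ennreal (1 / \<bar>a\<bar> powr ?p)) \<partial>lborel \<partial>lborel \<partial>lborel)"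
    by (intro nn_integral_cong lborel_pair.Fubini') measurable
  also have "\<dots> = (\<integral>\<^sup>+\<xi>. \<integral>\<^sup>+a. \<integral>\<^sup>+s. F \<xi> * (P s a \<xi> * ennreal (1 / \<bar>a\<bar> powr ?p)) \<partial>lborel \<partial>lborel \<partial>lborel)"
    by (intro lborel_pair.Fubini') measurable
  also have "\<dots> = (\<integral>\<^sup>+\<xi>. \<integral>\<^sup>+s. \<integral>\<^sup>+a. F \<xi> * (P s a \<xi> * ennreal (1 / \<bar>a\<bar> powr ?p)) \<partial>lborel \<partial>lborel \<partial>lborel)"
    by (intro nn_integral_cong lborel_pair.Fubini') measurable
  also have "\<dots> = (\<integral>\<^sup>+\<xi>. F \<xi> * (\<integral>\<^sup>+s. \<integral>\<^sup>+a. P s a \<xi> * ennreal (1 / \<bar>a\<bar> powr ?p) \<partial>lborel \<partial>lborel) \<partial>lborel)"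
    by (simp add: nn_integral_cmult)
  also have "\<dots> = (\<integral>\<^sup>+\<xi>. F \<xi> * C \<partial>lborel)"
  proof (rule nn_integral_cong_AE)
    \<comment> \<open>The substitution formula covers frequencies with nonzero first coordinate, so
      the hyperplane where it vanishes has to be null.\<close>
    let ?S = "{\<xi> :: real ^ 'm option. \<xi> $ None = 0}"
    have [measurable]: "?S \<in> sets borel" by measurable
    have S: "indicator ?S (vcons u v) = (indicator {0} u :: ennreal)" for u and v :: "real ^ 'm"
      by (simp add: indicator_def)
    have 0: "(\<integral>\<^sup>+u. indicator {0::real} u \<partial>lborel) = 0"
      by (subst nn_integral_indicator) auto
    have "(\<integral>\<^sup>+\<xi>. indicator ?S \<xi> \<partial>lborel) = (\<integral>\<^sup>+v. \<integral>\<^sup>+u. indicator ?S (vcons u v) \<partial>lborel \<partial>(lborel :: (real ^ 'm) measure))"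
      by (rule nn_integral_vcons) measurable
    also have "\<dots> = 0" unfolding S 0 by simp
    finally have "AE \<xi> in lborel. (\<xi> :: real ^ 'm option) $ None \<noteq> 0"
      by (subst (asm) nn_integral_0_iff_AE) (auto simp: indicator_eq_0_iff elim!: eventually_mono)
    then show "AE \<xi> in lborel. F \<xi> * (\<integral>\<^sup>+s. \<integral>\<^sup>+a. P s a \<xi> * ennreal (1 / \<bar>a\<bar> powr ?p) \<partial>lborel \<partial>lborel) = F \<xi> * C"
    proof eventually_elim
      case (elim \<xi>)
      have "(\<integral>\<^sup>+s. \<integral>\<^sup>+a. P s a \<xi> * ennreal (1 / \<bar>a\<bar> powr ?p) \<partial>lborel \<partial>lborel) = C"
        unfolding P_def C[symmetric] by (rule admissibility_substitution[OF _ elim]) measurable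
      then show ?case by simp
    qed
  qed
  also have "\<dots> = (\<integral>\<^sup>+\<xi>. F \<xi> \<partial>lborel) * C"
    by (rule nn_integral_multc) measurable
  also have "(\<integral>\<^sup>+\<xi>. F \<xi> \<partial>lborel) = ennreal ((l2 lborel f)\<^sup>2)"
    unfolding F_def nn_integral_l2[OF plancherel_L1(1)[OF f]] plancherel_L1(2)[OF f] ..
  finally show ?thesis by (simp only: Q_def mult.commute)
qed

subsection \<open>Test functions\<close>

text \<open>This class contains the standard bump function (\<open>p = 1\<close>, \<open>m = 0\<close>) and is closed under differentiation.\<close>

definition bump :: "complex poly \<Rightarrow> nat \<Rightarrow> real \<Rightarrow> complex" where
  "bump p m u = (if \<bar>u\<bar> < 1
     then poly p (complex_of_real u) * complex_of_real (exp (1 - 1 / (1 - u\<^sup>2)) / (1 - u\<^sup>2) ^ m) else 0)"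

lemma power_le_fact_exp: "0 \<le> y \<Longrightarrow> y ^ k \<le> fact k * exp (y::real)"
proof -
  assume y: "0 \<le> y"
  have "(\<Sum>n\<in>{k}. y ^ n /\<^sub>R fact n) \<le> (\<Sum>n. y ^ n /\<^sub>R fact n)"
    by (rule sum_le_suminf) (use y summable_exp_generic[of y] in auto)
  then show ?thesis by (simp add: exp_def field_simps)
qed

text \<open>The exponential beats every negative power of 1 - u^2. Asking for two powers more than m
  gives vanishing to second order at u = 1 and u = -1, which forces the derivative there to be
  0.\<close>

lemma bump_quadratic_bound: "\<exists>K\<ge>0. \<forall>u. cmod (bump p m u) \<le> K * \<bar>1 - u\<^sup>2\<bar>\<^sup>2"
proof -
  have "compact ((\<lambda>u. poly p (complex_of_real u)) ` {-1..1})"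
    by (intro compact_continuous_image continuous_intros) auto
  then have "bounded ((\<lambda>u. poly p (complex_of_real u)) ` {-1..1})"
    by (rule compact_imp_bounded)
  then obtain B where B: "\<And>u. u \<in> {-1..1} \<Longrightarrow> cmod (poly p (complex_of_real u)) \<le> B"
    unfolding bounded_iff by blast
  have B0: "0 \<le> B" using order_trans[OF norm_ge_zero B[of 0]] by simp
  let ?K = "B * (exp 1 * fact (m + 2))"
  have "cmod (bump p m u) \<le> ?K * \<bar>1 - u\<^sup>2\<bar>\<^sup>2" for u
  proof (cases "\<bar>u\<bar> < 1")
    case True
    define v where "v = 1 - u\<^sup>2"
    have v: "0 < v" using True by (simp add: v_def abs_square_less_1)
    have "(1 / v) ^ (m + 2) \<le> fact (m + 2) * exp (1 / v)"
      using v by (intro power_le_fact_exp) auto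
    then have "(1 / v) ^ (m + 2) * exp (- (1 / v)) \<le> fact (m + 2) * exp (1 / v) * exp (- (1 / v))"
      by (intro mult_right_mono) auto
    then have *: "(1 / v) ^ (m + 2) * exp (- (1 / v)) \<le> fact (m + 2)"
      by (simp add: mult.assoc exp_add[symmetric])
    have "exp (1 - 1 / v) = exp 1 * exp (- (1 / v))"
      unfolding exp_add[symmetric] by simp
    then have "exp (1 - 1 / v) / v ^ m = exp 1 * ((1 / v) ^ (m + 2) * exp (- (1 / v))) * v\<^sup>2"
      using v by (simp add: power_divide power2_eq_square)
    also have "\<dots> \<le> exp 1 * fact (m + 2) * v\<^sup>2"
      using * by (intro mult_right_mono mult_left_mono) auto
    finally have E: "exp (1 - 1 / v) / v ^ m \<le> exp 1 * fact (m + 2) * v\<^sup>2" .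
    have "cmod (bump p m u) = cmod (poly p (complex_of_real u)) * (exp (1 - 1 / v) / v ^ m)"
      using True v by (simp add: bump_def norm_mult norm_divide norm_power v_def[symmetric] del: of_real_divide of_real_power)
    also have "\<dots> \<le> B * (exp 1 * fact (m + 2) * v\<^sup>2)"
      using True v E B0 by (intro mult_mono B) auto
    finally show ?thesis by (simp add: v_def mult.assoc)
  qed (use B0 in \<open>auto simp: bump_def\<close>)
  moreover have "0 \<le> ?K" using B0 by simp
  ultimately show ?thesis by blast
qed

text \<open>The numerator of the derivative over the common denominator (1 - u^2)^(m + 2);
  \<open>[:1, 0, -1:]\<close> stands for 1 - u^2 and \<open>[:0, 2:]\<close> for 2 u.\<close>

definition bump_deriv :: "complex poly \<Rightarrow> nat \<Rightarrow> complex poly" where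
  "bump_deriv p m = pderiv p * [:1, 0, -1:]\<^sup>2 + smult (of_nat m) ([:0, 2:] * p * [:1, 0, -1:]) - [:0, 2:] * p"

lemma bump_has_vector_derivative:
  "(bump p m has_vector_derivative bump (bump_deriv p m) (m + 2) u) (at u)"
proof -
  consider "\<bar>u\<bar> < 1" | "\<bar>u\<bar> > 1" | "\<bar>u\<bar> = 1" by linarith
  then show ?thesis
  proof cases
    case 1
    define v where "v = 1 - u\<^sup>2"
    have v: "0 < v" using 1 by (simp add: v_def abs_square_less_1)
    define e where "e = exp (1 - 1 / v)"
    have 2: "((\<lambda>x. exp (1 - 1 / (1 - x\<^sup>2)) / (1 - x\<^sup>2) ^ m) has_real_derivative
        ((real m * 2 * u * v - 2 * u) * (e / v ^ (m + 2)))) (at u)"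
    proof -
      have d: "((\<lambda>x. exp (1 - 1 / (1 - x\<^sup>2))) has_real_derivative e * (- (2 * u) / v\<^sup>2)) (at u)"
        using v unfolding e_def v_def
        by (auto intro!: derivative_eq_intros simp: power2_eq_square field_simps)
      have d2: "((\<lambda>x. (1 - x\<^sup>2) ^ m) has_real_derivative real m * v ^ (m - 1) * (- (2 * u))) (at u)"
        unfolding v_def by (auto intro!: derivative_eq_intros)
      have vm: "(1 - u\<^sup>2) ^ m \<noteq> 0" using v by (simp add: v_def)
      have "((\<lambda>x. exp (1 - 1 / (1 - x\<^sup>2)) / (1 - x\<^sup>2) ^ m) has_real_derivative
         (e * (- (2 * u) / v\<^sup>2) * v ^ m - e * (real m * v ^ (m - 1) * (- (2 * u)))) / (v ^ m * v ^ m)) (at u)"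
        using DERIV_divide[OF d d2 vm] unfolding e_def v_def .
      also have "(e * (- (2 * u) / v\<^sup>2) * v ^ m - e * (real m * v ^ (m - 1) * (- (2 * u)))) / (v ^ m * v ^ m)
        = (real m * 2 * u * v - 2 * u) * (e / v ^ (m + 2))"
      proof (cases m)
        case 0
        then show ?thesis using v by (simp add: field_simps power2_eq_square)
      next
        case (Suc k)
        then show ?thesis using v by (simp add: field_simps power2_eq_square)
      qed
      finally show ?thesis .
    qed
    have 3: "((\<lambda>x. poly p (complex_of_real x)) has_vector_derivative poly (pderiv p) (complex_of_real u)) (at u)"
      using has_vector_derivative_real_field[OF poly_DERIV[of p "complex_of_real u"]] by simp
    have 4: "((\<lambda>x. complex_of_real (exp (1 - 1 / (1 - x\<^sup>2)) / (1 - x\<^sup>2) ^ m)) has_vector_derivative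
        complex_of_real ((real m * 2 * u * v - 2 * u) * (e / v ^ (m + 2)))) (at u)"
      using has_vector_derivative_of_real[OF 2] .
    let ?c = "complex_of_real"
    have eq: "poly p (?c u) * ?c ((real m * 2 * u * v - 2 * u) * (e / v ^ (m + 2))) + poly (pderiv p) (?c u) * ?c (exp (1 - 1 / (1 - u\<^sup>2)) / (1 - u\<^sup>2) ^ m)
       = bump (bump_deriv p m) (m + 2) u"
    proof -
      have "exp (1 - 1 / (1 - u\<^sup>2)) / (1 - u\<^sup>2) ^ m = v\<^sup>2 * (e / v ^ (m + 2))"
        unfolding e_def v_def[symmetric] using v by (simp add: power2_eq_square)
      moreover have "?c v = 1 - (?c u)\<^sup>2" by (simp add: v_def)
      moreover have "bump (bump_deriv p m) (m + 2) u = poly (bump_deriv p m) (?c u) * ?c (e / v ^ (m + 2))"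
        using 1 by (simp only: bump_def e_def v_def if_True)
      moreover have "poly (bump_deriv p m) (?c u) = poly (pderiv p) (?c u) * (?c v)\<^sup>2 + (of_nat m * 2 * ?c u * ?c v - 2 * ?c u) * poly p (?c u)"
        unfolding calculation(2) bump_deriv_def by (simp add: algebra_simps power2_eq_square)
      ultimately show ?thesis
        by (simp only: of_real_mult of_real_diff of_real_power of_real_of_nat_eq of_real_numeral) (simp only: ring_distribs mult_ac add.commute)
    qed
    have "((\<lambda>x. poly p (complex_of_real x) * complex_of_real (exp (1 - 1 / (1 - x\<^sup>2)) / (1 - x\<^sup>2) ^ m)) has_vector_derivative
        bump (bump_deriv p m) (m + 2) u) (at u)"
      using has_vector_derivative_mult[OF 3 4] unfolding v_def[symmetric] e_def[symmetric] eq[unfolded v_def[symmetric] e_def[symmetric]] .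
    then show ?thesis
    proof (rule has_vector_derivative_transform_within_open[of _ _ _ "{-1<..<1}"])
      show "u \<in> {-1<..<1}" using 1 by auto
    qed (auto simp: bump_def)
  next
    case 2
    have "((\<lambda>_. 0) has_vector_derivative bump (bump_deriv p m) (m + 2) u) (at u)"
      using 2 by (simp add: bump_def)
    then show ?thesis
    proof (rule has_vector_derivative_transform_within_open[of _ _ _ "- {-1..1}"])
      show "u \<in> - {-1..1}" using 2 by auto
      show "\<And>x. x \<in> - {-1..1} \<Longrightarrow> 0 = bump p m x" by (auto simp: bump_def)
    qed (simp add: open_Compl)
  next
    case 3
    obtain K where K: "0 \<le> K" "\<And>u. cmod (bump p m u) \<le> K * \<bar>1 - u\<^sup>2\<bar>\<^sup>2"
      using bump_quadratic_bound by blast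
    have u2: "u\<^sup>2 = 1" using 3 by (simp add: abs_square_eq_1)
    have z: "bump (bump_deriv p m) (m + 2) u = 0" "bump p m u = 0" using 3 by (simp_all add: bump_def)
    show ?thesis
      unfolding has_vector_derivative_def z
    proof (rule has_derivativeI_sandwich[of 1])
      show "((\<lambda>y. 9 * K * \<bar>y - u\<bar>) \<longlongrightarrow> 0) (at u)"
        by (auto intro!: tendsto_eq_intros)
      fix y assume y: "y \<noteq> u" "dist y u < 1"
      \<comment> \<open>As u^2 = 1, the difference 1 - y^2 factors as (u - y)(u + y), and within
        distance 1 of u the second factor is at most 3 in modulus; squaring gives the constant
        9.\<close>
      have "\<bar>1 - y\<^sup>2\<bar> = \<bar>u - y\<bar> * \<bar>u + y\<bar>"
        unfolding u2[symmetric] by (simp add: abs_mult[symmetric] power2_eq_square algebra_simps)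
      also have "\<bar>u + y\<bar> \<le> 3" using y 3 by (auto simp: dist_real_def)
      finally have "\<bar>1 - y\<^sup>2\<bar> \<le> 3 * \<bar>y - u\<bar>" by (simp add: mult_left_mono abs_minus_commute)
      then have "\<bar>1 - y\<^sup>2\<bar>\<^sup>2 \<le> (3 * \<bar>y - u\<bar>)\<^sup>2" by (intro power_mono) auto
      then have "cmod (bump p m y) \<le> K * (3 * \<bar>y - u\<bar>)\<^sup>2"
        using K(2)[of y] mult_left_mono[OF _ K(1)] order_trans by blast
      also have "\<dots> = 9 * K * \<bar>y - u\<bar> * \<bar>y - u\<bar>"
        by (simp add: power2_eq_square)
      finally show "norm (bump p m y - bump p m u - (y - u) *\<^sub>R 0) / norm (y - u) \<le> 9 * K * \<bar>y - u\<bar>"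
        using y z by (simp add: divide_le_eq)
    qed auto
  qed
qed

lemma bump_continuous: "continuous_on UNIV (bump p m)"
  using bump_has_vector_derivative[THEN has_vector_derivative_continuous]
  by (simp add: continuous_on_eq_continuous_at)

lemma bump_bounded: "\<exists>B. \<forall>u. cmod (bump p m u) \<le> B"
proof -
  obtain K where K: "0 \<le> K" "\<And>u. cmod (bump p m u) \<le> K * \<bar>1 - u\<^sup>2\<bar>\<^sup>2"
    using bump_quadratic_bound by blast
  have "cmod (bump p m u) \<le> K" for u
  proof (cases "\<bar>u\<bar> < 1")
    case True
    then have "\<bar>1 - u\<^sup>2\<bar> \<le> 1" by (simp add: abs_square_less_1 less_imp_le abs_le_iff)
    then have "\<bar>1 - u\<^sup>2\<bar>\<^sup>2 \<le> 1" by (rule power_le_one[OF abs_ge_zero])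
    then have "K * \<bar>1 - u\<^sup>2\<bar>\<^sup>2 \<le> K * 1" using K(1) by (rule mult_left_mono)
    with K(2)[of u] show ?thesis by simp
  qed (use K in \<open>simp add: bump_def\<close>)
  then show ?thesis by blast
qed

section \<open>Real test functions from windowed plane waves\<close>

text \<open>A window of half-width R times a plane wave of frequency \<omega>. Leaving
  \<open>p\<close> and \<open>m\<close> free makes the class closed under differentiation while R
  and \<omega> stay fixed.\<close>

definition wave_bumps :: "real \<Rightarrow> real \<Rightarrow> (real \<Rightarrow> complex) set" where
  "wave_bumps R \<omega> = {\<lambda>x. bump p m (x / R) * cis (\<omega> * x) | p m. True}"

lemma wave_bump_deriv:
  assumes "R > 0"
  shows "((\<lambda>x. bump p m (x / R) * cis (\<omega> * x)) has_vector_derivative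
     (bump (bump_deriv p m) (m + 2) (x / R) / R + \<i> * \<omega> * bump p m (x / R)) * cis (\<omega> * x)) (at x)"
proof -
  have "((\<lambda>x. x / R) has_vector_derivative 1 / R) (at x)"
    using assms by (auto intro!: derivative_eq_intros simp: has_real_derivative_iff_has_vector_derivative[symmetric])
  from vector_diff_chain_at[OF this bump_has_vector_derivative]
  have 1: "((\<lambda>x. bump p m (x / R)) has_vector_derivative (1 / R) *\<^sub>R bump (bump_deriv p m) (m + 2) (x / R)) (at x)"
    by (simp add: o_def)
  have "((\<lambda>x. cis (\<omega> * x)) has_vector_derivative \<omega> *\<^sub>R (\<i> * cis (\<omega> * x))) (at x)"
  proof -
    have "((\<lambda>x. \<omega> * x) has_vector_derivative \<omega>) (at x)"
      by (auto intro!: derivative_eq_intros simp: has_real_derivative_iff_has_vector_derivative[symmetric])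
    moreover have "(cis has_vector_derivative \<i> * cis y) (at y)" for y
    proof -
      have "((\<lambda>y. exp (\<i> * complex_of_real y)) has_vector_derivative \<i> * exp (\<i> * complex_of_real y)) (at y)"
        by (rule has_vector_derivative_real_field) (auto intro!: derivative_eq_intros)
      then show ?thesis by (simp add: cis_conv_exp[abs_def])
    qed
    ultimately show ?thesis
      using vector_diff_chain_at[of "\<lambda>x. \<omega> * x" \<omega> x cis] by (simp add: o_def)
  qed
  from has_vector_derivative_mult[OF 1 this] show ?thesis
    by (simp add: scaleR_conv_of_real algebra_simps)
qed

text \<open>The derivative of a windowed wave has one term with exponent m + 2 and one with m.
  Raising the second to m + 2 lets both be added within a single \<open>bump\<close>.\<close>

lemma bump_raise: "bump (p * [:1, 0, -1:] ^ 2) (m + 2) u = bump p m u"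
proof (cases "\<bar>u\<bar> < 1")
  case True
  then have "1 - u\<^sup>2 \<noteq> 0" by (simp add: abs_square_less_1 less_imp_neq)
  moreover have "poly [:1, 0, -1:] (complex_of_real u) = complex_of_real (1 - u\<^sup>2)"
    by (simp add: power2_eq_square)
  moreover have "e * v\<^sup>2 * (E / (v ^ (m + 2))) = e * (E / v ^ m)" if "v \<noteq> 0" for e v E :: complex
    using that by (simp add: power2_eq_square)
  ultimately show ?thesis
    using True unfolding bump_def poly_mult poly_power of_real_divide of_real_power
    by (simp only: if_True of_real_eq_0_iff not_False_eq_True)
qed (simp add: bump_def)

lemma bump_linear: "bump (smult a p + smult b q) m u = a * bump p m u + b * bump q m u"
  by (simp add: bump_def ring_distribs mult.assoc del: of_real_divide of_real_power)

lemma wave_bumps_closed: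
  assumes "\<beta> \<in> wave_bumps R \<omega>" "R > 0"
  shows "\<exists>\<beta>'\<in>wave_bumps R \<omega>. \<forall>x. (\<beta> has_vector_derivative \<beta>' x) (at x)"
proof -
  obtain p m where \<beta>: "\<beta> = (\<lambda>x. bump p m (x / R) * cis (\<omega> * x))"
    using assms(1) by (auto simp: wave_bumps_def)
  let ?q = "smult (1 / complex_of_real R) (bump_deriv p m) + smult (\<i> * complex_of_real \<omega>) (p * [:1, 0, -1:] ^ 2)"
  have "bump (bump_deriv p m) (m + 2) (x / R) / R + \<i> * \<omega> * bump p m (x / R) = bump ?q (m + 2) (x / R)" for x
    by (simp only: bump_linear bump_raise) simp
  then have "\<forall>x. (\<beta> has_vector_derivative bump ?q (m + 2) (x / R) * cis (\<omega> * x)) (at x)"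
    unfolding \<beta> using wave_bump_deriv[OF assms(2), of p m \<omega>] by simp
  then show ?thesis
    by (intro bexI[where x = "\<lambda>x. bump ?q (m + 2) (x / R) * cis (\<omega> * x)"]) (auto simp: wave_bumps_def)
qed

text \<open>Test functions are real, so the real part is taken, but only after the product: a
  partial derivative then changes a single complex factor and stays in the class.\<close>

definition product_waves :: "real \<Rightarrow> ('k \<Rightarrow> real) \<Rightarrow> (real ^ 'k::finite \<Rightarrow> real) set" where
  "product_waves R \<omega> = {\<lambda>x. Re (\<Prod>j\<in>UNIV. \<beta> j (x $ j)) | \<beta>. \<forall>j. \<beta> j \<in> wave_bumps R (\<omega> j)}"

lemma product_has_derivative:
  fixes \<beta> \<beta>' :: "'k::finite \<Rightarrow> real \<Rightarrow> complex"
  assumes "\<And>j y. (\<beta> j has_vector_derivative \<beta>' j y) (at y)"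
  shows "((\<lambda>x. Re (\<Prod>j\<in>UNIV. \<beta> j (x $ j))) has_derivative
    (\<lambda>h. Re (\<Sum>i\<in>UNIV. (h $ i *\<^sub>R \<beta>' i (x $ i)) * (\<Prod>j\<in>UNIV - {i}. \<beta> j (x $ j))))) (at x)"
proof -
  have 1: "((\<lambda>x. \<beta> j (x $ j)) has_derivative (\<lambda>h. h $ j *\<^sub>R \<beta>' j (x $ j))) (at x)" for j
  proof -
    have "((\<lambda>x. x $ j) has_derivative (\<lambda>h. h $ j)) (at x)"
      by (rule bounded_linear_imp_has_derivative) (rule bounded_linear_vec_nth)
    from has_derivative_compose[OF this assms[of j "x $ j", unfolded has_vector_derivative_def]]
    show ?thesis by simp
  qed
  show ?thesis
    by (intro has_derivative_Re has_derivative_prod 1)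
qed

lemma partial_deriv_product:
  fixes \<beta> \<beta>' :: "'k::finite \<Rightarrow> real \<Rightarrow> complex"
  assumes "\<And>j y. (\<beta> j has_vector_derivative \<beta>' j y) (at y)"
  shows "partial_deriv k (\<lambda>x. Re (\<Prod>j\<in>UNIV. \<beta> j (x $ j))) = (\<lambda>x. Re (\<Prod>j\<in>UNIV. (\<beta>(k := \<beta>' k)) j (x $ j)))"
proof
  fix x :: "real ^ 'k"
  have "partial_deriv k (\<lambda>x. Re (\<Prod>j\<in>UNIV. \<beta> j (x $ j))) x
     = Re (\<Sum>i\<in>UNIV. ((axis k 1 :: real ^ 'k) $ i *\<^sub>R \<beta>' i (x $ i)) * (\<Prod>j\<in>UNIV - {i}. \<beta> j (x $ j)))"
    unfolding partial_deriv_def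
    by (subst frechet_derivative_at[OF product_has_derivative[OF assms], symmetric]) (rule refl)
  also have "(\<Sum>i\<in>UNIV. ((axis k 1 :: real ^ 'k) $ i *\<^sub>R \<beta>' i (x $ i)) * (\<Prod>j\<in>UNIV - {i}. \<beta> j (x $ j)))
     = (\<Sum>i\<in>UNIV. if i = k then \<beta>' i (x $ i) * (\<Prod>j\<in>UNIV - {i}. \<beta> j (x $ j)) else 0)"
    by (intro sum.cong) (auto simp: axis_def)
  also have "\<dots> = \<beta>' k (x $ k) * (\<Prod>j\<in>UNIV - {k}. \<beta> j (x $ j))"
    by (simp add: sum.delta)
  also have "\<dots> = (\<beta>(k := \<beta>' k)) k (x $ k) * (\<Prod>j\<in>UNIV - {k}. (\<beta>(k := \<beta>' k)) j (x $ j))"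
    by (auto intro!: arg_cong2[where f = "(*)"] prod.cong)
  also have "\<dots> = (\<Prod>j\<in>UNIV. (\<beta>(k := \<beta>' k)) j (x $ j))"
    by (rule prod.remove[symmetric]) auto
  finally show "partial_deriv k (\<lambda>x. Re (\<Prod>j\<in>UNIV. \<beta> j (x $ j))) x = Re (\<Prod>j\<in>UNIV. (\<beta>(k := \<beta>' k)) j (x $ j))" .
qed

lemma product_waves_closed:
  assumes "\<phi> \<in> product_waves R \<omega>" "R > 0"
  shows "partial_deriv k \<phi> \<in> product_waves R \<omega>" "\<phi> differentiable_on UNIV"
proof -
  obtain \<beta> where \<phi>: "\<phi> = (\<lambda>x. Re (\<Prod>j\<in>UNIV. \<beta> j (x $ j)))" and \<beta>: "\<And>j. \<beta> j \<in> wave_bumps R (\<omega> j)"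
    using assms(1) by (auto simp: product_waves_def)
  have "\<forall>j. \<exists>\<beta>'. \<beta>' \<in> wave_bumps R (\<omega> j) \<and> (\<forall>y. (\<beta> j has_vector_derivative \<beta>' y) (at y))"
    using wave_bumps_closed[OF \<beta> assms(2)] by blast
  then obtain \<beta>' where \<beta>': "\<And>j. \<beta>' j \<in> wave_bumps R (\<omega> j)" "\<And>j y. (\<beta> j has_vector_derivative \<beta>' j y) (at y)"
    by metis
  have "\<forall>j. (\<beta>(k := \<beta>' k)) j \<in> wave_bumps R (\<omega> j)" using \<beta> \<beta>'(1) by simp
  then show "partial_deriv k \<phi> \<in> product_waves R \<omega>"
    unfolding \<phi> partial_deriv_product[OF \<beta>'(2)] product_waves_def by blast
  show "\<phi> differentiable_on UNIV"
    unfolding \<phi> differentiable_on_def differentiable_def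
  proof
    fix x :: "real ^ 'a"
    show "\<exists>D. ((\<lambda>x. Re (\<Prod>j\<in>UNIV. \<beta> j (x $ j))) has_derivative D) (at x)"
      by (rule exI, rule product_has_derivative[of \<beta> \<beta>']) (rule \<beta>'(2))
  qed
qed

text \<open>The class consists of differentiable functions and is stable under
  \<open>partial_deriv\<close>, so induction over the list of directions gives smoothness.\<close>

lemma product_waves_test_function:
  assumes "\<phi> \<in> product_waves R \<omega>" "R > 0"
  shows "test_function \<phi>"
  unfolding test_function_def
proof (intro conjI allI)
  fix ks
  have "foldr partial_deriv ks \<phi> \<in> product_waves R \<omega>"
    by (induction ks) (use assms product_waves_closed in auto)
  then show "foldr partial_deriv ks \<phi> differentiable_on UNIV"
    using product_waves_closed(2) assms(2) by blast
next
  obtain \<beta> where \<phi>: "\<phi> = (\<lambda>x. Re (\<Prod>j\<in>UNIV. \<beta> j (x $ j)))" and \<beta>: "\<And>j. \<beta> j \<in> wave_bumps R (\<omega> j)"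
    using assms(1) by (auto simp: product_waves_def)
  have "{x. \<phi> x \<noteq> 0} \<subseteq> cbox (\<chi> i. - R) (\<chi> i. R)"
  proof
    fix x assume "x \<in> {x. \<phi> x \<noteq> 0}"
    then have "(\<Prod>j\<in>UNIV. \<beta> j (x $ j)) \<noteq> 0" unfolding \<phi> mem_Collect_eq by (metis zero_complex.sel(1))
    then have "\<beta> j (x $ j) \<noteq> 0" for j by simp
    moreover have "\<beta> j (x $ j) = 0" if "\<bar>x $ j\<bar> > R" for j
    proof -
      obtain p m where "\<beta> j = (\<lambda>x. bump p m (x / R) * cis (\<omega> j * x))"
        using \<beta>[of j] by (auto simp: wave_bumps_def)
      then show ?thesis using that assms(2) by (simp add: bump_def divide_less_eq)
    qed
    ultimately have "\<bar>x $ j\<bar> \<le> R" for j by (meson not_le)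
    then show "x \<in> cbox (\<chi> i. - R) (\<chi> i. R)"
      by (simp add: mem_box_cart abs_le_iff minus_le_iff)
  qed
  then have "bounded {x. \<phi> x \<noteq> 0}" using bounded_cbox bounded_subset by blast
  then show "compact (closure {x. \<phi> x \<noteq> 0})" by (simp add: compact_closure)
qed

subsection \<open>Weak derivatives on the Fourier side\<close>

text \<open>The 1 in the exponent of \<open>bump\<close> normalises the value at 0 to 1. Hence
  \<open>bump [:1:] 0\<close> is a window bounded by 1 whose dilates tend to 1.\<close>

lemma cutoff_le_1: "cmod (bump [:1:] 0 u) \<le> 1"
proof (cases "\<bar>u\<bar> < 1")
  case True
  then have "0 < 1 - u\<^sup>2" "1 - u\<^sup>2 \<le> 1" by (simp_all add: abs_square_less_1)
  then have "1 \<le> 1 / (1 - u\<^sup>2)" by (simp add: le_divide_eq_1)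
  then show ?thesis using True by (simp add: bump_def)
qed (simp add: bump_def)

lemma cutoff_0: "bump [:1:] 0 0 = 1"
  by (simp add: bump_def)

definition wave :: "real \<Rightarrow> real \<Rightarrow> real \<Rightarrow> complex" where
  "wave R \<omega> y = bump [:1:] 0 (y / R) * cis (\<omega> * y)"

text \<open>The derivative of \<open>wave\<close>, with \<open>0 + 2\<close> left as it arises from
  \<open>wave_bump_deriv\<close> at m = 0.\<close>

definition wave' :: "real \<Rightarrow> real \<Rightarrow> real \<Rightarrow> complex" where
  "wave' R \<omega> y = (bump (bump_deriv [:1:] 0) (0 + 2) (y / R) / R + \<i> * \<omega> * bump [:1:] 0 (y / R)) * cis (\<omega> * y)"

lemma wave_has_derivative:
  "R > 0 \<Longrightarrow> (wave R \<omega> has_vector_derivative wave' R \<omega> y) (at y)"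
  unfolding wave_def[abs_def] wave'_def by (rule wave_bump_deriv)

lemma wave_in_wave_bumps: "(\<lambda>y. c * wave R \<omega> y) \<in> wave_bumps R \<omega>"
proof -
  have "c * wave R \<omega> y = bump [:c:] 0 (y / R) * cis (\<omega> * y)" for y
    by (simp add: wave_def bump_def)
  then show ?thesis unfolding wave_bumps_def by auto
qed

text \<open>The constant \<open>c\<close> is absorbed into the factor with index \<open>k\<close>.
  Its values 1 and - \<i> give the real and the imaginary part of a windowed plane wave as real test
  functions.\<close>

lemma wave_test_functions:
  fixes \<omega> :: "'k::finite \<Rightarrow> real" and k :: 'k
  assumes R: "R > 0"
  defines "F \<equiv> \<lambda>x :: real ^ 'k. \<Prod>j\<in>UNIV. wave R (\<omega> j) (x $ j)"
    and "G \<equiv> \<lambda>x :: real ^ 'k. wave' R (\<omega> k) (x $ k) * (\<Prod>j\<in>UNIV - {k}. wave R (\<omega> j) (x $ j))"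
  shows "test_function (\<lambda>x. Re (c * F x))" "partial_deriv k (\<lambda>x. Re (c * F x)) = (\<lambda>x. Re (c * G x))"
proof -
  define \<beta> where "\<beta> j y = (if j = k then c else 1) * wave R (\<omega> j) y" for j y
  define \<beta>' where "\<beta>' j y = (if j = k then c else 1) * wave' R (\<omega> j) y" for j y
  have d: "(\<beta> j has_vector_derivative \<beta>' j y) (at y)" for j y
    unfolding \<beta>_def[abs_def] \<beta>'_def
    by (rule has_vector_derivative_mult_right[OF wave_has_derivative[OF R]])
  have split: "(\<Prod>j\<in>UNIV. h j) = h k * (\<Prod>j\<in>UNIV - {k}. h j)" for h :: "'k \<Rightarrow> complex"
    by (rule prod.remove) auto
  have F: "c * F x = (\<Prod>j\<in>UNIV. \<beta> j (x $ j))" for x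
    unfolding F_def split by (simp add: \<beta>_def mult.assoc)
  have G: "c * G x = (\<Prod>j\<in>UNIV. (\<beta>(k := \<beta>' k)) j (x $ j))" for x
    unfolding G_def split by (simp add: \<beta>_def \<beta>'_def mult.assoc)
  have "\<beta> j \<in> wave_bumps R (\<omega> j)" for j
    unfolding \<beta>_def[abs_def] by (rule wave_in_wave_bumps)
  then have "(\<lambda>x. Re (c * F x)) \<in> product_waves R \<omega>"
    unfolding product_waves_def F by blast
  then show "test_function (\<lambda>x. Re (c * F x))"
    using R by (rule product_waves_test_function)
  show "partial_deriv k (\<lambda>x. Re (c * F x)) = (\<lambda>x. Re (c * G x))"
    unfolding F G by (rule partial_deriv_product[OF d])
qed

lemma norm_wave_le: "cmod (wave R \<omega> y) \<le> 1"
  using cutoff_le_1 by (simp add: wave_def norm_mult)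

text \<open>Uniformity in R is what dominated convergence needs as the window grows: differentiating
  the window costs a factor 1/R, which is at most 1 here.\<close>

lemma wave'_bounded: "\<exists>B\<ge>0. \<forall>R\<ge>1. \<forall>y. cmod (wave' R \<omega> y) \<le> B"
proof -
  obtain B where B: "\<And>u. cmod (bump (bump_deriv [:1:] 0) (0 + 2) u) \<le> B"
    using bump_bounded by blast
  have B0: "0 \<le> B" using order_trans[OF norm_ge_zero B[of 0]] .
  have "cmod (wave' R \<omega> y) \<le> B + \<bar>\<omega>\<bar>" if "R \<ge> 1" for R y
  proof -
    have "cmod (wave' R \<omega> y) = cmod (bump (bump_deriv [:1:] 0) (0 + 2) (y / R) / R + \<i> * \<omega> * bump [:1:] 0 (y / R))"
      by (simp add: wave'_def norm_mult)
    also have "\<dots> \<le> cmod (bump (bump_deriv [:1:] 0) (0 + 2) (y / R)) / R + \<bar>\<omega>\<bar> * cmod (bump [:1:] 0 (y / R))"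
      using that by (intro order_trans[OF norm_triangle_ineq]) (simp add: norm_mult norm_divide)
    also have "\<dots> \<le> B / 1 + \<bar>\<omega>\<bar> * 1"
      using that by (intro add_mono frac_le mult_left_mono B B0 cutoff_le_1) auto
    finally show ?thesis by simp
  qed
  then show ?thesis using B0 by (intro exI[of _ "B + \<bar>\<omega>\<bar>"]) auto
qed

lemma wave_tendsto:
  "(\<lambda>n. wave (real (Suc n)) \<omega> y) \<longlonglongrightarrow> cis (\<omega> * y)"
  "(\<lambda>n. wave' (real (Suc n)) \<omega> y) \<longlonglongrightarrow> \<i> * \<omega> * cis (\<omega> * y)"
proof -
  have inv: "(\<lambda>n. 1 / real (Suc n)) \<longlonglongrightarrow> 0"
    using LIMSEQ_inverse_real_of_nat by (simp add: inverse_eq_divide)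
  then have "(\<lambda>n. y / real (Suc n)) \<longlonglongrightarrow> 0"
    using tendsto_mult[OF tendsto_const[of y] inv] by simp
  then have lim: "(\<lambda>n. bump p m (y / real (Suc n))) \<longlonglongrightarrow> bump p m 0" for p m
    using bump_continuous[of p m]
    by (intro isCont_tendsto_compose[of 0 "bump p m"]) (auto simp: continuous_on_eq_continuous_at)
  have "(\<lambda>n. bump [:1:] 0 (y / real (Suc n)) * cis (\<omega> * y)) \<longlonglongrightarrow> 1 * cis (\<omega> * y)"
    using lim[of "[:1:]" 0] unfolding cutoff_0 by (intro tendsto_intros)
  then show "(\<lambda>n. wave (real (Suc n)) \<omega> y) \<longlonglongrightarrow> cis (\<omega> * y)"
    by (simp add: wave_def)
  let ?D = "bump (bump_deriv [:1:] 0) (0 + 2)"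
  have A: "(\<lambda>n. ?D (y / real (Suc n)) * complex_of_real (1 / real (Suc n))) \<longlonglongrightarrow> ?D 0 * complex_of_real 0"
    by (intro tendsto_mult lim tendsto_of_real inv)
  have "(\<lambda>n. (?D (y / real (Suc n)) * complex_of_real (1 / real (Suc n)) + \<i> * \<omega> * bump [:1:] 0 (y / real (Suc n))) * cis (\<omega> * y))
     \<longlonglongrightarrow> (?D 0 * complex_of_real 0 + \<i> * \<omega> * 1) * cis (\<omega> * y)"
    using lim[of "[:1:]" 0] unfolding cutoff_0
    by (intro tendsto_mult[OF tendsto_add[OF A tendsto_mult[OF tendsto_const]] tendsto_const])
  then show "(\<lambda>n. wave' (real (Suc n)) \<omega> y) \<longlonglongrightarrow> \<i> * \<omega> * cis (\<omega> * y)"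
    by (simp add: wave'_def)
qed

lemma wave_measurable: "wave R \<omega> \<in> borel_measurable borel" "wave' R \<omega> \<in> borel_measurable borel"
proof -
  have [measurable]: "bump p m \<in> borel_measurable borel" for p m
    by (intro borel_measurable_continuous_onI bump_continuous)
  have [measurable]: "cis \<in> borel_measurable borel"
    by (intro borel_measurable_continuous_onI continuous_intros)
  show "wave R \<omega> \<in> borel_measurable borel" "wave' R \<omega> \<in> borel_measurable borel"
    unfolding wave_def[abs_def] wave'_def[abs_def] by measurable
qed

lemma fourier_char_prod: "fourier_char \<xi> x = (\<Prod>j\<in>UNIV. cis (- 2 * pi * \<xi> $ j * x $ j))"
  for \<xi> x :: "real ^ 'k::finite"
  unfolding fourier_char_def
  by (subst cis_sum[symmetric]) (simp_all add: inner_vec_def sum_distrib_left mult.assoc)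

definition cutoff :: "real \<Rightarrow> real ^ 'k::finite \<Rightarrow> complex" where
  "cutoff R x = (\<Prod>j\<in>UNIV. bump [:1:] 0 (x $ j / R))"

lemma norm_cutoff_le: "cmod (cutoff R x) \<le> 1"
  unfolding cutoff_def prod_norm[symmetric] using cutoff_le_1 by (intro prod_le_1) auto

lemma cutoff_support:
  fixes x :: "real ^ 'k::finite"
  assumes "R > 0" "cutoff R x \<noteq> 0"
  shows "x \<in> cbox (\<chi> i. - R) (\<chi> i. R)"
proof -
  have "bump [:1:] 0 (x $ j / R) \<noteq> 0" for j using assms(2) by (simp add: cutoff_def)
  then have "\<bar>x $ j / R\<bar> < 1" for j unfolding bump_def by metis
  then have "\<bar>x $ j\<bar> < R" for j using assms(1) by (simp add: divide_less_eq)
  then show ?thesis by (simp add: mem_box_cart abs_less_iff) (meson less_imp_le minus_less_iff)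
qed

lemma cutoff_wave: "(\<Prod>j\<in>UNIV. wave R (- 2 * pi * \<xi> $ j) (x $ j)) = cutoff R x * fourier_char \<xi> x"
  unfolding wave_def fourier_char_prod cutoff_def by (rule prod.distrib)

text \<open>The weak derivative is tested against the character \<open>fourier_char \<xi>\<close> times a growing cutoff.\<close>

lemma fourier_weak_derivative_tendsto:
  fixes f g :: "real ^ 'k::finite \<Rightarrow> complex"
  assumes f: "integrable lborel f" and g: "sq_integrable lborel g"
    and weak: "\<And>\<phi>. test_function \<phi> \<Longrightarrow> (\<integral>x. partial_deriv k \<phi> x *\<^sub>R f x \<partial>lborel) = - (\<integral>x. \<phi> x *\<^sub>R g x \<partial>lborel)"
  shows "(\<lambda>n. fourier_L1 (\<lambda>x. cutoff (real (Suc n)) x * g x) \<xi>) \<longlonglongrightarrow> complex_of_real (2 * pi * \<xi> $ k) * \<i> * fourier_L1 f \<xi>"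
    and "integrable lborel (\<lambda>x. cutoff (real (Suc n)) x * g x)"
    and "sq_integrable lborel (\<lambda>x. cutoff (real (Suc n)) x * g x)"
proof -
  have fm [measurable]: "f \<in> borel_measurable borel" and gm [measurable]: "g \<in> borel_measurable borel"
    using f sq_integrable_measurable[OF g] by (auto dest: borel_measurable_integrable)
  note [measurable] = wave_measurable
  define \<omega> where "\<omega> j = - 2 * pi * \<xi> $ j" for j
  define F where "F n x = (\<Prod>j\<in>UNIV. wave (real (Suc n)) (\<omega> j) (x $ j))" for n and x :: "real ^ 'k"
  define G where "G n x = wave' (real (Suc n)) (\<omega> k) (x $ k) * (\<Prod>j\<in>UNIV - {k}. wave (real (Suc n)) (\<omega> j) (x $ j))" for n and x :: "real ^ 'k"
  have [measurable]: "cutoff R \<in> borel_measurable (borel :: (real ^ 'k) measure)" for R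
  proof -
    have [measurable]: "bump p m \<in> borel_measurable borel" for p m
      by (intro borel_measurable_continuous_onI bump_continuous)
    show ?thesis unfolding cutoff_def[abs_def] by measurable
  qed
  have [measurable]: "F n \<in> borel_measurable borel" "G n \<in> borel_measurable borel" for n
    unfolding F_def[abs_def] G_def[abs_def] by measurable
  have F: "F n x = cutoff (real (Suc n)) x * fourier_char \<xi> x" for n x
    unfolding F_def \<omega>_def by (rule cutoff_wave)
  have ind: "sq_integrable lborel (\<lambda>x::real ^ 'k. 1 * indicator (cbox (\<chi> i. - real (Suc n)) (\<chi> i. real (Suc n))) x :: real)" for n
    by (rule sq_integrable_indicator_bounded) auto
  show i1: "integrable lborel (\<lambda>x. cutoff (real (Suc n)) x * g x)" for n
  proof (rule Bochner_Integration.integrable_bound[OF l2_Cauchy_Schwarz(1)[OF ind[of n] g]])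
    show "AE x in lborel. norm (cutoff (real (Suc n)) x * g x)
       \<le> norm (norm (1 * indicator (cbox (\<chi> i. - real (Suc n)) (\<chi> i. real (Suc n))) x :: real) * norm (g x))"
    proof (rule AE_I2)
      fix x
      show "norm (cutoff (real (Suc n)) x * g x)
         \<le> norm (norm (1 * indicator (cbox (\<chi> i. - real (Suc n)) (\<chi> i. real (Suc n))) x :: real) * norm (g x))"
      proof (cases "cutoff (real (Suc n)) x = 0")
        case False
        then have "x \<in> cbox (\<chi> i. - real (Suc n)) (\<chi> i. real (Suc n))"
          by (intro cutoff_support) auto
        then show ?thesis
          using mult_right_mono[OF norm_cutoff_le norm_ge_zero[of "g x"], of "real (Suc n)" x]
          by (simp add: norm_mult)
      qed simp
    qed
  qed measurable
  show "sq_integrable lborel (\<lambda>x. cutoff (real (Suc n)) x * g x)" for n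
  proof (rule sq_integrable_bound[OF g, of _ 1])
    show "AE x in lborel. cmod (cutoff (real (Suc n)) x * g x) \<le> 1 * cmod (g x)"
      unfolding norm_mult by (intro AE_I2 mult_right_mono norm_cutoff_le) auto
  qed measurable
  obtain B where B: "0 \<le> B" "\<And>n y. cmod (wave' (real (Suc n)) (\<omega> k) y) \<le> B"
  proof -
    obtain B where "0 \<le> B" "\<forall>R\<ge>1. \<forall>y. cmod (wave' R (\<omega> k) y) \<le> B"
      using wave'_bounded by blast
    then show ?thesis using that[of B] by simp
  qed
  have GB: "cmod (G n x) \<le> B" for n x
  proof -
    have "cmod (G n x) \<le> B * 1"
      unfolding G_def norm_mult prod_norm[symmetric]
      by (intro mult_mono B prod_le_1 prod_nonneg) (auto simp: norm_wave_le)
    then show ?thesis by simp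
  qed
  have Gf: "integrable lborel (\<lambda>x. G n x * f x)" for n
  proof (rule Bochner_Integration.integrable_bound)
    show "integrable lborel (\<lambda>x. B * norm (f x))" using f by simp
    show "AE x in lborel. norm (G n x * f x) \<le> norm (B * norm (f x))"
      using GB B(1) by (intro AE_I2) (simp add: norm_mult mult_right_mono)
  qed measurable
  have Fg: "integrable lborel (\<lambda>x. F n x * g x)" for n
    using integrable_times_fourier_char[OF i1[of n], of \<xi>] by (simp add: F mult_ac)
  \<comment> \<open>The weak derivative is defined through real test functions, so the real and
    imaginary parts of the windowed character are tested separately and recombined.\<close>
  have parts: "(\<integral>x. G n x * f x \<partial>lborel) = - (\<integral>x. F n x * g x \<partial>lborel)" for n
  proof -
    have w: "(\<integral>x. Re (c * G n x) *\<^sub>R f x \<partial>lborel) = - (\<integral>x. Re (c * F n x) *\<^sub>R g x \<partial>lborel)" for c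
      using weak[OF wave_test_functions(1)[of "real (Suc n)" c \<omega>]]
      unfolding wave_test_functions(2)[of "real (Suc n)" k c \<omega>, OF of_nat_0_less_iff[THEN iffD2, OF zero_less_Suc]]
      by (simp add: F_def G_def)
    have dec: "z * h = Re (1 * z) *\<^sub>R h + \<i> * (Re (- \<i> * z) *\<^sub>R h)" for z h :: complex
      by (simp add: scaleR_conv_of_real complex_eq_iff)
    have int: "integrable lborel (\<lambda>x. Re (c * u x) *\<^sub>R h x)" if "integrable lborel (\<lambda>x. u x * h x)"
      "u \<in> borel_measurable borel" "h \<in> borel_measurable borel" "cmod c = 1" for c u and h :: "real ^ 'k \<Rightarrow> complex"
    proof (rule Bochner_Integration.integrable_bound[OF that(1)])
      show "(\<lambda>x. Re (c * u x) *\<^sub>R h x) \<in> borel_measurable lborel"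
        using that(2,3) by measurable
      have "\<bar>Re (c * z)\<bar> \<le> cmod z" for z
        using abs_Re_le_cmod[of "c * z"] that(4) by (simp only: norm_mult mult_1)
      then show "AE x in lborel. norm (Re (c * u x) *\<^sub>R h x) \<le> norm (u x * h x)"
        by (intro AE_I2) (simp only: norm_mult norm_scaleR mult_right_mono norm_ge_zero)
    qed
    have split: "(\<integral>x. u x * h x \<partial>lborel) = (\<integral>x. Re (1 * u x) *\<^sub>R h x \<partial>lborel) + \<i> * (\<integral>x. Re (- \<i> * u x) *\<^sub>R h x \<partial>lborel)"
      if uh: "integrable lborel (\<lambda>x. u x * h x)" "u \<in> borel_measurable borel" "h \<in> borel_measurable borel"
      for u and h :: "real ^ 'k \<Rightarrow> complex"
    proof -
      have i: "integrable lborel (\<lambda>x. Re (1 * u x) *\<^sub>R h x)" "integrable lborel (\<lambda>x. Re (- \<i> * u x) *\<^sub>R h x)"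
        by (rule int[OF uh], simp)+
      have "(\<integral>x. u x * h x \<partial>lborel) = (\<integral>x. Re (1 * u x) *\<^sub>R h x + \<i> * (Re (- \<i> * u x) *\<^sub>R h x) \<partial>lborel)"
        by (rule Bochner_Integration.integral_cong[OF refl dec])
      also have "\<dots> = (\<integral>x. Re (1 * u x) *\<^sub>R h x \<partial>lborel) + (\<integral>x. \<i> * (Re (- \<i> * u x) *\<^sub>R h x) \<partial>lborel)"
        by (rule Bochner_Integration.integral_add[OF i(1) integrable_mult_right[OF i(2)]])
      finally show ?thesis by (simp only: integral_mult_right_zero)
    qed
    have "(\<integral>x. G n x * f x \<partial>lborel) = - ((\<integral>x. Re (1 * F n x) *\<^sub>R g x \<partial>lborel) + \<i> * (\<integral>x. Re (- \<i> * F n x) *\<^sub>R g x \<partial>lborel))"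
      by (subst split[OF Gf]) (simp_all only: w mult_minus_right minus_add_distrib, measurable)
    also have "(\<integral>x. Re (1 * F n x) *\<^sub>R g x \<partial>lborel) + \<i> * (\<integral>x. Re (- \<i> * F n x) *\<^sub>R g x \<partial>lborel) = (\<integral>x. F n x * g x \<partial>lborel)"
      by (rule split[OF Fg, symmetric]) measurable
    finally show ?thesis .
  qed
  \<comment> \<open>As the window grows its own derivative disappears and \<open>G n\<close> tends
    to the derivative of the character; integrability of \<open>f\<close> provides the
    majorant.\<close>
  have "(\<lambda>n. \<integral>x. G n x * f x \<partial>lborel) \<longlonglongrightarrow> (\<integral>x. (\<i> * complex_of_real (\<omega> k) * fourier_char \<xi> x) * f x \<partial>lborel)"
  proof (rule integral_dominated_convergence)
    show "integrable lborel (\<lambda>x. B * norm (f x))" using f by simp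
    show "AE x in lborel. (\<lambda>n. G n x * f x) \<longlonglongrightarrow> \<i> * complex_of_real (\<omega> k) * fourier_char \<xi> x * f x"
    proof (rule AE_I2)
      fix x
      have "(\<lambda>n. G n x * f x) \<longlonglongrightarrow> (\<i> * \<omega> k * cis (\<omega> k * x $ k)) * (\<Prod>j\<in>UNIV - {k}. cis (\<omega> j * x $ j)) * f x"
        unfolding G_def by (intro tendsto_mult tendsto_prod wave_tendsto tendsto_const)
      moreover have "fourier_char \<xi> x = cis (\<omega> k * x $ k) * (\<Prod>j\<in>UNIV - {k}. cis (\<omega> j * x $ j))"
        unfolding fourier_char_prod \<omega>_def by (rule prod.remove) auto
      ultimately show "(\<lambda>n. G n x * f x) \<longlonglongrightarrow> \<i> * complex_of_real (\<omega> k) * fourier_char \<xi> x * f x"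
        by (simp only: mult.assoc)
    qed
    show "AE x in lborel. norm (G n x * f x) \<le> B * norm (f x)" for n
      using GB by (intro AE_I2) (simp add: norm_mult mult_right_mono)
  qed measurable
  then have lim: "(\<lambda>n. - (\<integral>x. G n x * f x \<partial>lborel)) \<longlonglongrightarrow> - (\<integral>x. (\<i> * complex_of_real (\<omega> k) * fourier_char \<xi> x) * f x \<partial>lborel)"
    by (rule tendsto_minus)
  have "(\<integral>x. (\<i> * complex_of_real (\<omega> k) * fourier_char \<xi> x) * f x \<partial>lborel) = \<i> * complex_of_real (\<omega> k) * fourier_L1 f \<xi>"
    unfolding fourier_L1_lborel[OF fm] integral_mult_right_zero[symmetric] by (simp only: mult_ac)
  then have "- (\<integral>x. (\<i> * complex_of_real (\<omega> k) * fourier_char \<xi> x) * f x \<partial>lborel) = complex_of_real (2 * pi * \<xi> $ k) * \<i> * fourier_L1 f \<xi>"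
    by (simp add: \<omega>_def)
  moreover have "- (\<integral>x. G n x * f x \<partial>lborel) = fourier_L1 (\<lambda>x. cutoff (real (Suc n)) x * g x) \<xi>" for n
    unfolding parts minus_minus F by (subst fourier_L1_lborel) (measurable, simp only: mult_ac)
  ultimately show "(\<lambda>n. fourier_L1 (\<lambda>x. cutoff (real (Suc n)) x * g x) \<xi>) \<longlonglongrightarrow> complex_of_real (2 * pi * \<xi> $ k) * \<i> * fourier_L1 f \<xi>"
    using lim by (simp only:)
qed

text \<open>A weak derivative in L^2 may lack a transform given by an integral, but its cut off
  versions have one. Their norms do not exceed that of \<open>g\<close>, and Fatou carries this
  bound to the pointwise limit of their transforms.\<close>

theorem weak_derivative_fourier_bound:
  fixes f g :: "real ^ 'k::finite \<Rightarrow> complex"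
  assumes f: "integrable lborel f" and g: "sq_integrable lborel g"
    and weak: "\<And>\<phi>. test_function \<phi> \<Longrightarrow> (\<integral>x. partial_deriv k \<phi> x *\<^sub>R f x \<partial>lborel) = - (\<integral>x. \<phi> x *\<^sub>R g x \<partial>lborel)"
  shows "(\<integral>\<^sup>+\<xi>. ennreal ((2 * pi * \<bar>\<xi> $ k\<bar> * cmod (fourier_L1 f \<xi>))\<^sup>2) \<partial>lborel) \<le> ennreal ((l2 lborel g)\<^sup>2)"
proof -
  define h where "h n x = cutoff (real (Suc n)) x * g x" for n x
  note w = fourier_weak_derivative_tendsto[OF f g weak, folded h_def]
  have [measurable]: "h n \<in> borel_measurable borel" for n
    using sq_integrable_measurable[OF w(3)] by (simp add: h_def[abs_def])
  have hn: "integrable lborel (h n)" "sq_integrable lborel (h n)" for n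
    using w(2,3) by (simp_all add: h_def[abs_def])
  have le: "l2 lborel (h n) \<le> l2 lborel g" for n
  proof (rule l2_mono[OF g])
    show "AE x in lborel. cmod (h n x) \<le> cmod (g x)"
      unfolding h_def norm_mult using mult_right_mono[OF norm_cutoff_le norm_ge_zero] by (intro AE_I2) force
  qed simp
  have "(\<integral>\<^sup>+\<xi>. ennreal ((2 * pi * \<bar>\<xi> $ k\<bar> * cmod (fourier_L1 f \<xi>))\<^sup>2) \<partial>lborel)
      = (\<integral>\<^sup>+\<xi>. liminf (\<lambda>n. ennreal ((cmod (fourier_L1 (h n) \<xi>))\<^sup>2)) \<partial>lborel)"
  proof (rule nn_integral_cong)
    fix \<xi> :: "real ^ 'k"
    have "(\<lambda>n. fourier_L1 (h n) \<xi>) \<longlonglongrightarrow> complex_of_real (2 * pi * \<xi> $ k) * \<i> * fourier_L1 f \<xi>"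
      using w(1)[of \<xi>] by (simp add: h_def[abs_def])
    then have "(\<lambda>n. ennreal ((cmod (fourier_L1 (h n) \<xi>))\<^sup>2)) \<longlonglongrightarrow> ennreal ((cmod (complex_of_real (2 * pi * \<xi> $ k) * \<i> * fourier_L1 f \<xi>))\<^sup>2)"
      by (intro tendsto_ennrealI tendsto_intros)
    moreover have "cmod (complex_of_real (2 * pi * \<xi> $ k) * \<i> * fourier_L1 f \<xi>) = 2 * pi * \<bar>\<xi> $ k\<bar> * cmod (fourier_L1 f \<xi>)"
      by (simp add: norm_mult abs_mult)
    ultimately show "ennreal ((2 * pi * \<bar>\<xi> $ k\<bar> * cmod (fourier_L1 f \<xi>))\<^sup>2) = liminf (\<lambda>n. ennreal ((cmod (fourier_L1 (h n) \<xi>))\<^sup>2))"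
      using lim_imp_Liminf[OF sequentially_bot] by fastforce
  qed
  also have "\<dots> \<le> liminf (\<lambda>n. \<integral>\<^sup>+\<xi>. ennreal ((cmod (fourier_L1 (h n) \<xi>))\<^sup>2) \<partial>lborel)"
    by (rule nn_integral_liminf) measurable
  also have "\<dots> = liminf (\<lambda>n. ennreal ((l2 lborel (h n))\<^sup>2))"
    by (simp add: nn_integral_l2[OF plancherel_L1(1)[OF hn]] plancherel_L1(2)[OF hn])
  also have "\<dots> \<le> liminf (\<lambda>n. ennreal ((l2 lborel g)\<^sup>2))"
    by (intro Liminf_mono always_eventually allI ennreal_leI power_mono le) simp
  also have "\<dots> = ennreal ((l2 lborel g)\<^sup>2)"
    by (rule Liminf_const) simp
  finally show ?thesis .
qed

subsection \<open>Heisenberg inequality for the shearlet transform\<close>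

lemma norm_cis_minus_one_le: "cmod (cis t - 1) \<le> \<bar>t\<bar>"
  using iexp_approx1[of t 0] by (simp add: cis_conv_exp)

text \<open>Translation multiplies the transform by a character, whose distance from 1 is at most
  its angle. That angle is \<epsilon> times the modulus of the multiplier of the k-th derivative, so
  Plancherel turns the frequency bound into the difference estimate.\<close>

lemma l2_translation_difference:
  fixes f :: "real ^ 'k::finite \<Rightarrow> complex"
  assumes f: "integrable lborel f" "sq_integrable lborel f" and "0 \<le> B"
    and bound: "(\<integral>\<^sup>+\<xi>. ennreal ((2 * pi * \<bar>\<xi> $ k\<bar> * cmod (fourier_L1 f \<xi>))\<^sup>2) \<partial>lborel) \<le> ennreal (B\<^sup>2)"
    and \<epsilon>: "0 \<le> \<epsilon>"
  shows "l2 lborel (\<lambda>x. f (axis k \<epsilon> + x) - f x) \<le> \<epsilon> * B"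
proof -
  let ?d = "\<lambda>x. f (axis k \<epsilon> + x) - f x"
  have [measurable]: "f \<in> borel_measurable borel" using sq_integrable_measurable[OF f(2)] by simp
  have d: "integrable lborel ?d" "sq_integrable lborel ?d"
    by (intro Bochner_Integration.integrable_diff lborel_integrable_translate sq_integrable_diff sq_integrable_translate f)+
  have F: "cmod (fourier_L1 ?d \<xi>) \<le> \<epsilon> * (2 * pi * \<bar>\<xi> $ k\<bar> * cmod (fourier_L1 f \<xi>))" for \<xi>
  proof -
    have eq: "fourier_L1 ?d \<xi> = (fourier_char \<xi> (- axis k \<epsilon>) - 1) * fourier_L1 f \<xi>"
      unfolding fourier_L1_diff[OF lborel_integrable_translate[OF f(1)] f(1)] fourier_L1_translate[OF f(1)]
      by (simp only: left_diff_distrib mult_1)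
    have le: "cmod (fourier_char \<xi> (- axis k \<epsilon>) - 1) \<le> \<epsilon> * (2 * pi * \<bar>\<xi> $ k\<bar>)"
      unfolding fourier_char_def using \<epsilon>
      by (intro order_trans[OF norm_cis_minus_one_le]) (simp add: inner_axis abs_mult)
    show ?thesis
      using mult_right_mono[OF le norm_ge_zero[of "fourier_L1 f \<xi>"]] by (simp only: eq norm_mult mult.assoc)
  qed
  have "l2 lborel (fourier_L1 ?d) \<le> \<epsilon> * B"
  proof (rule l2_le_nn_integral(2))
    have "(\<integral>\<^sup>+\<xi>. ennreal ((cmod (fourier_L1 ?d \<xi>))\<^sup>2) \<partial>lborel)
       \<le> (\<integral>\<^sup>+\<xi>. ennreal (\<epsilon>\<^sup>2) * ennreal ((2 * pi * \<bar>\<xi> $ k\<bar> * cmod (fourier_L1 f \<xi>))\<^sup>2) \<partial>lborel)"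
    proof (rule nn_integral_mono)
      fix \<xi>
      have "(cmod (fourier_L1 ?d \<xi>))\<^sup>2 \<le> \<epsilon>\<^sup>2 * (2 * pi * \<bar>\<xi> $ k\<bar> * cmod (fourier_L1 f \<xi>))\<^sup>2"
        unfolding power_mult_distrib[symmetric, of \<epsilon>] by (intro power_mono F) auto
      then show "ennreal ((cmod (fourier_L1 ?d \<xi>))\<^sup>2) \<le> ennreal (\<epsilon>\<^sup>2) * ennreal ((2 * pi * \<bar>\<xi> $ k\<bar> * cmod (fourier_L1 f \<xi>))\<^sup>2)"
        by (subst ennreal_mult[symmetric]) (auto intro: ennreal_leI)
    qed
    also have "\<dots> = ennreal (\<epsilon>\<^sup>2) * (\<integral>\<^sup>+\<xi>. ennreal ((2 * pi * \<bar>\<xi> $ k\<bar> * cmod (fourier_L1 f \<xi>))\<^sup>2) \<partial>lborel)"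
      by (rule nn_integral_cmult) measurable
    also have "\<dots> \<le> ennreal (\<epsilon>\<^sup>2) * ennreal (B\<^sup>2)"
      by (rule mult_left_mono[OF bound]) simp
    also have "\<dots> = ennreal ((\<epsilon> * B)\<^sup>2)"
      by (simp add: ennreal_mult power_mult_distrib)
    finally show "(\<integral>\<^sup>+\<xi>. ennreal ((cmod (fourier_L1 ?d \<xi>))\<^sup>2) \<partial>lborel) \<le> ennreal ((\<epsilon> * B)\<^sup>2)" .
  qed (use \<epsilon> \<open>0 \<le> B\<close> in auto)
  then show ?thesis by (simp add: plancherel_L1(2)[OF d])
qed

text \<open>
  Since \<open>T\<close> preserves the measure and moves the position \<open>\<tau>\<close> by \<open>\<epsilon>\<close>, we have
  \<open>\<integral> \<tau> (|F \<circ> T|\<^sup>2 - |F|\<^sup>2) = - \<epsilon> \<integral> |F|\<^sup>2\<close>, and the left-hand side is controlled by \<open>F \<circ> T - F\<close>.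
\<close>

lemma heisenberg_translation:
  fixes F :: "'a \<Rightarrow> complex" and \<tau> :: "'a \<Rightarrow> real"
  assumes T [measurable]: "T \<in> measurable M M" and inv: "distr M M T = M"
    and \<tau> [measurable]: "\<tau> \<in> borel_measurable M" and shift: "\<And>p. \<tau> (T p) = \<tau> p + \<epsilon>" and \<epsilon>: "0 < \<epsilon>"
    and F: "sq_integrable M F" and \<tau>F: "sq_integrable M (\<lambda>p. \<tau> p *\<^sub>R F p)"
    and D: "l2 M (\<lambda>p. F (T p) - F p) \<le> \<epsilon> * B"
  shows "(l2 M F)\<^sup>2 \<le> B * (2 * l2 M (\<lambda>p. \<tau> p *\<^sub>R F p) + \<epsilon> * l2 M F)"
proof -
  have [measurable]: "F \<in> borel_measurable M" using F by (rule sq_integrable_measurable)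
  have int: "integrable M (\<lambda>p. g (T p))" "(\<integral>p. g (T p) \<partial>M) = (\<integral>p. g p \<partial>M)" if "integrable M g" for g :: "'a \<Rightarrow> real"
  proof -
    have [measurable]: "g \<in> borel_measurable M" using that by auto
    have "integrable (distr M M T) g" using that by (simp add: inv)
    then show "integrable M (\<lambda>p. g (T p))" by (subst (asm) integrable_distr_eq) auto
    have "(\<integral>p. g p \<partial>M) = (\<integral>p. g p \<partial>distr M M T)" by (simp add: inv)
    then show "(\<integral>p. g (T p) \<partial>M) = (\<integral>p. g p \<partial>M)" by (simp add: integral_distr)
  qed
  have sq: "sq_integrable M (\<lambda>p. h (T p))" "l2 M (\<lambda>p. h (T p)) = l2 M h" if h: "sq_integrable M h" for h :: "'a \<Rightarrow> complex"
  proof -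
    have [measurable]: "h \<in> borel_measurable M" using h by (rule sq_integrable_measurable)
    show "sq_integrable M (\<lambda>p. h (T p))"
      by (rule sq_integrableI) (use int(1)[OF sq_integrableD[OF h]] in simp_all)
    show "l2 M (\<lambda>p. h (T p)) = l2 M h"
      unfolding l2_def using int(2)[OF sq_integrableD[OF h]] by simp
  qed
  \<comment> \<open>This is (\<tau> - \<epsilon>) F, and composing it with \<open>T\<close> gives
    \<tau> times F o T. So the latter is square integrable with the norm of \<open>E\<close>, which
    is the origin of the remainder \<open>\<epsilon> * l2 M F\<close>.\<close>
  define E where "E p = \<tau> p *\<^sub>R F p - \<epsilon> *\<^sub>R F p" for p
  have E: "sq_integrable M E"
    unfolding E_def by (intro sq_integrable_diff \<tau>F sq_integrable_scaleR F)
  have ET: "E (T p) = \<tau> p *\<^sub>R F (T p)" for p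
    by (simp add: E_def shift scaleR_add_left)
  have El: "l2 M E \<le> l2 M (\<lambda>p. \<tau> p *\<^sub>R F p) + \<epsilon> * l2 M F"
  proof -
    have "l2 M E \<le> l2 M (\<lambda>p. \<tau> p *\<^sub>R F p) + l2 M (\<lambda>p. \<epsilon> *\<^sub>R F p)"
      unfolding E_def by (intro l2_triangle_diff \<tau>F sq_integrable_scaleR F)
    also have "l2 M (\<lambda>p. \<epsilon> *\<^sub>R F p) = \<epsilon> * l2 M F"
      using l2_cmult[of M "complex_of_real \<epsilon>" F] \<epsilon> by (simp add: scaleR_conv_of_real)
    finally show ?thesis .
  qed
  note FT = sq(1)[OF F] and ETs = sq[OF E, unfolded ET]
  have i1: "integrable M (\<lambda>p. \<tau> p * (cmod (F p))\<^sup>2)"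
  proof (rule Bochner_Integration.integrable_bound[OF l2_Cauchy_Schwarz(1)[OF \<tau>F F]])
    show "AE p in M. norm (\<tau> p * (cmod (F p))\<^sup>2) \<le> norm (norm (\<tau> p *\<^sub>R F p) * norm (F p))"
      by (simp add: abs_mult power2_eq_square)
  qed measurable
  have i2: "integrable M (\<lambda>p. (\<tau> p - \<epsilon>) * (cmod (F p))\<^sup>2)"
    using i1 sq_integrableD[OF F] by (simp add: left_diff_distrib)
  have i3: "integrable M (\<lambda>p. \<tau> p * (cmod (F (T p)))\<^sup>2)"
    using int(1)[OF i2] by (simp add: shift)
  have "\<epsilon> * (l2 M F)\<^sup>2 = - (\<integral>p. \<tau> p * (cmod (F (T p)))\<^sup>2 - \<tau> p * (cmod (F p))\<^sup>2 \<partial>M)"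
  proof -
    have "(\<integral>p. \<tau> p * (cmod (F (T p)))\<^sup>2 \<partial>M) = (\<integral>p. (\<tau> p - \<epsilon>) * (cmod (F p))\<^sup>2 \<partial>M)"
      using int(2)[OF i2] by (simp add: shift)
    also have "\<dots> = (\<integral>p. \<tau> p * (cmod (F p))\<^sup>2 \<partial>M) - \<epsilon> * (l2 M F)\<^sup>2"
      using i1 sq_integrableD[OF F] by (simp add: left_diff_distrib l2_power2)
    finally show ?thesis using i1 i3 by simp
  qed
  also have "\<dots> \<le> (\<integral>p. norm (F (T p) - F p) * norm (\<tau> p *\<^sub>R F (T p)) + norm (F (T p) - F p) * norm (\<tau> p *\<^sub>R F p) \<partial>M)"
    unfolding integral_minus[symmetric]
  proof (rule integral_mono)
    show "integrable M (\<lambda>p. - (\<tau> p * (cmod (F (T p)))\<^sup>2 - \<tau> p * (cmod (F p))\<^sup>2))"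
      using i1 i3 by simp
    show "integrable M (\<lambda>p. norm (F (T p) - F p) * norm (\<tau> p *\<^sub>R F (T p)) + norm (F (T p) - F p) * norm (\<tau> p *\<^sub>R F p))"
      by (intro Bochner_Integration.integrable_add l2_Cauchy_Schwarz(1) sq_integrable_diff FT F ETs \<tau>F)
    fix p
    let ?u = "cmod (F (T p))" and ?v = "cmod (F p)"
    \<comment> \<open>Factoring the difference of squares leaves ?u - ?v, whose modulus is at most
      |F o T - F|.\<close>
    have "- (\<tau> p * ?u\<^sup>2 - \<tau> p * ?v\<^sup>2) \<le> \<bar>\<tau> p * ((?u - ?v) * (?u + ?v))\<bar>"
      by (simp add: power2_eq_square algebra_simps) 
    also have "\<dots> = \<bar>\<tau> p\<bar> * (\<bar>?u - ?v\<bar> * (?u + ?v))"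
      by (simp add: abs_mult)
    also have "\<dots> \<le> \<bar>\<tau> p\<bar> * (cmod (F (T p) - F p) * (?u + ?v))"
      by (intro mult_left_mono mult_right_mono norm_triangle_ineq3) auto
    finally show "- (\<tau> p * ?u\<^sup>2 - \<tau> p * ?v\<^sup>2)
       \<le> norm (F (T p) - F p) * norm (\<tau> p *\<^sub>R F (T p)) + norm (F (T p) - F p) * norm (\<tau> p *\<^sub>R F p)"
      by (simp add: algebra_simps)
  qed
  also have "\<dots> \<le> l2 M (\<lambda>p. F (T p) - F p) * l2 M (\<lambda>p. \<tau> p *\<^sub>R F (T p)) + l2 M (\<lambda>p. F (T p) - F p) * l2 M (\<lambda>p. \<tau> p *\<^sub>R F p)"
    by (subst Bochner_Integration.integral_add; intro add_mono l2_Cauchy_Schwarz sq_integrable_diff FT F ETs \<tau>F)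
  also have "\<dots> = l2 M (\<lambda>p. F (T p) - F p) * (l2 M E + l2 M (\<lambda>p. \<tau> p *\<^sub>R F p))"
    by (simp add: ETs(2) distrib_left)
  also have "\<dots> \<le> (\<epsilon> * B) * (2 * l2 M (\<lambda>p. \<tau> p *\<^sub>R F p) + \<epsilon> * l2 M F)"
    using El order_trans[OF l2_nonneg D] by (intro mult_mono D) auto
  finally show ?thesis using \<epsilon> by (simp add: mult.assoc)
qed

section \<open>Translations on the parameter space\<close>

text \<open>In the substituted form of the transform a shift of t is visibly a shift of the argument
  of \<open>f\<close>, and the rest is linearity in \<open>f\<close>.\<close>

lemma sht_translate_diff:
  fixes \<psi> f :: "real ^ ('m::finite option) \<Rightarrow> complex"
  assumes \<psi>: "sq_integrable lborel \<psi>" and f: "sq_integrable lborel f"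
  shows "sht \<psi> f a s (c + t) - sht \<psi> f a s t = sht \<psi> (\<lambda>x. f (c + x) - f x) a s t"
proof (cases "a = 0")
  case True
  \<comment> \<open>At a = 0 the determinant factor is 0, so both sides vanish.\<close>
  then show ?thesis by (simp add: sht_def dil_det_def)
next
  case False
  have [measurable]: "f \<in> borel_measurable borel" using sq_integrable_measurable[OF f] by simp
  have i: "integrable lborel (\<lambda>y. f (b + shearlet_matrix s a *v y) * cnj (\<psi> y))" for b
  proof (intro sq_integrable_mult sq_integrable_cnj \<psi> sq_integrableI)
    show "(\<lambda>y. f (b + shearlet_matrix s a *v y)) \<in> borel_measurable lborel" by measurable
    show "integrable lborel (\<lambda>y. (cmod (f (b + shearlet_matrix s a *v y)))\<^sup>2)"
      using shearlet_matrix_subst(2)[OF False, of "\<lambda>x. (cmod (f (b + x)))\<^sup>2"]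
        sq_integrableD[OF sq_integrable_translate[OF f]] by simp
  qed
  show ?thesis
    using i[of "c + t"] i[of t]
    by (simp add: sht_def right_diff_distrib[symmetric] left_diff_distrib add.assoc)
qed

text \<open>The Borel counterpart of \<open>shearlet_measure\<close> on the whole product space:
  points with a = 0 are kept, with density 1/0 = 0.\<close>

definition shearlet_lborel :: "(real \<times> (real ^ 'm) \<times> (real ^ ('m::finite option))) measure" where
  "shearlet_lborel = density lborel (\<lambda>p. ennreal (1 / \<bar>fst p\<bar> ^ (CARD('m option) + 1)))"

lemma sets_shearlet_lborel [measurable_cong, simp]: "sets shearlet_lborel = sets borel"
  by (simp add: shearlet_lborel_def)

lemma nn_integral_shearlet_lborel:
  fixes h :: "real \<times> (real ^ 'm) \<times> (real ^ ('m::finite option)) \<Rightarrow> ennreal"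
  assumes [measurable]: "h \<in> borel_measurable borel"
  shows "(\<integral>\<^sup>+p. h p \<partial>shearlet_lborel) = (\<integral>\<^sup>+p. h p * ennreal (1 / \<bar>fst p\<bar> ^ (CARD('m option) + 1)) \<partial>lborel)"
  unfolding shearlet_lborel_def by (subst nn_integral_density) (auto simp: mult.commute)

text \<open>The density depends on a alone, which a shift in t leaves fixed.\<close>

lemma shearlet_lborel_translate:
  fixes c :: "real ^ ('m::finite option)"
  defines "T \<equiv> \<lambda>p :: real \<times> (real ^ 'm) \<times> (real ^ 'm option). (0, 0, c) + p"
  shows "distr shearlet_lborel shearlet_lborel T = shearlet_lborel"
proof (rule measure_eqI)
  fix A assume "A \<in> sets (distr shearlet_lborel shearlet_lborel T)"
  then have A [measurable]: "A \<in> sets borel" by simp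
  have [measurable]: "T \<in> borel_measurable borel" unfolding T_def by measurable
  let ?w = "\<lambda>p :: real \<times> (real ^ 'm) \<times> (real ^ 'm option). ennreal (1 / \<bar>fst p\<bar> ^ (CARD('m option) + 1))"
  have "emeasure (distr shearlet_lborel shearlet_lborel T) A = (\<integral>\<^sup>+p. indicator A p \<partial>distr shearlet_lborel shearlet_lborel T)"
    by simp
  also have "\<dots> = (\<integral>\<^sup>+p. indicator A (T p) \<partial>shearlet_lborel)"
    by (rule nn_integral_distr) measurable
  also have "\<dots> = (\<integral>\<^sup>+p. indicator A (T p) * ?w p \<partial>lborel)"
    by (rule nn_integral_shearlet_lborel) measurable
  also have "\<dots> = (\<integral>\<^sup>+p. indicator A ((0, 0, c) + p) * ?w ((0, 0, c) + p) \<partial>lborel)"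
    by (simp add: T_def)
  also have "\<dots> = (\<integral>\<^sup>+p. indicator A p * ?w p \<partial>lborel)"
    by (rule lborel_nn_integral_translate[of "\<lambda>p. indicator A p * ?w p"]) measurable
  also have "\<dots> = (\<integral>\<^sup>+p. indicator A p \<partial>shearlet_lborel)"
    by (rule nn_integral_shearlet_lborel[symmetric]) measurable
  finally show "emeasure (distr shearlet_lborel shearlet_lborel T) A = emeasure shearlet_lborel A" by simp
qed simp

definition shp :: "(real ^ ('m::finite option) \<Rightarrow> complex) \<Rightarrow> (real ^ 'm option \<Rightarrow> complex) \<Rightarrow> real \<times> (real ^ 'm) \<times> (real ^ 'm option) \<Rightarrow> complex" where
  "shp \<psi> f p = sht \<psi> f (fst p) (fst (snd p)) (snd (snd p))"

lemma shp_isometry: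
  fixes \<psi> f :: "real ^ ('m::finite option) \<Rightarrow> complex"
  assumes pair: "fourier_pair \<psi> \<Psi>" and C: "radial_integral (\<lambda>x. ennreal ((cmod (\<Psi> x))\<^sup>2)) = 1"
    and f: "integrable lborel f" "sq_integrable lborel f"
  shows "shp \<psi> f \<in> borel_measurable borel" "sq_integrable shearlet_lborel (shp \<psi> f)" "l2 shearlet_lborel (shp \<psi> f) = l2 lborel f"
proof -
  have s: "sq_integrable lborel \<psi>" using pair by (auto simp: fourier_pair_def)
  have [measurable]: "f \<in> borel_measurable borel" "\<psi> \<in> borel_measurable borel"
    using sq_integrable_measurable[OF f(2)] sq_integrable_measurable[OF s] by auto
  show m [measurable]: "shp \<psi> f \<in> borel_measurable borel"
    unfolding shp_def[abs_def] by measurable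
  have nn: "(\<integral>\<^sup>+p. ennreal ((cmod (shp \<psi> f p))\<^sup>2) \<partial>shearlet_lborel) = ennreal ((l2 lborel f)\<^sup>2)"
    using sht_isometry[OF pair f C] by (subst nn_integral_shearlet_lborel) (measurable, simp add: shp_def)
  show sq: "sq_integrable shearlet_lborel (shp \<psi> f)"
    by (rule sq_integrable_nn_integral) (simp_all add: nn)
  have "(l2 shearlet_lborel (shp \<psi> f))\<^sup>2 = (l2 lborel f)\<^sup>2"
    using nn nn_integral_l2[OF sq] by simp
  then show "l2 shearlet_lborel (shp \<psi> f) = l2 lborel f"
    by (simp add: power2_eq_iff_nonneg)
qed

text \<open>\<open>heisenberg_translation\<close> is applied to the shift of t by \<epsilon> along
  axis \<open>k\<close>. Covariance and isometry identify the norm of the resulting difference with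
  that of a translation difference of \<open>f\<close>, and shrinking \<epsilon> removes the
  remainder.\<close>

lemma shearlet_heisenberg_coordinate:
  fixes \<psi> f :: "real ^ ('m::finite option) \<Rightarrow> complex"
  assumes pair: "fourier_pair \<psi> \<Psi>" and C: "radial_integral (\<lambda>x. ennreal ((cmod (\<Psi> x))\<^sup>2)) = 1"
    and f: "integrable lborel f" "sq_integrable lborel f" and B: "0 \<le> B"
    and bound: "(\<integral>\<^sup>+\<xi>. ennreal ((2 * pi * \<bar>\<xi> $ k\<bar> * cmod (fourier_L1 f \<xi>))\<^sup>2) \<partial>lborel) \<le> ennreal (B\<^sup>2)"
    and V: "sq_integrable shearlet_lborel (\<lambda>p. (snd (snd p) $ k) *\<^sub>R shp \<psi> f p)"
  shows "(l2 lborel f)\<^sup>2 \<le> 2 * (B * l2 shearlet_lborel (\<lambda>p. (snd (snd p) $ k) *\<^sub>R shp \<psi> f p))"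
proof (rule field_le_epsilon)
  fix e :: real assume e: "e > 0"
  have s: "sq_integrable lborel \<psi>" using pair by (auto simp: fourier_pair_def)
  define N where "N = l2 lborel f"
  have N: "0 \<le> N" by (simp add: N_def)
  \<comment> \<open>Chosen so that the remainder \<epsilon> B N stays below e; the added 1 keeps the
    denominator positive when B N = 0.\<close>
  define \<epsilon> where "\<epsilon> = e / (B * N + 1)"
  have BN: "0 < B * N + 1" using B N by (simp add: add_nonneg_pos)
  then have \<epsilon>: "0 < \<epsilon>" using e by (simp add: \<epsilon>_def)
  let ?T = "\<lambda>p :: real \<times> (real ^ 'm) \<times> (real ^ 'm option). (0, 0, axis k \<epsilon>) + p"
  let ?d = "\<lambda>x. f (axis k \<epsilon> + x) - f x"
  note F = shp_isometry[OF pair C f]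
  have d: "integrable lborel ?d" "sq_integrable lborel ?d"
    by (intro Bochner_Integration.integrable_diff lborel_integrable_translate sq_integrable_diff sq_integrable_translate f)+
  have "(l2 shearlet_lborel (shp \<psi> f))\<^sup>2 \<le> B * (2 * l2 shearlet_lborel (\<lambda>p. (snd (snd p) $ k) *\<^sub>R shp \<psi> f p) + \<epsilon> * l2 shearlet_lborel (shp \<psi> f))"
  proof (rule heisenberg_translation[OF _ shearlet_lborel_translate[of "axis k \<epsilon>"] _ _ \<epsilon> F(2) V])
    show "?T \<in> measurable shearlet_lborel shearlet_lborel" by measurable
    show "(\<lambda>p. snd (snd p) $ k) \<in> borel_measurable shearlet_lborel" by measurable
    show "snd (snd (?T p)) $ k = snd (snd p) $ k + \<epsilon>" for p by (simp add: axis_def)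
    have "shp \<psi> f (?T p) - shp \<psi> f p = shp \<psi> ?d p" for p
      using sht_translate_diff[OF s f(2), of "fst p" "fst (snd p)" "axis k \<epsilon>" "snd (snd p)"] by (simp add: shp_def)
    then show "l2 shearlet_lborel (\<lambda>p. shp \<psi> f (?T p) - shp \<psi> f p) \<le> \<epsilon> * B"
      using shp_isometry(3)[OF pair C d] l2_translation_difference[OF f B bound] \<epsilon> by simp
  qed
  then have "N\<^sup>2 \<le> 2 * (B * l2 shearlet_lborel (\<lambda>p. (snd (snd p) $ k) *\<^sub>R shp \<psi> f p)) + \<epsilon> * (B * N)"
    by (simp add: F(3) N_def algebra_simps)
  also have "\<epsilon> * (B * N) \<le> \<epsilon> * (B * N + 1)" using \<epsilon> by (intro mult_left_mono) auto
  also have "\<dots> = e" using BN by (simp add: \<epsilon>_def)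
  finally show "(l2 lborel f)\<^sup>2 \<le> 2 * (B * l2 shearlet_lborel (\<lambda>p. (snd (snd p) $ k) *\<^sub>R shp \<psi> f p)) + e"
    by (simp add: N_def)
qed

section \<open>An upper bound for the digamma function\<close>

text \<open>By the functional equation ln x is the increment of ln Gamma over [x, x + 1], hence
  \<open>Digamma z\<close> for some z > x by the mean value theorem; \<open>Digamma\<close> is
  increasing.\<close>

lemma Digamma_le_ln: "Digamma x \<le> ln x" if "0 < x" for x :: real
proof -
  have d: "((\<lambda>x. ln (Gamma x)) has_real_derivative Digamma y) (at y)" if "0 < y" for y :: real
    using that Gamma_real_pos[OF that]
    by (auto intro!: derivative_eq_intros elim!: nonpos_Ints_cases' simp: Gamma_eq_zero_iff)
  have "\<exists>z>x. z < x + 1 \<and> ln (Gamma (x + 1)) - ln (Gamma x) = (x + 1 - x) * Digamma z"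
    by (rule MVT2) (use that d in auto)
  then obtain z where z: "z > x" "ln (Gamma (x + 1)) - ln (Gamma x) = Digamma z" by auto
  have "x \<notin> \<int>\<^sub>\<le>\<^sub>0" using that by (auto elim!: nonpos_Ints_cases')
  then have "ln (Gamma (x + 1)) = ln (x * Gamma x)" by (simp add: Gamma_plus1)
  also have "\<dots> = ln x + ln (Gamma x)" by (rule ln_mult_pos[OF that Gamma_real_pos[OF that]])
  finally have "ln (Gamma (x + 1)) = ln x + ln (Gamma x)" .
  then have "Digamma z = ln x" using z by simp
  then show ?thesis using Digamma_real_mono[OF that less_imp_le[OF z(1)]] by simp
qed

lemma exp_deriv_Gamma_le:
  assumes "0 < x"
  shows "exp (deriv Gamma x / Gamma x) \<le> (x::real)"
proof -
  have "x \<notin> \<int>\<^sub>\<le>\<^sub>0" using assms by (auto elim!: nonpos_Ints_cases')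
  then have "deriv Gamma x = Gamma x * Digamma x"
    by (intro DERIV_imp_deriv has_field_derivative_Gamma)
  then have "exp (deriv Gamma x / Gamma x) = exp (Digamma x)"
    using Gamma_real_pos[OF assms] by simp
  also have "\<dots> \<le> exp (ln x)" using Digamma_le_ln[OF assms] by simp
  finally show ?thesis using assms by simp
qed

section \<open>From the stated objects to Borel representatives, and the conclusion\<close>

lemma test_function_measurable:
  assumes "test_function \<phi>"
  shows "\<phi> \<in> borel_measurable borel" "partial_deriv k \<phi> \<in> borel_measurable borel"
proof -
  have "foldr partial_deriv ks \<phi> \<in> borel_measurable borel" for ks
    using assms differentiable_imp_continuous_on
    by (intro borel_measurable_continuous_onI) (auto simp: test_function_def)
  from this[of "[]"] this[of "[k]"]
  show "\<phi> \<in> borel_measurable borel" "partial_deriv k \<phi> \<in> borel_measurable borel" by simp_all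
qed

text \<open>The weak gradient picked by \<open>SOME\<close> is known only to be locally integrable,
  and that gives measurability of its truncations; their pointwise limit settles the function
  itself.\<close>

lemma locally_integrable_measurable:
  fixes g :: "'a::euclidean_space \<Rightarrow> 'b::euclidean_space"
  assumes "locally_integrable g"
  shows "g \<in> borel_measurable lebesgue"
proof (rule borel_measurable_LIMSEQ_metric)
  show "(\<lambda>x. indicator (cball 0 (real n)) x *\<^sub>R g x) \<in> borel_measurable lebesgue" for n
    using assms unfolding locally_integrable_def set_integrable_def by (auto intro: borel_measurable_integrable)
  fix x :: 'a
  obtain m :: nat where m: "norm x \<le> real m" using real_arch_simple by blast
  have "\<forall>\<^sub>F n in sequentially. indicator (cball 0 (real n)) x *\<^sub>R g x = g x"
    using eventually_ge_at_top[of m]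
  proof eventually_elim
    case (elim n)
    then have "real m \<le> real n" by simp
    then have "norm x \<le> real n" using m by linarith
    then show ?case by simp
  qed
  then show "(\<lambda>n. indicator (cball 0 (real n)) x *\<^sub>R g x) \<longlonglongrightarrow> g x"
    by (rule tendsto_eventually)
qed

text \<open>Agreement off a = 0 is what \<open>shearlet_transform_eq_sht\<close> provides, and it
  suffices because \<open>shearlet_measure\<close> lives on the set where a is nonzero.\<close>

lemma shearlet_measure_nn_integral:
  fixes h h' :: "real \<times> (real ^ 'm) \<times> (real ^ ('m::finite option)) \<Rightarrow> ennreal"
  assumes h' [measurable]: "h' \<in> borel_measurable borel" and eq: "\<And>p. fst p \<noteq> 0 \<Longrightarrow> h p = h' p"
  shows "(\<integral>\<^sup>+p. h p \<partial>shearlet_measure) = (\<integral>\<^sup>+p. h' p \<partial>shearlet_lborel)"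
proof -
  let ?S = "shearlet_space :: (real \<times> (real ^ 'm) \<times> (real ^ 'm option)) set"
  let ?w = "\<lambda>p :: real \<times> (real ^ 'm) \<times> (real ^ 'm option). ennreal (1 / \<bar>fst p\<bar> ^ (CARD('m option) + 1))"
  have S: "?S = {p. fst p \<noteq> 0}" by (auto simp: shearlet_space_def)
  have [measurable]: "?S \<in> sets borel" unfolding S by measurable
  have "?S \<in> sets lborel" by simp
  then have SL: "?S \<in> sets lebesgue" by auto
  have SM: "shearlet_measure = density (lebesgue_on ?S) ?w"
    by (simp add: shearlet_measure_def case_prod_beta')
  have wm: "?w \<in> borel_measurable borel" by measurable
  have m: "g \<in> borel_measurable (lebesgue_on ?S)" if "g \<in> borel_measurable borel" for g :: "_ \<Rightarrow> ennreal"
    using lebesgue_measurable_of_borel[OF that] by (rule measurable_restrict_space1)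
  have "(\<integral>\<^sup>+p. h p \<partial>shearlet_measure) = (\<integral>\<^sup>+p. h' p \<partial>shearlet_measure)"
    unfolding SM by (intro nn_integral_cong) (auto simp: S eq)
  also have "\<dots> = (\<integral>\<^sup>+p. ?w p * h' p \<partial>lebesgue_on ?S)"
    unfolding SM by (intro nn_integral_density m wm h')
  also have "\<dots> = (\<integral>\<^sup>+p. ?w p * h' p * indicator ?S p \<partial>lebesgue)"
    using SL by (intro nn_integral_restrict_space) simp
  also have "\<dots> = (\<integral>\<^sup>+p. h' p * ?w p \<partial>lborel)"
    unfolding nn_integral_completion by (intro nn_integral_cong) (auto simp: S indicator_def mult.commute)
  also have "\<dots> = (\<integral>\<^sup>+p. h' p \<partial>shearlet_lborel)"
    by (rule nn_integral_shearlet_lborel[symmetric]) simp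
  finally show ?thesis .
qed


text \<open>Adding the coordinate inequalities counts the squared norm of \<open>f\<close> n times;
  Cauchy-Schwarz over the coordinates gathers the products on the right into one product of full
  norms.\<close>

theorem shearlet_heisenberg:
  fixes \<psi> f :: "real ^ ('m::finite option) \<Rightarrow> complex"
  assumes pair: "fourier_pair \<psi> \<Psi>" and C: "radial_integral (\<lambda>x. ennreal ((cmod (\<Psi> x))\<^sup>2)) = 1"
    and f: "integrable lborel f" "sq_integrable lborel f" and B: "\<And>k. 0 \<le> B k"
    and bound: "\<And>k. (\<integral>\<^sup>+\<xi>. ennreal ((2 * pi * \<bar>\<xi> $ k\<bar> * cmod (fourier_L1 f \<xi>))\<^sup>2) \<partial>lborel) \<le> ennreal ((B k)\<^sup>2)"
    and V: "(\<integral>\<^sup>+p. ennreal ((norm (snd (snd p)))\<^sup>2 * (cmod (shp \<psi> f p))\<^sup>2) \<partial>shearlet_lborel) = ennreal V" "0 \<le> V"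
  shows "real CARD('m option) * (l2 lborel f)\<^sup>2 \<le> 2 * (sqrt (\<Sum>k\<in>UNIV. (B k)\<^sup>2) * sqrt V)"
proof -
  have [measurable]: "shp \<psi> f \<in> borel_measurable borel" by (rule shp_isometry(1)[OF pair C f])
  define X where "X k p = (snd (snd p) $ k) *\<^sub>R shp \<psi> f p" for k and p :: "real \<times> (real ^ 'm) \<times> (real ^ 'm option)"
  have Xeq: "X k = (\<lambda>p. (snd (snd p) $ k) *\<^sub>R shp \<psi> f p)" for k
    by (simp add: X_def fun_eq_iff)
  have [measurable]: "X k \<in> borel_measurable borel" for k
    unfolding X_def[abs_def] by measurable
  have normX: "(norm (snd (snd p)))\<^sup>2 * (cmod (shp \<psi> f p))\<^sup>2 = (\<Sum>k\<in>UNIV. (cmod (X k p))\<^sup>2)" for p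
    by (simp add: X_def power_mult_distrib sum_distrib_right[symmetric] norm_vec_def L2_set_def sum_nonneg)
  have sumX: "(\<Sum>k\<in>UNIV. \<integral>\<^sup>+p. ennreal ((cmod (X k p))\<^sup>2) \<partial>shearlet_lborel) = ennreal V"
  proof -
    have "(\<Sum>k\<in>UNIV. \<integral>\<^sup>+p. ennreal ((cmod (X k p))\<^sup>2) \<partial>shearlet_lborel) = (\<integral>\<^sup>+p. (\<Sum>k\<in>UNIV. ennreal ((cmod (X k p))\<^sup>2)) \<partial>shearlet_lborel)"
      by (rule nn_integral_sum[symmetric]) measurable
    then show ?thesis using V(1) by (simp add: normX)
  qed
  have X: "sq_integrable shearlet_lborel (X k)" for k
  proof (rule sq_integrable_nn_integral)
    have "(\<integral>\<^sup>+p. ennreal ((cmod (X k p))\<^sup>2) \<partial>shearlet_lborel) \<le> (\<Sum>k\<in>UNIV. \<integral>\<^sup>+p. ennreal ((cmod (X k p))\<^sup>2) \<partial>shearlet_lborel)"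
      by (rule member_le_sum) auto
    then show "(\<integral>\<^sup>+p. ennreal ((cmod (X k p))\<^sup>2) \<partial>shearlet_lborel) < \<infinity>"
      unfolding sumX by (simp add: order_le_less_trans)
  qed simp
  have sumV: "(\<Sum>k\<in>UNIV. (l2 shearlet_lborel (X k))\<^sup>2) = V"
    using sumX V(2) by (simp add: nn_integral_l2[OF X] sum_ennreal sum_nonneg)
  have "real CARD('m option) * (l2 lborel f)\<^sup>2 = (\<Sum>k\<in>(UNIV :: 'm option set). (l2 lborel f)\<^sup>2)"
    by simp
  also have "\<dots> \<le> (\<Sum>k\<in>UNIV. 2 * (B k * l2 shearlet_lborel (X k)))"
    by (intro sum_mono, unfold Xeq, rule shearlet_heisenberg_coordinate[OF pair C f B bound X[unfolded Xeq]])
  also have "\<dots> = 2 * (\<Sum>k\<in>UNIV. B k * l2 shearlet_lborel (X k))"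
    by (simp add: sum_distrib_left)
  also have "(\<Sum>k\<in>UNIV. B k * l2 shearlet_lborel (X k)) \<le> sqrt ((\<Sum>k\<in>UNIV. (B k)\<^sup>2) * (\<Sum>k\<in>UNIV. (l2 shearlet_lborel (X k))\<^sup>2))"
    by (rule real_le_rsqrt[OF Cauchy_Schwarz_ineq_sum])
  finally show ?thesis by (simp add: sumV real_sqrt_mult)
qed

theorem theorem5p2:
  fixes \<psi> f :: "real ^ ('m::finite option) \<Rightarrow> complex"
  assumes "admissible_shearlet \<psi>"
    and "admissibility_constant \<psi> = 1"
    and "f \<in> sobolev_H \<inter> weighted_Lp 1 1"
    and "\<not> (AE x in lebesgue. f x = 0)"
    and "integrable shearlet_measure
           (\<lambda>(a, s, t). (norm t)\<^sup>2 * (cmod (shearlet_transform \<psi> f a s t))\<^sup>2)"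
  shows "(\<integral>(a, s, t). (norm t)\<^sup>2 * (cmod (shearlet_transform \<psi> f a s t))\<^sup>2 \<partial>shearlet_measure)
         \<ge> 2 / L2_norm (weak_gradient f)
             * exp (deriv Gamma (real CARD('m option) / 2) / Gamma (real CARD('m option) / 2))
             * L2_norm f ^ 3
           - (L2_norm f)\<^sup>2"
proof -
  let ?n = "real CARD('m option)"
  define g where "g = weak_gradient f"
  define N where "N = L2_norm f"
  define G where "G = L2_norm g"
  define V where "V = (\<integral>(a, s, t). (norm t)\<^sup>2 * (cmod (shearlet_transform \<psi> f a s t))\<^sup>2 \<partial>shearlet_measure)"
  have V0: "0 \<le> V" unfolding V_def by (intro integral_nonneg_AE AE_I2) auto
  have N0: "0 \<le> N" and G0: "0 \<le> G" by (simp_all add: N_def G_def L2_norm_eq_l2)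
  have "2 / G * exp (deriv Gamma (?n / 2) / Gamma (?n / 2)) * N ^ 3 - N\<^sup>2 \<le> V"
  proof (cases "G = 0")
    \<comment> \<open>This also covers a non-integrable \<open>|g|\<^sup>2\<close>: then \<open>G = sqrt 0\<close>, and \<open>2 / 0 = 0\<close>.\<close>
    case True
    then show ?thesis using V0 by (simp add: order_trans[of _ 0])
  next
    case False
    then have G: "0 < G" using G0 by simp
    have "\<exists>g. has_weak_gradient f g" using assms(3) by (auto simp: sobolev_H_def)
    then have wg: "has_weak_gradient f g"
      unfolding g_def weak_gradient_def by (rule someI_ex)
    have gm: "g \<in> borel_measurable lebesgue"
      using wg by (auto simp: has_weak_gradient_def intro: locally_integrable_measurable)
    \<comment> \<open>The representative picked by \<open>SOME\<close> is so far only locally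
      integrable. Square integrability is read off from \<open>G \<noteq> 0\<close>, because the
      integral of a non-integrable function is 0.\<close>
    have gi: "integrable lebesgue (\<lambda>x. (norm (g x))\<^sup>2)"
      using False unfolding G_def L2_norm_def by (metis not_integrable_integral_eq real_sqrt_zero)
    have \<psi>2: "\<psi> \<in> Lp 2" using assms(1) by (simp add: admissible_shearlet_def)
    have fL: "f \<in> Lp 2" "f \<in> Lp 1" using assms(3) by (auto simp: sobolev_H_def weighted_Lp_def)
    have fm: "f \<in> borel_measurable lebesgue" using fL by (simp add: Lp_def)
    obtain f' where f': "f' \<in> borel_measurable borel" "AE x in lborel. f x = f' x"
      by (rule lebesgue_borel_representative[OF fm])
    have f1: "integrable lborel f'" and f2: "sq_integrable lborel f'" and fN: "l2 lborel f' = N"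
      using lebesgue_integral_representative(1)[OF fm f'] l2_representative[OF fm f'] fL
      by (simp_all add: Lp1_iff Lp2_iff N_def L2_norm_eq_l2)
    have F\<psi>: "is_fourier_L2 \<psi> (fourier_L2 \<psi>)"
      unfolding fourier_L2_def by (rule someI_ex[OF is_fourier_L2_exists[OF \<psi>2]])
    have \<psi>m: "\<psi> \<in> borel_measurable lebesgue" "fourier_L2 \<psi> \<in> borel_measurable lebesgue"
      using F\<psi> by (auto simp: is_fourier_L2_def Lp_def)
    obtain \<psi>' where \<psi>': "\<psi>' \<in> borel_measurable borel" "AE x in lborel. \<psi> x = \<psi>' x"
      by (rule lebesgue_borel_representative[OF \<psi>m(1)])
    obtain \<Psi> where \<Psi>: "\<Psi> \<in> borel_measurable borel" "AE x in lborel. fourier_L2 \<psi> x = \<Psi> x"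
      by (rule lebesgue_borel_representative[OF \<psi>m(2)])
    have pair: "fourier_pair \<psi>' \<Psi>" by (rule is_fourier_L2_pair[OF F\<psi> \<psi>' \<Psi>])
    have C: "radial_integral (\<lambda>x. ennreal ((cmod (\<Psi> x))\<^sup>2)) = 1"
      using admissibility_constant_eq[OF \<Psi>] assms(2) by simp
    have gk: "(\<lambda>x. g x $ k) \<in> borel_measurable lebesgue" for k
    proof -
      have "(\<lambda>v :: complex ^ 'm option. v $ k) \<in> borel_measurable borel"
        by (intro borel_measurable_continuous_onI continuous_intros)
      then show ?thesis by (rule measurable_compose[OF gm])
    qed
    \<comment> \<open>Each component of the gradient gets its own Borel representative; their norms
      serve as the bounds \<open>B k\<close> of \<open>shearlet_heisenberg\<close>, and the squares
      add up to \<open>G\<^sup>2\<close>.\<close>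
    have "\<forall>k. \<exists>h. h \<in> borel_measurable borel \<and> (AE x in lborel. g x $ k = h x)"
      using lebesgue_borel_representative[OF gk] by metis
    then obtain h where h: "\<And>k. h k \<in> borel_measurable borel" "\<And>k. AE x in lborel. g x $ k = h k x"
      by metis
    have gs: "sq_integrable lebesgue (\<lambda>x. g x $ k)" for k
      by (rule sq_integrable_bound[OF sq_integrableI[OF gm gi] gk, where c = 1]) (simp add: Finite_Cartesian_Product.norm_nth_le)
    have hs: "sq_integrable lborel (h k)" for k
      using l2_representative(1)[OF gk h] gs by simp
    have sumG: "(\<Sum>k\<in>UNIV. (l2 lborel (h k))\<^sup>2) = G\<^sup>2"
    proof -
      have "(\<Sum>k\<in>UNIV. (l2 lborel (h k))\<^sup>2) = (\<Sum>k\<in>UNIV. \<integral>x. (cmod (g x $ k))\<^sup>2 \<partial>lebesgue)"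
        by (simp only: l2_representative(2)[OF gk h, symmetric] l2_power2)
      also have "\<dots> = (\<integral>x. (\<Sum>k\<in>UNIV. (cmod (g x $ k))\<^sup>2) \<partial>lebesgue)"
        by (rule Bochner_Integration.integral_sum[symmetric]) (rule sq_integrableD[OF gs])
      also have "\<dots> = G\<^sup>2"
        unfolding G_def L2_norm_eq_l2 l2_power2 by (simp add: norm_vec_def L2_set_def sum_nonneg)
      finally show ?thesis .
    qed
    have weak: "(\<integral>x. partial_deriv k \<phi> x *\<^sub>R f' x \<partial>lborel) = - (\<integral>x. \<phi> x *\<^sub>R h k x \<partial>lborel)"
      if \<phi>: "test_function \<phi>" for \<phi> k
    proof -
      have eq: "(\<integral>x. q x *\<^sub>R u x \<partial>lebesgue) = (\<integral>x. q x *\<^sub>R u' x \<partial>lborel)"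
        if [measurable]: "q \<in> borel_measurable borel" "u' \<in> borel_measurable borel" and ae: "AE x in lborel. u x = u' x"
        for q :: "_ \<Rightarrow> real" and u u' :: "real ^ 'm option \<Rightarrow> complex"
      proof -
        have m: "(\<lambda>x. q x *\<^sub>R u' x) \<in> borel_measurable borel" by measurable
        have a: "AE x in lborel. q x *\<^sub>R u x = q x *\<^sub>R u' x" using ae by eventually_elim simp
        show ?thesis by (rule lebesgue_integral_representative(2)[OF measurable_lebesgue_AE[OF m a] m a])
      qed
      have "(\<integral>x. partial_deriv k \<phi> x *\<^sub>R f x \<partial>lebesgue) = - (\<integral>x. \<phi> x *\<^sub>R (g x $ k) \<partial>lebesgue)"
        using wg \<phi> by (simp add: has_weak_gradient_def)
      then show ?thesis
        by (simp only: eq[OF test_function_measurable(2)[OF \<phi>] f'] eq[OF test_function_measurable(1)[OF \<phi>] h])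
    qed
    have nnV: "(\<integral>\<^sup>+p. ennreal ((norm (snd (snd p)))\<^sup>2 * (cmod (shp \<psi>' f' p))\<^sup>2) \<partial>shearlet_lborel) = ennreal V"
    proof -
      have m: "(\<lambda>p. ennreal ((norm (snd (snd p)))\<^sup>2 * (cmod (shp \<psi>' f' p))\<^sup>2)) \<in> borel_measurable borel"
        using shp_isometry(1)[OF pair C f1 f2] by measurable
      \<comment> \<open>Here it enters that the left-hand side is defined: integrability equates the
        Bochner integral with a nonnegative integral, which is therefore finite.\<close>
      have "(\<integral>\<^sup>+p. ennreal (case p of (a, s, t) \<Rightarrow> (norm t)\<^sup>2 * (cmod (shearlet_transform \<psi> f a s t))\<^sup>2) \<partial>shearlet_measure) = ennreal V"
        unfolding V_def by (rule nn_integral_eq_integral[OF assms(5)]) auto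
      moreover have "(\<integral>\<^sup>+p. ennreal (case p of (a, s, t) \<Rightarrow> (norm t)\<^sup>2 * (cmod (shearlet_transform \<psi> f a s t))\<^sup>2) \<partial>shearlet_measure)
         = (\<integral>\<^sup>+p. ennreal ((norm (snd (snd p)))\<^sup>2 * (cmod (shp \<psi>' f' p))\<^sup>2) \<partial>shearlet_lborel)"
        by (rule shearlet_measure_nn_integral[OF m]) (auto simp: shp_def shearlet_transform_eq_sht[OF \<psi>' f'])
      ultimately show ?thesis by simp
    qed
    have H: "?n * N\<^sup>2 \<le> 2 * (G * sqrt V)"
      using shearlet_heisenberg[OF pair C f1 f2 l2_nonneg weak_derivative_fourier_bound[OF f1 hs weak] nnV V0] G0
      by (simp only: fN sumG real_sqrt_abs abs_of_nonneg)
    \<comment> \<open>Splitting N^3 / G into N^2 times N / G lets the bound \<open>H\<close> cancel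
      G.\<close>
    have "2 / G * exp (deriv Gamma (?n / 2) / Gamma (?n / 2)) * N ^ 3 \<le> 2 / G * (?n / 2) * N ^ 3"
      using G N0 by (intro mult_right_mono mult_left_mono exp_deriv_Gamma_le) auto
    also have "\<dots> = (?n * N\<^sup>2) * (N / G)"
    proof -
      have "2 / G * (n / 2) * N ^ 3 = (n * N\<^sup>2) * (N / G)" for n
        by (simp add: power2_eq_square power3_eq_cube)
      then show ?thesis .
    qed
    also have "\<dots> \<le> (2 * (G * sqrt V)) * (N / G)"
      using H G N0 by (intro mult_right_mono) auto
    also have "\<dots> = 2 * sqrt V * N" using G by simp
    also have "\<dots> \<le> (sqrt V)\<^sup>2 + N\<^sup>2" by (rule sum_squares_bound)
    also have "\<dots> = V + N\<^sup>2" using V0 by simp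
    finally show ?thesis by simp
  qed
  then show ?thesis unfolding V_def N_def G_def g_def .
qed

end
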